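(* Let $T$ be a weakly mixing automorphism of a standard probability space $(X,\mu)$ which is a Poisson suspension or a Gaussian suspension. Then its weak homoclinic group $$WH(T)=\Big\{S\in G:\ \frac1N\sum_{n=1}^{N}T^{-n}ST^{n}\to I,\ N\to\infty\Big\}$$ is ergodic, where $G$ is the group of all automorphisms of $(X,\mu)$.
   Context: $G$ is the group of all automorphisms of the standard probability space $(X,\mu)$ on which $T$ acts, i.e. invertible bi-measurable $\mu$-preserving transformations, identified when equal $\mu$-a.e.; $I$ is the identity. Automorphisms are associated with the corresponding (Koopman) unitary operators on $L_2(X,\mu)$; in the definition of $WH(T)$ the averages of the operators corresponding to the automorphisms $T^{-n}\circ S\circ T^{n}$ are required to converge to the identity operator in the strong operator topology of $L_2(X,\mu)$. A subgroup $H\subset G$ is ergodic if every measurable $A$ with $\mu(SA\,\triangle\,A)=0$ for all $S\in H$ satisfies $\mu(A)\in\{0,1\}$. Poisson suspension: let $T_0$ be an automorphism (invertible measure-preserving transformation) of a standard non-atomic $\sigma$-finite infinite measure space $(Y,m)$. Let $Y_*$ be the space of countable subsets (configurations) of $Y$ that are finite on a fixed exhausting sequence of finite-measure sets, equipped with the Poisson probability measure $m_*$: for disjoint finite-measure sets $A_1,\dots,A_r$ the counts $\omega\mapsto|\omega\cap A_i|$ are independent Poisson random variables with means $m(A_i)$. The Poisson suspension of $T_0$ is the automorphism of $(Y_*,m_* )$ given by $\omega\mapsto T_0\omega=\{T_0y:y\in\omega\}$. Gaussian suspension: let $\gamma$ be the product of standard Gaussian measures on $\mathbb{R}^{\mathbb{N}}$,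 and for $h\in \ell_2$ (real) put $\xi_h(x)=\sum_i h_ix_i\in L_2(\gamma)$. For each orthogonal operator $U$ on real $\ell_2$ there is a unique (mod $0$) automorphism $T_U$ of $(\mathbb{R}^{\mathbb{N}},\gamma)$ with $\xi_h\circ T_U=\xi_{U^{-1}h}$ for all $h\in\ell_2$. Gaussian suspensions (Gaussian automorphisms) are the automorphisms $T_U$. *)

theory Defs
  imports "HOL-Probability.Probability"
begin

section \<open>Automorphisms modulo null sets\<close>

text \<open>
  Transformations are represented by total functions.  Invertibility and all identities
  between transformations are understood almost everywhere, so that a point of the group of
  automorphisms corresponds to an a.e.-equality class of functions satisfying
  \<open>automorphism\<close>.
\<close>

definition ae_inverse :: "'a measure \<Rightarrow> ('a \<Rightarrow> 'a) \<Rightarrow> ('a \<Rightarrow> 'a) \<Rightarrow> bool" where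
  "ae_inverse M S S' \<longleftrightarrow>
     S' \<in> measurable M M \<and> (AE x in M. S' (S x) = x) \<and> (AE x in M. S (S' x) = x)"

definition automorphism :: "'a measure \<Rightarrow> ('a \<Rightarrow> 'a) \<Rightarrow> bool" where
  "automorphism M S \<longleftrightarrow>
     S \<in> measurable M M \<and> distr M M S = M \<and> (\<exists>S'. ae_inverse M S S')"

text \<open>For an automorphism the following is a representative of the (a.e. unique) inverse.\<close>

definition aut_inv :: "'a measure \<Rightarrow> ('a \<Rightarrow> 'a) \<Rightarrow> ('a \<Rightarrow> 'a)" where
  "aut_inv M S = (SOME S'. ae_inverse M S S')"

definition isomorphic_mod0 ::
  "'a measure \<Rightarrow> ('a \<Rightarrow> 'a) \<Rightarrow> 'b measure \<Rightarrow> ('b \<Rightarrow> 'b) \<Rightarrow> bool" where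
  "isomorphic_mod0 M T N R \<longleftrightarrow>
     (\<exists>f\<in>measurable M N. \<exists>g\<in>measurable N M.
        distr M N f = N \<and> distr N M g = M \<and>
        (AE x in M. g (f x) = x) \<and> (AE y in N. f (g y) = y) \<and>
        (AE x in M. f (T x) = R (f x)))"

text \<open>A set of representatives, closed under a.e. equality, that is a subgroup of the group of
  automorphisms.\<close>

definition aut_subgroup :: "'a measure \<Rightarrow> ('a \<Rightarrow> 'a) set \<Rightarrow> bool" where
  "aut_subgroup M H \<longleftrightarrow>
     (\<forall>S\<in>H. automorphism M S) \<and>
     (\<forall>S\<in>H. \<forall>R. automorphism M R \<and> (AE x in M. R x = S x) \<longrightarrow> R \<in> H) \<and>
     id \<in> H \<and>
     (\<forall>S\<in>H. \<forall>R\<in>H. S \<circ> R \<in> H) \<and>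
     (\<forall>S\<in>H. aut_inv M S \<in> H)"

text \<open>The image \<open>SA\<close> is the preimage of \<open>A\<close> under the inverse of \<open>S\<close>;
  for an a.e. invertible function the pointwise image might fail to be measurable.\<close>

definition aut_image :: "'a measure \<Rightarrow> ('a \<Rightarrow> 'a) \<Rightarrow> 'a set \<Rightarrow> 'a set" where
  "aut_image M S A = aut_inv M S -` A \<inter> space M"

definition ergodic_subgroup :: "'a measure \<Rightarrow> ('a \<Rightarrow> 'a) set \<Rightarrow> bool" where
  "ergodic_subgroup M H \<longleftrightarrow>
     aut_subgroup M H \<and>
     (\<forall>A\<in>sets M. (\<forall>S\<in>H. emeasure M (sym_diff (aut_image M S A) A) = 0) \<longrightarrow>
        measure M A = 0 \<or> measure M A = 1)"

definition weakly_mixing :: "'a measure \<Rightarrow> ('a \<Rightarrow> 'a) \<Rightarrow> bool" where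
  "weakly_mixing M T \<longleftrightarrow>
     (\<forall>A\<in>sets M. \<forall>B\<in>sets M.
        (\<lambda>N. (\<Sum>n<N. \<bar>measure M (((T ^^ n) -` A \<inter> space M) \<inter> B)
                        - measure M A * measure M B\<bar>) / real N) \<longlonglongrightarrow> 0)"


section \<open>The weak homoclinic group\<close>

definition sq_int :: "'a measure \<Rightarrow> ('a \<Rightarrow> complex) set" where
  "sq_int M = {f \<in> borel_measurable M. integrable M (\<lambda>x. (cmod (f x))\<^sup>2)}"

definition l2norm :: "'a measure \<Rightarrow> ('a \<Rightarrow> complex) \<Rightarrow> real" where
  "l2norm M f = sqrt (\<integral>x. (cmod (f x))\<^sup>2 \<partial>M)"

definition koopman :: "('a \<Rightarrow> 'a) \<Rightarrow> ('a \<Rightarrow> complex) \<Rightarrow> ('a \<Rightarrow> complex)" where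
  "koopman S f = f \<circ> S"

definition weak_homoclinic :: "'a measure \<Rightarrow> ('a \<Rightarrow> 'a) \<Rightarrow> ('a \<Rightarrow> 'a) set" where
  "weak_homoclinic M T =
     {S. automorphism M S \<and>
        (\<forall>f\<in>sq_int M.
           (\<lambda>N. l2norm M (\<lambda>x.
              (\<Sum>n=1..N. koopman ((aut_inv M T ^^ n) \<circ> S \<circ> (T ^^ n)) f x) / of_nat N
                - koopman id f x)) \<longlonglongrightarrow> 0)}"


section \<open>Standard measure spaces\<close>

text \<open>A standard Borel space: Borel isomorphic to a Borel subset of the real line.\<close>

definition standard_borel :: "'a measure \<Rightarrow> bool" where
  "standard_borel M \<longleftrightarrow>
     (\<exists>B\<in>sets (borel :: real measure). \<exists>f g.
        f \<in> measurable M (restrict_space borel B) \<and>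
        g \<in> measurable (restrict_space borel B) M \<and>
        (\<forall>x\<in>space M. g (f x) = x) \<and> (\<forall>y\<in>B. f (g y) = y))"

definition standard_probability_space :: "'a measure \<Rightarrow> bool" where
  "standard_probability_space M \<longleftrightarrow> standard_borel M \<and> prob_space M"

definition non_atomic :: "'a measure \<Rightarrow> bool" where
  "non_atomic M \<longleftrightarrow>
     (\<forall>A\<in>sets M. emeasure M A > 0 \<longrightarrow>
        (\<exists>B\<in>sets M. B \<subseteq> A \<and> 0 < emeasure M B \<and> emeasure M B < emeasure M A))"

definition standard_infinite_space :: "'a measure \<Rightarrow> bool" where
  "standard_infinite_space M \<longleftrightarrow>
     standard_borel M \<and> non_atomic M \<and> sigma_finite_measure M \<and> emeasure M (space M) = \<infinity>"


section \<open>Poisson suspensions\<close>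

definition exhausting :: "'y measure \<Rightarrow> (nat \<Rightarrow> 'y set) \<Rightarrow> bool" where
  "exhausting Y E \<longleftrightarrow>
     range E \<subseteq> sets Y \<and> incseq E \<and> (\<Union>n. E n) = space Y \<and> (\<forall>n. emeasure Y (E n) < \<infinity>)"

definition configurations :: "'y measure \<Rightarrow> (nat \<Rightarrow> 'y set) \<Rightarrow> 'y set set" where
  "configurations Y E = {\<omega>. \<omega> \<subseteq> space Y \<and> countable \<omega> \<and> (\<forall>n. finite (\<omega> \<inter> E n))}"

text \<open>The \<open>\<sigma>\<close>-algebra generated by the counts.  As \<open>card\<close> is \<open>0\<close> on infinite sets, finiteness
  of \<open>\<omega> \<inter> A\<close> (which for a set \<open>A\<close> of finite measure holds only almost surely) is part of
  the generating events.\<close>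

definition count_event :: "'y measure \<Rightarrow> (nat \<Rightarrow> 'y set) \<Rightarrow> 'y set \<Rightarrow> nat \<Rightarrow> 'y set set" where
  "count_event Y E A k = {\<omega> \<in> configurations Y E. finite (\<omega> \<inter> A) \<and> card (\<omega> \<inter> A) = k}"

definition config_space :: "'y measure \<Rightarrow> (nat \<Rightarrow> 'y set) \<Rightarrow> 'y set measure" where
  "config_space Y E =
     sigma (configurations Y E)
       {count_event Y E A k | A k. A \<in> sets Y \<and> emeasure Y A < \<infinity>}"

definition poisson_measure ::
  "'y measure \<Rightarrow> (nat \<Rightarrow> 'y set) \<Rightarrow> 'y set measure \<Rightarrow> bool" where
  "poisson_measure Y E P \<longleftrightarrow>
     space P = configurations Y E \<and>
     sets P = sets (config_space Y E) \<and>
     prob_space P \<and>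
     (\<forall>A\<in>sets Y. emeasure Y A < \<infinity> \<longrightarrow>
        (\<forall>k. measure P (count_event Y E A k)
              = measure Y A ^ k / fact k * exp (- measure Y A))) \<and>
     (\<forall>r (A :: nat \<Rightarrow> 'y set).
        (\<forall>i<r. A i \<in> sets Y \<and> emeasure Y (A i) < \<infinity>) \<and> disjoint_family_on A {..<r} \<longrightarrow>
        prob_space.indep_vars P (\<lambda>_. count_space UNIV) (\<lambda>i \<omega>. card (\<omega> \<inter> A i)) {..<r})"

text \<open>\<open>T\<close> is (isomorphic mod 0 to) the Poisson suspension of \<open>T0\<close>.  The image of a configuration
  under \<open>T0\<close> is a configuration only almost surely, so the suspension is an automorphism of the
  configuration space that a.e. coincides with \<open>\<omega> \<mapsto> T0 ` \<omega>\<close>.\<close>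

definition poisson_suspension_of ::
  "'y measure \<Rightarrow> ('y \<Rightarrow> 'y) \<Rightarrow> 'x measure \<Rightarrow> ('x \<Rightarrow> 'x) \<Rightarrow> bool" where
  "poisson_suspension_of Y T0 M T \<longleftrightarrow>
     (\<exists>E P R. exhausting Y E \<and> poisson_measure Y E P \<and>
        automorphism P R \<and> (AE \<omega> in P. R \<omega> = T0 ` \<omega>) \<and>
        isomorphic_mod0 M T P R)"


section \<open>Gaussian suspensions\<close>

definition gauss :: "(nat \<Rightarrow> real) measure" where
  "gauss = PiM UNIV (\<lambda>_. density lborel (\<lambda>x. ennreal (std_normal_density x)))"

definition ell2 :: "(nat \<Rightarrow> real) set" where
  "ell2 = {h. summable (\<lambda>i. (h i)\<^sup>2)}"

definition ell2_orthogonal :: "((nat \<Rightarrow> real) \<Rightarrow> (nat \<Rightarrow> real)) \<Rightarrow> bool" where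
  "ell2_orthogonal U \<longleftrightarrow>
     U ` ell2 = ell2 \<and>
     (\<forall>h\<in>ell2. \<forall>k\<in>ell2. \<forall>a b.
        U (\<lambda>i. a * h i + b * k i) = (\<lambda>i. a * U h i + b * U k i)) \<and>
     (\<forall>h\<in>ell2. \<forall>k\<in>ell2. (\<Sum>i. U h i * U k i) = (\<Sum>i. h i * k i))"

text \<open>A representative of \<open>\<xi>\<^sub>h = (\<Sum>i. h\<^sub>i x\<^sub>i)\<close>, the series being convergent in \<open>L\<^sub>2\<close>; it exists
  and is a.e. unique for every \<open>h\<close> in \<open>ell2\<close>.\<close>

definition gauss_xi :: "(nat \<Rightarrow> real) \<Rightarrow> (nat \<Rightarrow> real) \<Rightarrow> real" where
  "gauss_xi h = (SOME F. F \<in> borel_measurable gauss \<and> integrable gauss (\<lambda>x. (F x)\<^sup>2) \<and>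
     (\<lambda>n. \<integral>x. ((\<Sum>i<n. h i * x i) - F x)\<^sup>2 \<partial>gauss) \<longlonglongrightarrow> 0)"

text \<open>\<open>T\<close> is (isomorphic mod 0 to) the Gaussian automorphism defined by \<open>U\<close>.\<close>

definition gaussian_suspension_of ::
  "((nat \<Rightarrow> real) \<Rightarrow> (nat \<Rightarrow> real)) \<Rightarrow> 'x measure \<Rightarrow> ('x \<Rightarrow> 'x) \<Rightarrow> bool" where
  "gaussian_suspension_of U M T \<longleftrightarrow>
     (\<exists>R. automorphism gauss R \<and>
        (\<forall>h\<in>ell2. AE x in gauss. gauss_xi h (R x) = gauss_xi (inv_into ell2 U h) x) \<and>
        isomorphic_mod0 M T gauss R)"

end

theory Submission
  imports Defs
begin

text \<open>
  Membership of \<open>S\<close> in the weak homoclinic group means that, for every measurable set \<open>A\<close>, the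
  displacement \<open>\<mu>(S\<^sup>-\<^sup>1 (T\<^sup>n A) \<triangle> T\<^sup>n A)\<close> tends to zero on average over \<open>n\<close> (\<open>weak_homoclinic_iff\<close>).  In this
  form the group properties are immediate, and it suffices to check the condition on generators of
  the \<open>\<sigma>\<close>-algebra (\<open>weak_homoclinicI_generated\<close>).  Ergodicity follows as soon as the group contains a
  sequence \<open>S\<^sub>j\<close> with \<open>\<mu>(A \<inter> S\<^sub>j\<^sup>-\<^sup>1 B) \<longlonglongrightarrow> \<mu>(A) \<mu>(B)\<close> for all \<open>A\<close>, \<open>B\<close>, because an invariant set then satisfies
  \<open>\<mu>(A) = \<mu>(A)\<^sup>2\<close> (\<open>ergodic_weak_homoclinicI\<close>).  The mixing property, too, need only be checked on
  generators, if these are closed under intersection.  In both cases of the theorem the \<open>S\<^sub>j\<close> are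
  suspensions of maps that affect only a bounded part of the base and move the \<open>j\<close>-th member of an
  exhaustion of it away from itself.

  For a Poisson suspension, the generators are the events that a set of finite measure contains no
  point of the configuration.  Weak mixing makes \<open>m(T\<^sub>0\<^sup>-\<^sup>n D \<inter> C)\<close> vanish on average (\<open>overlaps_vanish\<close>).
  Thus a power of \<open>T\<^sub>0\<close> moves a given set of finite measure almost off itself, which yields an
  involution \<open>s\<^sub>j\<close> supported in a set of finite measure that sends almost all of \<open>E j\<close> outside \<open>E j\<close>
  (\<open>swap_automorphism\<close>, \<open>swap_exists\<close>).  Its suspension is weakly homoclinic, since \<open>T\<^sub>0\<^sup>n C\<close> is on average
  almost disjoint from the support of \<open>s\<^sub>j\<close>, and the suspensions mix, since avoiding disjoint sets are
  independent events.

  For a Gaussian suspension, \<open>S\<^sub>j\<close> exchanges the first \<open>j\<close> coordinates with the next \<open>j\<close> ones.  Mixing is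
  evident for events that depend on finitely many coordinates.  Weak mixing, extended from sets to
  square-integrable functions, says that each matrix entry of \<open>U\<^sup>n\<close> vanishes on average
  (\<open>matrix_entries_vanish\<close>).  So the vector \<open>h = U\<^sup>n e\<^sub>i\<close> has on average almost no mass on the exchanged
  coordinates, hence \<open>S\<^sub>j\<close> barely changes the variable \<open>\<xi>\<^sub>h\<close>, and therefore barely moves the half-spaces
  that it defines (\<open>exchange_coords_homoclinic\<close>).
\<close>

section \<open>Sequences with vanishing averages\<close>

text \<open>
  The averages run over \<open>1..N\<close> as in the definition of the weak homoclinic group, whereas weak
  mixing averages over \<open>{..<N}\<close>; \<open>cesaro_nullI_lessThan\<close> passes from the latter to the former.
\<close>

definition cesaro_null :: "(nat \<Rightarrow> real) \<Rightarrow> bool" where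
  "cesaro_null a \<longleftrightarrow> (\<lambda>N. (\<Sum>n=1..N. a n) / real N) \<longlonglongrightarrow> 0"

lemma cesaro_null_mono:
  assumes "cesaro_null b" "\<And>n. 0 \<le> a n" "\<And>n. a n \<le> b n"
  shows "cesaro_null a"
  unfolding cesaro_null_def
proof (rule tendsto_sandwich[OF _ _ tendsto_const assms(1)[unfolded cesaro_null_def]])
  show "\<forall>\<^sub>F N in sequentially. 0 \<le> (\<Sum>n=1..N. a n) / real N"
    by (intro always_eventually allI divide_nonneg_nonneg sum_nonneg assms) auto
  show "\<forall>\<^sub>F N in sequentially. (\<Sum>n=1..N. a n) / real N \<le> (\<Sum>n=1..N. b n) / real N"
    by (intro always_eventually allI divide_right_mono sum_mono assms) auto
qed

lemma cesaro_null_add: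
  assumes "cesaro_null a" "cesaro_null b"
  shows "cesaro_null (\<lambda>n. a n + b n)"
  using tendsto_add[OF assms[unfolded cesaro_null_def]]
  by (simp add: cesaro_null_def sum.distrib add_divide_distrib)

lemma cesaro_null_cmult:
  assumes "cesaro_null a"
  shows "cesaro_null (\<lambda>n. c * a n)"
  using tendsto_mult_left[OF assms[unfolded cesaro_null_def], of c]
  by (simp add: cesaro_null_def sum_distrib_left[symmetric])

lemma cesaro_null_zero: "cesaro_null (\<lambda>n. 0)"
  by (simp add: cesaro_null_def)

lemma cesaro_null_sum:
  assumes "\<And>i. i \<in> I \<Longrightarrow> cesaro_null (a i)"
  shows "cesaro_null (\<lambda>n. \<Sum>i\<in>I. a i n)"
  using assms
  by (induction I rule: infinite_finite_induct) (auto intro: cesaro_null_add cesaro_null_zero)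

text \<open>
  The common form of the approximation arguments for averages (of functions by simple functions, of
  countable unions by finite ones, of hyperplanes by thin slabs): the error \<open>e\<close> is uniform in \<open>n\<close>.
\<close>

lemma cesaro_null_approx:
  assumes nonneg: "\<And>n. 0 \<le> a n"
    and approx: "\<And>e. e > 0 \<Longrightarrow> \<exists>b. cesaro_null b \<and> (\<forall>n. a n \<le> b n + e)"
  shows "cesaro_null a"
  unfolding cesaro_null_def
proof (rule LIMSEQ_I)
  fix r :: real assume "r > 0"
  then obtain b where b: "cesaro_null b" "\<And>n. a n \<le> b n + r / 2"
    using approx[of "r / 2"] by auto
  obtain N0 where N0: "\<And>N. N \<ge> N0 \<Longrightarrow> \<bar>(\<Sum>n=1..N. b n) / real N\<bar> < r / 2"
    using LIMSEQ_D[OF b(1)[unfolded cesaro_null_def], of "r / 2"] \<open>r > 0\<close> by auto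
  have "norm ((\<Sum>n=1..N. a n) / real N - 0) < r" if "N \<ge> max 1 N0" for N
  proof -
    have "(\<Sum>n=1..N. a n) \<le> (\<Sum>n=1..N. b n) + real N * (r / 2)"
      using sum_mono[of "{1..N}" a "\<lambda>n. b n + r / 2"] b(2) by (simp add: sum.distrib)
    then have "(\<Sum>n=1..N. a n) / real N \<le> (\<Sum>n=1..N. b n) / real N + r / 2"
      using that by (simp add: field_simps)
    moreover have "0 \<le> (\<Sum>n=1..N. a n) / real N"
      by (intro divide_nonneg_nonneg sum_nonneg nonneg) auto
    moreover have "\<bar>(\<Sum>n=1..N. b n) / real N\<bar> < r / 2"
      using N0[of N] that by simp
    ultimately show ?thesis
      unfolding real_norm_def by linarith
  qed
  then show "\<exists>no. \<forall>n\<ge>no. norm ((\<Sum>n=1..n. a n) / real n - 0) < r"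
    by blast
qed

lemma cesaro_null_small:
  assumes "cesaro_null a" "e > 0"
  shows "\<exists>n. a n < e"
proof (rule ccontr)
  assume "\<not> (\<exists>n. a n < e)"
  then have ge: "\<And>n. e \<le> a n" by (meson not_less)
  obtain N0 where N0: "\<And>N. N \<ge> N0 \<Longrightarrow> \<bar>(\<Sum>n=1..N. a n) / real N\<bar> < e"
    using LIMSEQ_D[OF assms(1)[unfolded cesaro_null_def] assms(2)] by auto
  have "real (Suc N0) * e \<le> (\<Sum>n=1..Suc N0. a n)"
    using sum_mono[of "{1..Suc N0}" "\<lambda>_. e" a] ge by simp
  then have "e \<le> (\<Sum>n=1..Suc N0. a n) / real (Suc N0)"
    by (simp add: field_simps)
  with N0[OF le_SucI[OF order_refl]] show False by linarith
qed

lemma cesaro_nullI_lessThan: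
  assumes "(\<lambda>N. (\<Sum>n<N. a n) / real N) \<longlonglongrightarrow> 0" "\<And>n. 0 \<le> a n"
  shows "cesaro_null a"
  unfolding cesaro_null_def
proof (rule tendsto_sandwich[OF _ _ tendsto_const])
  show "\<forall>\<^sub>F N in sequentially. 0 \<le> (\<Sum>n=1..N. a n) / real N"
    by (intro always_eventually allI divide_nonneg_nonneg sum_nonneg assms) auto
  show "(\<lambda>N. 2 * ((\<Sum>n<Suc N. a n) / real (Suc N))) \<longlonglongrightarrow> 0"
    using tendsto_mult_left[OF LIMSEQ_Suc[OF assms(1)], of 2] by simp
  have "(\<Sum>n=1..N. a n) / real N \<le> 2 * ((\<Sum>n<Suc N. a n) / real (Suc N))" if "N \<ge> 1" for N
  proof -
    have "(\<Sum>n=1..N. a n) \<le> (\<Sum>n<Suc N. a n)"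
      by (intro sum_mono2) (auto simp: assms)
    moreover have "0 \<le> (\<Sum>n<Suc N. a n)"
      by (intro sum_nonneg assms)
    moreover have "1 / real N \<le> 2 / real (Suc N)"
      using that by (simp add: field_simps)
    ultimately have "(\<Sum>n=1..N. a n) * (1 / real N) \<le> (\<Sum>n<Suc N. a n) * (2 / real (Suc N))"
      by (intro mult_mono) auto
    then show ?thesis by (simp add: field_simps)
  qed
  then show "\<forall>\<^sub>F N in sequentially. (\<Sum>n=1..N. a n) / real N
      \<le> 2 * ((\<Sum>n<Suc N. a n) / real (Suc N))"
    using eventually_sequentially by blast
qed

section \<open>Automorphisms\<close>

text \<open>
  The property \<open>Q\<close> need not be a measurable one, because a null set that contains the exceptions
  can be pulled back instead.
\<close>

lemma AE_measure_preserving: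
  assumes "S \<in> measurable M N" "distr M N S = N" "AE y in N. Q y"
  shows "AE x in M. Q (S x)"
  using assms by (metis AE_distrD)

lemma measure_preserving_vimage:
  assumes "S \<in> measurable M N" "distr M N S = N" "A \<in> sets N"
  shows "measure M (S -` A \<inter> space M) = measure N A"
  using measure_distr[OF assms(1,3)] assms(2) by simp

lemma measure_preserving_Collect:
  assumes "S \<in> measurable M N" "distr M N S = N" "{y \<in> space N. Q y} \<in> sets N"
  shows "measure M {x \<in> space M. Q (S x)} = measure N {y \<in> space N. Q y}"
proof -
  have "{x \<in> space M. Q (S x)} = S -` {y \<in> space N. Q y} \<inter> space M"
    using measurable_space[OF assms(1)] by auto
  then show ?thesis
    using measure_preserving_vimage[OF assms] by simp
qed

lemma measure_preserving_integral:
  fixes f :: "'b \<Rightarrow> 'c::{banach, second_countable_topology}"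
  assumes "S \<in> measurable M N" "distr M N S = N" "f \<in> borel_measurable N"
  shows "(\<integral>x. f (S x) \<partial>M) = (\<integral>y. f y \<partial>N)"
  using integral_distr[OF assms(1,3)] assms(2) by simp

lemma measure_preserving_integrable:
  fixes f :: "'b \<Rightarrow> 'c::{banach, second_countable_topology}"
  assumes "S \<in> measurable M N" "distr M N S = N" "f \<in> borel_measurable N"
  shows "integrable M (\<lambda>x. f (S x)) \<longleftrightarrow> integrable N f"
  using integrable_distr_eq[OF assms(1,3)] assms(2) by simp

lemma automorphismD:
  assumes "automorphism M S"
  shows "S \<in> measurable M M" "distr M M S = M" "ae_inverse M S (aut_inv M S)"
proof -
  show "S \<in> measurable M M" "distr M M S = M"
    using assms by (auto simp: automorphism_def)
  obtain S' where "ae_inverse M S S'"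
    using assms by (auto simp: automorphism_def)
  then show "ae_inverse M S (aut_inv M S)"
    unfolding aut_inv_def by (rule someI[of "ae_inverse M S"])
qed

lemma ae_inverse_automorphism:
  assumes S: "automorphism M S" and inv: "ae_inverse M S S'"
  shows "automorphism M S'"
proof -
  note [measurable] = automorphismD(1)[OF S]
  have [measurable]: "S' \<in> measurable M M"
    using inv by (simp add: ae_inverse_def)
  have "distr M M S' = distr (distr M M S) M S'"
    using automorphismD(2)[OF S] by simp
  also have "\<dots> = distr M M (\<lambda>x. S' (S x))"
    by (subst distr_distr) (auto simp: comp_def)
  also have "\<dots> = distr M M (\<lambda>x. x)"
    using inv by (intro distr_cong_AE) (auto simp: ae_inverse_def)
  finally have "distr M M S' = M"
    by (simp add: distr_id2)
  moreover have "ae_inverse M S' S"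
    using inv automorphismD(1)[OF S] by (auto simp: ae_inverse_def)
  ultimately show ?thesis
    by (auto simp: automorphism_def)
qed

lemma automorphism_aut_inv:
  "automorphism M S \<Longrightarrow> automorphism M (aut_inv M S)"
  using ae_inverse_automorphism automorphismD(3) by blast

lemma automorphism_id: "automorphism M id"
proof -
  have "ae_inverse M id id"
    by (auto simp: ae_inverse_def)
  moreover have "distr M M id = M"
    using distr_id2[of M M] by (simp add: id_def)
  ultimately show ?thesis
    unfolding automorphism_def by auto
qed

lemma distr_comp_eq:
  assumes "S \<in> measurable M N" "distr M N S = N" "R \<in> measurable N K" "distr N K R = K"
  shows "distr M K (R \<circ> S) = K"
  using distr_distr[OF assms(3,1)] assms(2,4) by simp

lemma ae_inverse_comp:
  assumes S: "automorphism M S" "ae_inverse M S S'" and R: "automorphism M R" "ae_inverse M R R'"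
  shows "ae_inverse M (S \<circ> R) (R' \<circ> S')"
proof -
  have 1: "R' \<circ> S' \<in> measurable M M"
    using S(2) R(2) by (auto simp: ae_inverse_def)
  have "AE x in M. S' (S (R x)) = R x"
    using S(2) by (intro AE_measure_preserving[OF automorphismD(1,2)[OF R(1)]])
      (simp add: ae_inverse_def)
  moreover have "AE x in M. R (R' (S' x)) = S' x"
    using R(2)
    by (intro AE_measure_preserving[OF automorphismD(1,2)[OF ae_inverse_automorphism[OF S]]])
      (simp add: ae_inverse_def)
  ultimately show ?thesis
    using S(2) R(2) 1 by (auto simp: ae_inverse_def elim: AE_mp)
qed

lemma automorphism_comp:
  assumes "automorphism M S" "automorphism M R"
  shows "automorphism M (S \<circ> R)"
proof -
  have "S \<circ> R \<in> measurable M M"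
    using automorphismD(1)[OF assms(1)] automorphismD(1)[OF assms(2)] by auto
  then show ?thesis
    using distr_comp_eq[OF automorphismD(1,2)[OF assms(2)] automorphismD(1,2)[OF assms(1)]]
      ae_inverse_comp[OF assms(1) automorphismD(3)[OF assms(1)] assms(2)
        automorphismD(3)[OF assms(2)]]
    unfolding automorphism_def by blast
qed

lemma automorphism_funpow: "automorphism M S \<Longrightarrow> automorphism M (S ^^ n)"
  by (induction n) (auto intro: automorphism_comp automorphism_id)

lemma ae_inverse_funpow:
  assumes S: "automorphism M S" "ae_inverse M S S'"
  shows "ae_inverse M (S ^^ n) (S' ^^ n)"
proof (induction n)
  case 0
  then show ?case by (auto simp: ae_inverse_def)
next
  case (Suc n)
  then have "ae_inverse M (S ^^ n \<circ> S) (S' \<circ> S' ^^ n)"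
    by (rule ae_inverse_comp[OF automorphism_funpow[OF S(1)] _ S])
  moreover have "S ^^ Suc n = S ^^ n \<circ> S" "S' ^^ Suc n = S' \<circ> S' ^^ n"
    by (rule funpow_Suc_right) simp
  ultimately show ?case by metis
qed

section \<open>Induction on square-integrable functions\<close>

lemma norm_add_squared_le:
  fixes a b :: "'b::real_normed_vector"
  shows "(norm (a + b))\<^sup>2 \<le> 2 * (norm a)\<^sup>2 + 2 * (norm b)\<^sup>2"
proof -
  have "(norm (a + b))\<^sup>2 \<le> (norm a + norm b)\<^sup>2"
    by (intro power_mono norm_triangle_ineq) auto
  also have "\<dots> \<le> 2 * (norm a)\<^sup>2 + 2 * (norm b)\<^sup>2"
    using sum_squares_bound[of "norm a" "norm b"] by (simp add: power2_sum)
  finally show ?thesis .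
qed

lemma (in finite_measure) square_integrable_diff:
  fixes f g :: "'a \<Rightarrow> 'b::{banach, second_countable_topology}"
  assumes [measurable]: "f \<in> borel_measurable M" "g \<in> borel_measurable M"
    and "integrable M (\<lambda>x. (norm (f x))\<^sup>2)" "integrable M (\<lambda>x. (norm (g x))\<^sup>2)"
  shows "integrable M (\<lambda>x. (norm (f x - g x))\<^sup>2)"
proof (rule Bochner_Integration.integrable_bound)
  show "integrable M (\<lambda>x. 2 * (norm (f x))\<^sup>2 + 2 * (norm (g x))\<^sup>2)"
    using assms by auto
  have "(norm (f x - g x))\<^sup>2 \<le> 2 * (norm (f x))\<^sup>2 + 2 * (norm (g x))\<^sup>2" for x
    using norm_add_squared_le[of "f x" "- g x"] by simp
  then show "AE x in M. norm ((norm (f x - g x))\<^sup>2)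
      \<le> norm (2 * (norm (f x))\<^sup>2 + 2 * (norm (g x))\<^sup>2)"
    by (auto intro!: AE_I2)
qed measurable

text \<open>
  Simple functions are dense in \<open>L\<^sub>2\<close>: they approximate \<open>f\<close> pointwise with norm at most \<open>2 \<bar>f\<bar>\<close>, so
  dominated convergence applies to the squared differences.
\<close>

lemma (in finite_measure) square_integrable_induct [consumes 2, case_names indicator add limit]:
  fixes f :: "'a \<Rightarrow> 'b::{banach, second_countable_topology}"
  assumes f: "f \<in> borel_measurable M" "integrable M (\<lambda>x. (norm (f x))\<^sup>2)"
    and indicator: "\<And>A c. A \<in> sets M \<Longrightarrow> Q (\<lambda>x. indicator A x *\<^sub>R c)"
    and add: "\<And>g h. \<lbrakk>g \<in> borel_measurable M; integrable M (\<lambda>x. (norm (g x))\<^sup>2); Q g;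
        h \<in> borel_measurable M; integrable M (\<lambda>x. (norm (h x))\<^sup>2); Q h\<rbrakk>
        \<Longrightarrow> Q (\<lambda>x. g x + h x)"
    and limit: "\<And>g s. \<lbrakk>g \<in> borel_measurable M; integrable M (\<lambda>x. (norm (g x))\<^sup>2);
        \<And>i. s i \<in> borel_measurable M; \<And>i. integrable M (\<lambda>x. (norm (s i x))\<^sup>2); \<And>i. Q (s i);
        (\<lambda>i. \<integral>x. (norm (g x - s i x))\<^sup>2 \<partial>M) \<longlonglongrightarrow> 0\<rbrakk> \<Longrightarrow> Q g"
  shows "Q f"
proof -
  have simple: "(\<lambda>x. \<Sum>y\<in>I. indicator (A y) x *\<^sub>R y) \<in> borel_measurable M \<and>
      integrable M (\<lambda>x. (norm (\<Sum>y\<in>I. indicator (A y) x *\<^sub>R y))\<^sup>2) \<and>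
      Q (\<lambda>x. \<Sum>y\<in>I. indicator (A y) x *\<^sub>R y)"
    if "finite I" "\<And>y. A y \<in> sets M" for I :: "'b set" and A
    using that(1)
  proof induction
    case empty
    show ?case using indicator[of "{}" 0] by simp
  next
    case (insert z I)
    have [measurable]: "\<And>y. A y \<in> sets M" by fact
    have sq: "integrable M (\<lambda>x. (norm (\<Sum>y\<in>J. indicator (A y) x *\<^sub>R y))\<^sup>2)" for J :: "'b set"
    proof (rule integrable_const_bound[where B="(\<Sum>y\<in>J. norm y)\<^sup>2"])
      have "norm (\<Sum>y\<in>J. indicator (A y) x *\<^sub>R y) \<le> (\<Sum>y\<in>J. norm y)" for x
        by (intro order_trans[OF norm_sum] sum_mono) (auto simp: indicator_def)
      then show "AE x in M. norm ((norm (\<Sum>y\<in>J. indicator (A y) x *\<^sub>R y))\<^sup>2) \<le> (\<Sum>y\<in>J. norm y)\<^sup>2"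
        by (auto intro!: AE_I2 power_mono)
    qed measurable
    have "integrable M (\<lambda>x. (norm (indicator (A z) x *\<^sub>R z))\<^sup>2)"
      using sq[of "{z}"] 
      by (simp only: sum.insert[OF finite.emptyI] sum.empty empty_iff not_False_eq_True add_0_right)
    then have "Q (\<lambda>x. indicator (A z) x *\<^sub>R z + (\<Sum>y\<in>I. indicator (A y) x *\<^sub>R y))"
      using insert by (intro add indicator) auto
    then show ?case
      using sq[of "insert z I"] unfolding sum.insert[OF insert(1,2)] by (intro conjI) measurable
  qed
  obtain F where F: "\<And>i. simple_function M (F i)"
      "\<And>x. x \<in> space M \<Longrightarrow> (\<lambda>i. F i x) \<longlonglongrightarrow> f x"
      "\<And>i x. x \<in> space M \<Longrightarrow> norm (F i x) \<le> 2 * norm (f x)"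
    using borel_measurable_implies_sequence_metric[OF f(1), of 0] unfolding dist_0_norm
      dist_norm diff_0_right by blast
  \<comment> \<open>The approximants are replaced by explicit indicator sums, which agree with them on the space only;
     \<open>Q\<close> is a property of total functions.\<close>
  define s where "s i x = (\<Sum>y\<in>F i ` space M. indicator (F i -` {y} \<inter> space M) x *\<^sub>R y)" for i x
  have s_eq: "s i x = F i x" if "x \<in> space M" for i x
  proof -
    have "s i x = (\<Sum>y\<in>F i ` space M. if y = F i x then y else 0)"
      unfolding s_def using that by (intro sum.cong) (auto simp: indicator_def)
    also have "\<dots> = F i x"
      using that simple_functionD(1)[OF F(1)[of i]] by simp
    finally show ?thesis .
  qed
  have s: "s i \<in> borel_measurable M \<and> integrable M (\<lambda>x. (norm (s i x))\<^sup>2) \<and> Q (s i)" for i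
    unfolding s_def
    using simple_functionD[OF F(1)[of i]] by (intro simple) auto
  have [measurable]: "\<And>i. s i \<in> borel_measurable M" "f \<in> borel_measurable M"
    using s f by auto
  have "(\<lambda>i. \<integral>x. (norm (f x - s i x))\<^sup>2 \<partial>M) \<longlonglongrightarrow> (\<integral>x. 0 \<partial>M)"
  proof (rule integral_dominated_convergence)
    show "integrable M (\<lambda>x. 9 * (norm (f x))\<^sup>2)"
      using f by simp
    show "AE x in M. (\<lambda>i. (norm (f x - s i x))\<^sup>2) \<longlonglongrightarrow> 0"
    proof (rule AE_I2)
      fix x assume x: "x \<in> space M"
      have "(\<lambda>i. (norm (f x - F i x))\<^sup>2) \<longlonglongrightarrow> (norm (f x - f x))\<^sup>2"
        by (intro tendsto_intros F x)
      then show "(\<lambda>i. (norm (f x - s i x))\<^sup>2) \<longlonglongrightarrow> 0"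
        using x by (simp add: s_eq)
    qed
    show "AE x in M. norm ((norm (f x - s i x))\<^sup>2) \<le> 9 * (norm (f x))\<^sup>2" for i
    proof (rule AE_I2)
      fix x assume x: "x \<in> space M"
      have "norm (f x - F i x) \<le> 3 * norm (f x)"
        using norm_triangle_ineq4[of "f x" "F i x"] F(3)[OF x, of i] by simp
      then have "(norm (f x - F i x))\<^sup>2 \<le> (3 * norm (f x))\<^sup>2"
        by (intro power_mono) auto
      then show "norm ((norm (f x - s i x))\<^sup>2) \<le> 9 * (norm (f x))\<^sup>2"
        using x by (simp add: s_eq power_mult_distrib)
    qed
  qed measurable
  then show ?thesis
    using s f by (intro limit[of f s]) auto
qed

section \<open>The weak homoclinic group in terms of sets\<close>

lemma (in prob_space) integral_squared_le:
  fixes u :: "'a \<Rightarrow> real"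
  assumes "u \<in> borel_measurable M" "integrable M (\<lambda>x. (u x)\<^sup>2)"
  shows "(\<integral>x. u x \<partial>M)\<^sup>2 \<le> (\<integral>x. (u x)\<^sup>2 \<partial>M)"
  using variance_positive[of u] variance_eq[OF square_integrable_imp_integrable[OF assms] assms(2)]
  by simp

text \<open>
  The measure by which \<open>S\<close> moves the set \<open>U -` A\<close>.  With \<open>U = T\<^sup>-\<^sup>n\<close> this set is \<open>T\<^sup>n A\<close>, and the
  measure equals the distance between \<open>A\<close> and its preimage under the conjugate \<open>T\<^sup>-\<^sup>n S T\<^sup>n\<close>.
\<close>

definition moved :: "'a measure \<Rightarrow> ('a \<Rightarrow> 'a) \<Rightarrow> ('a \<Rightarrow> 'a) \<Rightarrow> 'a set \<Rightarrow> real" where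
  "moved M S U A = measure M {x \<in> space M. (U (S x) \<in> A) \<noteq> (U x \<in> A)}"

lemma moved_nonneg: "0 \<le> moved M S U A"
  by (simp add: moved_def)

lemma (in prob_space) measure_conjugate_eq_moved:
  assumes [measurable]: "S \<in> measurable M M" and A[measurable]: "A \<in> sets M"
    and T: "automorphism M T" and inv: "ae_inverse M T V"
  shows "measure M {x \<in> space M. (V (S (T x)) \<in> A) \<noteq> (x \<in> A)} = moved M S V A"
proof -
  have [measurable]: "V \<in> measurable M M" "T \<in> measurable M M"
    using inv automorphismD[OF T] by (auto simp: ae_inverse_def)
  have "measure M {x \<in> space M. (V (S (T x)) \<in> A) \<noteq> (x \<in> A)}
      = measure M {x \<in> space M. (V (S (T x)) \<in> A) \<noteq> (V (T x) \<in> A)}"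
    using inv by (intro finite_measure_eq_AE) (auto simp: ae_inverse_def)
  also have "\<dots> = moved M S V A"
    unfolding moved_def
    by (rule measure_preserving_Collect[OF automorphismD(1,2)[OF T],
          where Q="\<lambda>y. (V (S y) \<in> A) \<noteq> (V y \<in> A)"]) measurable
  finally show ?thesis .
qed

text \<open>
  This recovers a statement about distances of sets from the strong convergence of averaged
  operators: for indicator functions the averages involve no cancellation, so their \<open>L\<^sub>1\<close> norm is the
  average of the \<open>L\<^sub>1\<close> norms, and the \<open>L\<^sub>2\<close> norm dominates it.
\<close>

lemma (in prob_space) averages_of_moved:
  assumes [measurable]: "\<And>n. W n \<in> measurable M M" and A[measurable]: "A \<in> sets M"
  shows "(\<Sum>n=1..N. measure M {x \<in> space M. (W n x \<in> A) \<noteq> (x \<in> A)}) / real N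
    \<le> l2norm M (\<lambda>x. (\<Sum>n=1..N. koopman (W n) (indicator A) x) / of_nat N - koopman id (indicator A) x)"
    (is "?avg \<le> l2norm M ?g")
proof (cases "N = 0")
  case True
  then show ?thesis by (simp add: l2norm_def)
next
  case False
  define u :: "'a \<Rightarrow> real" where "u x = (\<Sum>n=1..N. of_bool ((W n x \<in> A) \<noteq> (x \<in> A))) / real N" for x
  have [measurable]: "u \<in> borel_measurable M"
    unfolding u_def by measurable
  \<comment> \<open>All differences \<open>1\<^sub>A (W\<^sub>n x) - 1\<^sub>A x\<close> have the same sign, which depends only on \<open>x \<in> A\<close>;
     so nothing cancels in the average.\<close>
  have norm_g: "cmod (?g x) = u x" for x
  proof (cases "x \<in> A")
    case True
    have "(\<Sum>n=1..N. indicator A (W n x) :: complex) = (\<Sum>n=1..N. 1 - of_real (of_bool (W n x \<notin> A)))"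
      by (intro sum.cong) (auto simp: indicator_def)
    also have "\<dots> = of_nat N - of_real (\<Sum>n=1..N. of_bool (W n x \<notin> A))"
      by (simp only: sum_subtractf of_real_sum) simp
    finally have "?g x = - of_real (u x)"
      using True \<open>N \<noteq> 0\<close> by (simp add: u_def koopman_def diff_divide_distrib)
    moreover have "0 \<le> u x"
      by (auto simp: u_def intro!: sum_nonneg divide_nonneg_nonneg)
    ultimately show ?thesis by simp
  next
    case False
    have "(\<Sum>n=1..N. indicator A (W n x) :: complex) = (\<Sum>n=1..N. of_real (of_bool (W n x \<in> A)))"
      by (intro sum.cong) (auto simp: indicator_def)
    also have "\<dots> = of_real (\<Sum>n=1..N. of_bool (W n x \<in> A))"
      by (simp only: of_real_sum)
    finally have "?g x = of_real (u x)"
      using False by (simp add: u_def koopman_def)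
    moreover have "0 \<le> u x"
      by (auto simp: u_def intro!: sum_nonneg divide_nonneg_nonneg)
    ultimately show ?thesis by simp
  qed
  have u_le: "0 \<le> u x" "u x \<le> 1" for x
  proof -
    show "0 \<le> u x"
      by (auto simp: u_def intro!: sum_nonneg divide_nonneg_nonneg)
    have "(\<Sum>n=1..N. of_bool ((W n x \<in> A) \<noteq> (x \<in> A))) \<le> (\<Sum>n=1..N. 1::real)"
      by (intro sum_mono) auto
    then show "u x \<le> 1"
      using False by (simp add: u_def field_simps)
  qed
  have "integrable M (\<lambda>x. (u x)\<^sup>2)"
    using u_le by (intro integrable_const_bound[where B=1]) (auto intro!: power_le_one)
  then have "(\<integral>x. u x \<partial>M)\<^sup>2 \<le> (\<integral>x. (u x)\<^sup>2 \<partial>M)"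
    by (intro integral_squared_le) auto
  then have "(\<integral>x. u x \<partial>M) \<le> l2norm M ?g"
    unfolding l2norm_def norm_g by (rule real_le_rsqrt)
  moreover have "(\<integral>x. u x \<partial>M) = ?avg"
  proof -
    have "(\<integral>x. of_bool ((W n x \<in> A) \<noteq> (x \<in> A)) \<partial>M :: real) = measure M {x \<in> space M. (W n x \<in> A) \<noteq> (x \<in> A)}" for n
    proof -
      have "(\<integral>x. of_bool ((W n x \<in> A) \<noteq> (x \<in> A)) \<partial>M :: real)
          = (\<integral>x. indicator {x \<in> space M. (W n x \<in> A) \<noteq> (x \<in> A)} x \<partial>M)"
        by (intro Bochner_Integration.integral_cong) (auto simp: indicator_def)
      then show ?thesis by simp
    qed
    moreover have "integrable M (\<lambda>x. of_bool ((W n x \<in> A) \<noteq> (x \<in> A)) :: real)" for n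
      by (intro integrable_const_bound[where B=1]) auto
    ultimately show ?thesis
      unfolding u_def by (simp add: Bochner_Integration.integral_sum del: sum_of_bool_eq)
  qed
  ultimately show ?thesis by simp
qed

lemma norm_average_squared_le:
  fixes a :: "nat \<Rightarrow> complex"
  assumes "N \<noteq> 0"
  shows "(cmod ((\<Sum>n=1..N. a n) / of_nat N - b))\<^sup>2 \<le> (\<Sum>n=1..N. (cmod (a n - b))\<^sup>2) / real N"
proof -
  have "(\<Sum>n=1..N. a n) / of_nat N - b = (\<Sum>n=1..N. a n - b) / of_nat N"
    using assms by (simp add: sum_subtractf field_simps)
  then have "cmod ((\<Sum>n=1..N. a n) / of_nat N - b) \<le> (\<Sum>n=1..N. cmod (a n - b)) / real N"
    by (simp add: norm_divide divide_right_mono norm_sum)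
  then have "(cmod ((\<Sum>n=1..N. a n) / of_nat N - b))\<^sup>2 \<le> ((\<Sum>n=1..N. cmod (a n - b)) / real N)\<^sup>2"
    by (intro power_mono) auto
  also have "\<dots> \<le> ((\<Sum>n=1..N. (cmod (a n - b))\<^sup>2) * real N) / (real N)\<^sup>2"
    using sum_squared_le_sum_of_squares[of "\<lambda>n. cmod (a n - b)" "{1..N}"]
    by (simp add: power_divide divide_right_mono)
  also have "\<dots> = (\<Sum>n=1..N. (cmod (a n - b))\<^sup>2) / real N"
    using assms by (simp add: power2_eq_square)
  finally show ?thesis .
qed

text \<open>
  All \<open>W\<^sub>n\<close> act isometrically on \<open>L\<^sub>2\<close>, so an approximation error of \<open>f\<close> enters the displacement
  uniformly in \<open>n\<close>, and the claim spreads from indicator functions to all of \<open>L\<^sub>2\<close>.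
\<close>

lemma (in prob_space) average_displacement_null:
  fixes f :: "'a \<Rightarrow> complex"
  assumes W: "\<And>n. W n \<in> measurable M M" "\<And>n. distr M M (W n) = M"
    and sets: "\<And>A. A \<in> sets M \<Longrightarrow>
      cesaro_null (\<lambda>n. measure M {x \<in> space M. (W n x \<in> A) \<noteq> (x \<in> A)})"
    and f: "f \<in> borel_measurable M" "integrable M (\<lambda>x. (cmod (f x))\<^sup>2)"
  shows "cesaro_null (\<lambda>n. \<integral>x. (cmod (f (W n x) - f x))\<^sup>2 \<partial>M)"
  using f
proof (induct rule: square_integrable_induct)
  case (indicator A c)
  note [measurable] = W(1) indicator
  have "(\<integral>x. (cmod (indicator A (W n x) *\<^sub>R c - indicator A x *\<^sub>R c))\<^sup>2 \<partial>M)
      = (cmod c)\<^sup>2 * measure M {x \<in> space M. (W n x \<in> A) \<noteq> (x \<in> A)}" for n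
  proof -
    have "(\<integral>x. (cmod (indicator A (W n x) *\<^sub>R c - indicator A x *\<^sub>R c))\<^sup>2 \<partial>M)
        = (\<integral>x. (cmod c)\<^sup>2 * indicator {x \<in> space M. (W n x \<in> A) \<noteq> (x \<in> A)} x \<partial>M)"
      by (intro Bochner_Integration.integral_cong) (auto simp: indicator_def)
    then show ?thesis by simp
  qed
  then show ?case
    using cesaro_null_cmult[OF sets[OF indicator]] by simp
next
  case (add g h)
  note [measurable] = W(1) add(1,4)
  have int: "integrable M (\<lambda>x. (cmod (g (W n x) - g x))\<^sup>2)"
    "integrable M (\<lambda>x. (cmod (h (W n x) - h x))\<^sup>2)" for n
    using add measure_preserving_integrable[OF W(1)[of n] W(2)[of n], of "\<lambda>x. (cmod (g x))\<^sup>2"]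
      measure_preserving_integrable[OF W(1)[of n] W(2)[of n], of "\<lambda>x. (cmod (h x))\<^sup>2"]
    by (auto intro!: square_integrable_diff)
  show ?case
  proof (rule cesaro_null_mono[OF cesaro_null_add[OF cesaro_null_cmult[OF add(3), of 2]
          cesaro_null_cmult[OF add(6), of 2]]])
    fix n
    have "(\<integral>x. (cmod (g (W n x) + h (W n x) - (g x + h x)))\<^sup>2 \<partial>M)
        \<le> (\<integral>x. 2 * (cmod (g (W n x) - g x))\<^sup>2 + 2 * (cmod (h (W n x) - h x))\<^sup>2 \<partial>M)"
    proof (rule integral_mono_AE')
      show "AE x in M. (cmod (g (W n x) + h (W n x) - (g x + h x)))\<^sup>2
          \<le> 2 * (cmod (g (W n x) - g x))\<^sup>2 + 2 * (cmod (h (W n x) - h x))\<^sup>2"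
        using norm_add_squared_le[of "g (W n x) - g x" "h (W n x) - h x" for x]
        by (intro AE_I2) (simp add: algebra_simps)
    qed (use int in auto)
    then show "(\<integral>x. (cmod (g (W n x) + h (W n x) - (g x + h x)))\<^sup>2 \<partial>M)
        \<le> 2 * (\<integral>x. (cmod (g (W n x) - g x))\<^sup>2 \<partial>M) + 2 * (\<integral>x. (cmod (h (W n x) - h x))\<^sup>2 \<partial>M)"
      using int by simp
  qed simp
next
  case (limit g s)
  note [measurable] = W(1) limit(1,3)
  show ?case
  proof (rule cesaro_null_approx)
    fix e :: real assume "e > 0"
    then obtain i where i: "(\<integral>x. (cmod (g x - s i x))\<^sup>2 \<partial>M) < e / 8"
      using LIMSEQ_D[OF limit(6), of "e / 8"] by fastforce
    have int0: "integrable M (\<lambda>x. (cmod (g x - s i x))\<^sup>2)"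
      using limit by (intro square_integrable_diff) auto
    have int: "integrable M (\<lambda>x. (cmod (g (W n x) - s i (W n x)))\<^sup>2)"
      "integrable M (\<lambda>x. (cmod (s i (W n x) - s i x))\<^sup>2)" for n
      using int0 limit
        measure_preserving_integrable[OF W(1)[of n] W(2)[of n], of "\<lambda>x. (cmod (g x - s i x))\<^sup>2"]
        measure_preserving_integrable[OF W(1)[of n] W(2)[of n], of "\<lambda>x. (cmod (s i x))\<^sup>2"]
      by (auto intro!: square_integrable_diff)
    have "(\<integral>x. (cmod (g (W n x) - g x))\<^sup>2 \<partial>M)
        \<le> 2 * (\<integral>x. (cmod (s i (W n x) - s i x))\<^sup>2 \<partial>M) + e" for n
    proof -
      have "(\<integral>x. (cmod (g (W n x) - g x))\<^sup>2 \<partial>M)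
          \<le> (\<integral>x. 2 * (cmod (s i (W n x) - s i x))\<^sup>2
             + (4 * (cmod (g (W n x) - s i (W n x)))\<^sup>2 + 4 * (cmod (g x - s i x))\<^sup>2) \<partial>M)"
      proof (rule integral_mono_AE')
        have "(cmod (g (W n x) - g x))\<^sup>2 \<le> 2 * (cmod (s i (W n x) - s i x))\<^sup>2
             + (4 * (cmod (g (W n x) - s i (W n x)))\<^sup>2 + 4 * (cmod (g x - s i x))\<^sup>2)" for x
          using norm_add_squared_le[of "s i (W n x) - s i x"
              "(g (W n x) - s i (W n x)) + (s i x - g x)"]
            norm_add_squared_le[of "g (W n x) - s i (W n x)" "s i x - g x"]
          by (simp add: algebra_simps norm_minus_commute)
        then show "AE x in M. (cmod (g (W n x) - g x))\<^sup>2 \<le> 2 * (cmod (s i (W n x) - s i x))\<^sup>2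
             + (4 * (cmod (g (W n x) - s i (W n x)))\<^sup>2 + 4 * (cmod (g x - s i x))\<^sup>2)"
          by simp
      qed (use int int0 in auto)
      also have "\<dots> = 2 * (\<integral>x. (cmod (s i (W n x) - s i x))\<^sup>2 \<partial>M)
          + (4 * (\<integral>x. (cmod (g (W n x) - s i (W n x)))\<^sup>2 \<partial>M) + 4 * (\<integral>x. (cmod (g x - s i x))\<^sup>2 \<partial>M))"
        using int[of n] int0 by simp
      also have "(\<integral>x. (cmod (g (W n x) - s i (W n x)))\<^sup>2 \<partial>M) = (\<integral>x. (cmod (g x - s i x))\<^sup>2 \<partial>M)"
        by (rule measure_preserving_integral[OF W, of "\<lambda>x. (cmod (g x - s i x))\<^sup>2"]) measurable
      finally show ?thesis using i by simp
    qed
    then show "\<exists>b. cesaro_null b \<and> (\<forall>n. (\<integral>x. (cmod (g (W n x) - g x))\<^sup>2 \<partial>M) \<le> b n + e)"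
      using cesaro_null_cmult[OF limit(5)[of i], of 2] by blast
  qed simp
qed

text \<open>
  Membership in the weak homoclinic group is a condition on sets: on average over \<open>n\<close>, the
  transformation \<open>S\<close> barely moves \<open>T\<^sup>n A\<close>.  From sets to functions one uses convexity of the square
  (the squared norm of an average is at most the average of the squared norms).
\<close>

lemma (in prob_space) weak_homoclinic_iff:
  assumes T: "automorphism M T"
  shows "S \<in> weak_homoclinic M T \<longleftrightarrow> automorphism M S \<and>
    (\<forall>A\<in>sets M. cesaro_null (\<lambda>n. moved M S (aut_inv M T ^^ n) A))"
proof (cases "automorphism M S")
  case False
  then show ?thesis by (simp add: weak_homoclinic_def)
next
  case S: True
  define W where "W n = (aut_inv M T ^^ n) \<circ> S \<circ> (T ^^ n)" for n
  let ?dist = "\<lambda>A n. measure M {x \<in> space M. (W n x \<in> A) \<noteq> (x \<in> A)}"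
  note T' = automorphism_aut_inv[OF T]
  have "automorphism M (W n)" for n
    unfolding W_def by (intro automorphism_comp automorphism_funpow S T T')
  then have W: "W n \<in> measurable M M" "distr M M (W n) = M" for n
    using automorphismD by blast+
  note [measurable] = W(1)
  have moved: "moved M S (aut_inv M T ^^ n) A = ?dist A n"
    if "A \<in> sets M" for A n
    using measure_conjugate_eq_moved[OF automorphismD(1)[OF S] that automorphism_funpow[OF T, of n]
        ae_inverse_funpow[OF T automorphismD(3)[OF T]]]
    by (simp add: W_def)
  define avg where "avg f N = l2norm M (\<lambda>x. (\<Sum>n=1..N. koopman (W n) f x) / of_nat N - koopman id f x)" for f N
  have "(\<forall>f\<in>sq_int M. avg f \<longlonglongrightarrow> 0) \<longleftrightarrow>
      (\<forall>A\<in>sets M. cesaro_null (?dist A))"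
  proof safe
    fix A assume avg: "\<forall>f\<in>sq_int M. avg f \<longlonglongrightarrow> 0" and A[measurable]: "A \<in> sets M"
    have "integrable M (\<lambda>x. (cmod (indicator A x))\<^sup>2)"
      by (intro integrable_const_bound[where B=1]) (auto simp: indicator_def)
    then have "indicator A \<in> sq_int M"
      by (simp add: sq_int_def)
    then have lim: "avg (indicator A) \<longlonglongrightarrow> 0"
      using avg by blast
    have le: "(\<Sum>n=1..N. ?dist A n) / real N
        \<le> avg (indicator A) N" for N
      unfolding avg_def by (rule averages_of_moved[OF W(1) A])
    show "cesaro_null (?dist A)"
      unfolding cesaro_null_def
      by (rule tendsto_sandwich[OF _ _ tendsto_const lim]; intro always_eventually allI le)
        (intro divide_nonneg_nonneg sum_nonneg measure_nonneg of_nat_0_le_iff)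
  next
    fix f assume null: "\<forall>A\<in>sets M. cesaro_null (?dist A)"
      and "f \<in> sq_int M"
    then have f: "f \<in> borel_measurable M" "integrable M (\<lambda>x. (cmod (f x))\<^sup>2)"
      by (auto simp: sq_int_def)
    note [measurable] = f(1)
    have int: "integrable M (\<lambda>x. (cmod (f (W n x) - f x))\<^sup>2)" for n
      using f measure_preserving_integrable[OF W[of n], of "\<lambda>x. (cmod (f x))\<^sup>2"]
      by (intro square_integrable_diff) auto
    have "avg f N \<le> sqrt ((\<Sum>n=1..N. \<integral>x. (cmod (f (W n x) - f x))\<^sup>2 \<partial>M) / real N)" if "N \<ge> 1" for N
    proof -
      have "(\<integral>x. (cmod ((\<Sum>n=1..N. f (W n x)) / of_nat N - f x))\<^sup>2 \<partial>M)
          \<le> (\<integral>x. (\<Sum>n=1..N. (cmod (f (W n x) - f x))\<^sup>2) / real N \<partial>M)"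
        using int norm_average_squared_le[of N] that
        by (intro integral_mono_AE') (auto intro!: sum_nonneg divide_nonneg_nonneg)
      also have "\<dots> = (\<Sum>n=1..N. \<integral>x. (cmod (f (W n x) - f x))\<^sup>2 \<partial>M) / real N"
        using int by (simp add: Bochner_Integration.integral_sum)
      finally show ?thesis
        by (simp add: avg_def l2norm_def koopman_def)
    qed
    then have le: "\<forall>\<^sub>F N in sequentially.
        avg f N \<le> sqrt ((\<Sum>n=1..N. \<integral>x. (cmod (f (W n x) - f x))\<^sup>2 \<partial>M) / real N)"
      using eventually_sequentially by blast
    have "cesaro_null (\<lambda>n. \<integral>x. (cmod (f (W n x) - f x))\<^sup>2 \<partial>M)"
      using null by (intro average_displacement_null W f) blast
    then have lim: "(\<lambda>N. sqrt ((\<Sum>n=1..N. \<integral>x. (cmod (f (W n x) - f x))\<^sup>2 \<partial>M) / real N)) \<longlonglongrightarrow> 0"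
      unfolding cesaro_null_def by (drule_tac tendsto_real_sqrt) (simp only: real_sqrt_zero)
    show "avg f \<longlonglongrightarrow> 0"
      by (rule tendsto_sandwich[OF _ le tendsto_const lim]) (simp add: avg_def l2norm_def)
  qed
  then show ?thesis
    using S moved unfolding weak_homoclinic_def avg_def W_def by simp
qed

lemma (in prob_space) moved_cong_AE:
  assumes [measurable]: "S \<in> measurable M M" "R \<in> measurable M M" "U \<in> measurable M M" "A \<in> sets M"
    and "AE x in M. R x = S x"
  shows "moved M R U A = moved M S U A"
  unfolding moved_def using assms(5) by (intro finite_measure_eq_AE) auto

lemma (in prob_space) moved_comp_le:
  assumes S[measurable]: "S \<in> measurable M M" and R: "R \<in> measurable M M" "distr M M R = M"
    and [measurable]: "U \<in> measurable M M" "A \<in> sets M"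
  shows "moved M (S \<circ> R) U A \<le> moved M S U A + moved M R U A"
proof -
  note [measurable] = R(1)
  let ?B = "{x \<in> space M. (U (S (R x)) \<in> A) \<noteq> (U (R x) \<in> A)}"
  let ?C = "{x \<in> space M. (U (R x) \<in> A) \<noteq> (U x \<in> A)}"
  have "moved M (S \<circ> R) U A \<le> measure M (?B \<union> ?C)"
    unfolding moved_def by (intro finite_measure_mono) auto
  also have "\<dots> \<le> measure M ?B + measure M ?C"
    by (intro measure_Un_le) measurable
  also have "measure M ?B = moved M S U A"
    unfolding moved_def
    by (rule measure_preserving_Collect[OF R, where Q="\<lambda>y. (U (S y) \<in> A) \<noteq> (U y \<in> A)"]) measurable
  finally show ?thesis by (simp add: moved_def)
qed

lemma (in prob_space) moved_inverse:
  assumes S: "automorphism M S" and inv: "ae_inverse M S S'"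
    and [measurable]: "U \<in> measurable M M" "A \<in> sets M"
  shows "moved M S' U A = moved M S U A"
proof -
  have [measurable]: "S \<in> measurable M M" "S' \<in> measurable M M"
    using automorphismD[OF S] inv by (auto simp: ae_inverse_def)
  have "moved M S' U A = measure M {x \<in> space M. (U (S' (S x)) \<in> A) \<noteq> (U (S x) \<in> A)}"
    unfolding moved_def
    by (rule measure_preserving_Collect[OF automorphismD(1,2)[OF S],
          where Q="\<lambda>y. (U (S' y) \<in> A) \<noteq> (U y \<in> A)", symmetric]) measurable
  also have "\<dots> = moved M S U A"
    unfolding moved_def using inv by (intro finite_measure_eq_AE) (auto simp: ae_inverse_def)
  finally show ?thesis .
qed

text \<open>
  In the form of \<open>weak_homoclinic_iff\<close> no conjugates occur any more: the displacement of a set is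
  subadditive under composition, invariant under inversion and depends only on a.e. classes.
\<close>

lemma (in prob_space) aut_subgroup_weak_homoclinic:
  assumes T: "automorphism M T"
  shows "aut_subgroup M (weak_homoclinic M T)"
proof -
  have U[measurable]: "aut_inv M T ^^ n \<in> measurable M M" for n
    by (intro automorphismD automorphism_funpow automorphism_aut_inv T)
  note iff = weak_homoclinic_iff[OF T]
  have "automorphism M S" if "S \<in> weak_homoclinic M T" for S
    using that iff by blast
  moreover have "R \<in> weak_homoclinic M T"
    if S: "S \<in> weak_homoclinic M T" and R: "automorphism M R" "AE x in M. R x = S x" for S R
  proof -
    have "moved M R (aut_inv M T ^^ n) A = moved M S (aut_inv M T ^^ n) A" if "A \<in> sets M" for A n
      using S R that by (intro moved_cong_AE U) (auto simp: iff dest: automorphismD)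
    then show ?thesis using S R by (simp add: iff)
  qed
  moreover have "id \<in> weak_homoclinic M T"
    by (simp add: iff automorphism_id moved_def cesaro_null_zero)
  moreover have "S \<circ> R \<in> weak_homoclinic M T"
    if S: "S \<in> weak_homoclinic M T" and R: "R \<in> weak_homoclinic M T" for S R
    unfolding iff
  proof (intro conjI ballI)
    show "automorphism M (S \<circ> R)"
      using S R by (auto simp: iff intro: automorphism_comp)
    fix A assume A: "A \<in> sets M"
    show "cesaro_null (\<lambda>n. moved M (S \<circ> R) (aut_inv M T ^^ n) A)"
    proof (rule cesaro_null_mono[OF cesaro_null_add])
      show "moved M (S \<circ> R) (aut_inv M T ^^ n) A
          \<le> moved M S (aut_inv M T ^^ n) A + moved M R (aut_inv M T ^^ n) A" for n
        using S R A by (intro moved_comp_le U) (auto simp: iff dest: automorphismD)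
    qed (use S R A in \<open>auto simp: iff moved_nonneg\<close>)
  qed
  moreover have "aut_inv M S \<in> weak_homoclinic M T" if S: "S \<in> weak_homoclinic M T" for S
  proof -
    have "automorphism M S" using S by (simp add: iff)
    then have "moved M (aut_inv M S) (aut_inv M T ^^ n) A = moved M S (aut_inv M T ^^ n) A"
      if "A \<in> sets M" for A n
      using that automorphismD(3) by (intro moved_inverse U) auto
    then show ?thesis using S by (simp add: iff automorphism_aut_inv)
  qed
  ultimately show ?thesis
    unfolding aut_subgroup_def by blast
qed

section \<open>Reduction to generating classes\<close>

text \<open>
  The sets that are asymptotically not moved form a \<open>\<sigma>\<close>-algebra.  For a countable union, a finite
  partial union \<open>B\<close> misses a set \<open>C\<close> of small measure, and a point can only be moved by \<open>S\<close> in or out of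
  the union if this happens for a member of \<open>B\<close>, or if its position before or after lies in \<open>C\<close>.
\<close>

lemma (in prob_space) moved_null_generated:
  assumes S: "S \<in> measurable M M" "distr M M S = M"
    and U: "\<And>n. U n \<in> measurable M M" "\<And>n. distr M M (U n) = M"
    and gen: "sets M = sigma_sets (space M) G"
    and null: "\<And>A. A \<in> G \<Longrightarrow> cesaro_null (\<lambda>n. moved M S (U n) A)"
    and A: "A \<in> sets M"
  shows "cesaro_null (\<lambda>n. moved M S (U n) A)"
proof -
  note [measurable] = S(1) U(1)
  show ?thesis
    using A unfolding gen
  proof induct
    case (Basic A)
    then show ?case by (rule null)
  next
    case Empty
    then show ?case by (simp add: moved_def cesaro_null_zero)
  next
    case (Compl A)
    have "moved M S (U n) (space M - A) = moved M S (U n) A" for n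
      using measurable_space[OF S(1)] measurable_space[OF U(1)]
      unfolding moved_def by (intro arg_cong[where f="measure M"]) auto
    then show ?case using Compl by simp
  next
    case (Union A)
    have A[measurable]: "A i \<in> sets M" for i
      using Union(1) gen by auto
    show ?case
    proof (rule cesaro_null_approx[OF moved_nonneg])
      fix e :: real assume "e > 0"
      define C where "C k = (\<Union>i. A i) - (\<Union>i<k. A i)" for k
      have [measurable]: "C k \<in> sets M" for k
        unfolding C_def by measurable
      have "(\<lambda>k. measure M (C k)) \<longlonglongrightarrow> measure M (\<Inter>k. C k)"
      proof (rule finite_Lim_measure_decseq)
        show "decseq C"
          unfolding C_def by (rule decseq_SucI) auto
      qed auto
      moreover have "(\<Inter>k. C k) = {}"
        unfolding C_def by auto
      ultimately obtain k where k: "measure M (C k) < e / 2"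
        using LIMSEQ_D[of "\<lambda>k. measure M (C k)" 0 "e / 2"] \<open>e > 0\<close> by fastforce
      have "moved M S (U n) (\<Union>i. A i) \<le> (\<Sum>i<k. moved M S (U n) (A i)) + e" for n
      proof -
        let ?D = "\<lambda>i. {x \<in> space M. (U n (S x) \<in> A i) \<noteq> (U n x \<in> A i)}"
        let ?E = "{x \<in> space M. U n (S x) \<in> C k}"
        let ?F = "{x \<in> space M. U n x \<in> C k}"
        have "moved M S (U n) (\<Union>i. A i) \<le> measure M ((\<Union>i<k. ?D i) \<union> (?E \<union> ?F))"
          unfolding moved_def
          by (rule finite_measure_mono) (auto simp: C_def, measurable)
        also have "\<dots> \<le> measure M (\<Union>i<k. ?D i) + measure M (?E \<union> ?F)"
          by (intro measure_Un_le) measurable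
        also have "measure M (\<Union>i<k. ?D i) \<le> (\<Sum>i<k. moved M S (U n) (A i))"
          unfolding moved_def by (intro finite_measure_subadditive_finite) auto
        also have "measure M (?E \<union> ?F) \<le> measure M ?E + measure M ?F"
          by (intro measure_Un_le) measurable
        also have "measure M ?E = measure M ?F"
          by (rule measure_preserving_Collect[OF S, where Q="\<lambda>x. U n x \<in> C k"]) measurable
        also have "measure M ?F = measure M (C k)"
          using measure_preserving_Collect[OF U, where Q="\<lambda>x. x \<in> C k"] 
            sets.sets_into_space[of "C k" M] by (simp add: Collect_conj_eq Int_absorb1)
        finally show ?thesis using k by simp
      qed
      then show "\<exists>b. cesaro_null b \<and> (\<forall>n. moved M S (U n) (\<Union>i. A i) \<le> b n + e)"
        using cesaro_null_sum[of "{..<k}" "\<lambda>i n. moved M S (U n) (A i)"] Union(2) by blast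
    qed
  qed
qed

lemma (in prob_space) weak_homoclinicI_generated:
  assumes T: "automorphism M T" and S: "automorphism M S"
    and gen: "sets M = sigma_sets (space M) G"
    and null: "\<And>A. A \<in> G \<Longrightarrow> cesaro_null (\<lambda>n. moved M S (aut_inv M T ^^ n) A)"
  shows "S \<in> weak_homoclinic M T"
proof -
  have U: "automorphism M (aut_inv M T ^^ n)" for n
    by (intro automorphism_funpow automorphism_aut_inv T)
  show ?thesis
    unfolding weak_homoclinic_iff[OF T]
    using S moved_null_generated[OF automorphismD(1,2)[OF S] automorphismD(1,2)[OF U] gen null]
    by blast
qed

text \<open>
  A Dynkin class argument.  Domination by the measure is what allows the limit in \<open>j\<close> to be exchanged
  with the sum over a disjoint sequence (Tannery).
\<close>

lemma (in prob_space) tendsto_on_generated: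
  fixes \<nu> :: "nat \<Rightarrow> 'a set \<Rightarrow> real"
  assumes gen: "sets M = sigma_sets (space M) G" "Int_stable G" "G \<subseteq> Pow (space M)"
    and sums: "\<And>j A. range A \<subseteq> sets M \<Longrightarrow> disjoint_family A \<Longrightarrow> (\<lambda>i. \<nu> j (A i)) sums \<nu> j (\<Union>i. A i)"
    and compl: "\<And>j A. A \<in> sets M \<Longrightarrow> \<nu> j (space M - A) = \<nu> j (space M) - \<nu> j A"
    and le: "\<And>j A. A \<in> sets M \<Longrightarrow> 0 \<le> \<nu> j A \<and> \<nu> j A \<le> measure M A"
    and space: "\<And>j. \<nu> j (space M) = c"
    and lim: "\<And>A. A \<in> G \<Longrightarrow> (\<lambda>j. \<nu> j A) \<longlonglongrightarrow> c * measure M A"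
    and A: "A \<in> sets M"
  shows "(\<lambda>j. \<nu> j A) \<longlonglongrightarrow> c * measure M A"
  using gen(2,3) A[unfolded gen(1)]
proof (induct rule: sigma_sets_induct_disjoint)
  case (basic A)
  then show ?case by (rule lim)
next
  case empty
  have "\<nu> j {} = 0" for j using le[of "{}" j] by simp
  then show ?case by simp
next
  case (compl A)
  then have A: "A \<in> sets M" by (simp add: gen(1))
  have "(\<lambda>j. c - \<nu> j A) \<longlonglongrightarrow> c - c * measure M A"
    using compl by (intro tendsto_intros)
  moreover have "\<nu> j (space M - A) = c - \<nu> j A" for j
    using assms(5)[OF A] space by simp
  ultimately show ?case
    using A by (simp add: prob_compl right_diff_distrib)
next
  case (union A)
  then have A: "range A \<subseteq> sets M" by (auto simp: gen(1))
  note m = finite_measure_UNION[OF A union(1)]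
  have "(\<lambda>j. \<Sum>i. \<nu> j (A i)) \<longlonglongrightarrow> (\<Sum>i. c * measure M (A i))"
  proof (rule tannerys_theorem[THEN conjunct2, THEN conjunct2])
    show "(\<lambda>j. \<nu> j (A i)) \<longlonglongrightarrow> c * measure M (A i)" for i
      by (rule union(3))
    show "summable (\<lambda>i. measure M (A i))"
      using m by (rule sums_summable)
    show "\<forall>\<^sub>F (i, j) in at_top \<times>\<^sub>F sequentially. norm (\<nu> j (A i)) \<le> measure M (A i)"
      using le[OF subsetD[OF A rangeI]] by (intro always_eventually) simp
  qed simp
  moreover have "(\<Sum>i. \<nu> j (A i)) = \<nu> j (\<Union>i. A i)" for j
    using sums[OF A union(1)] by (rule sums_unique[symmetric])
  moreover have "(\<Sum>i. c * measure M (A i)) = c * measure M (\<Union>i. A i)"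
    using sums_mult[OF m, of c] by (rule sums_unique[symmetric])
  ultimately show ?case by simp
qed

text \<open>
  The sequence \<open>S\<close> mixes \<open>A\<close> and \<open>B\<close>, without being the sequence of powers of one transformation.
\<close>

definition asymptotically_independent :: "'a measure \<Rightarrow> (nat \<Rightarrow> 'a \<Rightarrow> 'a) \<Rightarrow> 'a set \<Rightarrow> 'a set \<Rightarrow> bool"
  where "asymptotically_independent M S A B \<longleftrightarrow>
    (\<lambda>j. measure M (A \<inter> (S j -` B \<inter> space M))) \<longlonglongrightarrow> measure M A * measure M B"

text \<open>
  The extension is carried out in one argument at a time: first in \<open>B\<close> for generators \<open>A\<close>, then in
  \<open>A\<close> for arbitrary \<open>B\<close>.
\<close>

lemma (in prob_space) asymptotically_independent_generated:
  assumes gen: "sets M = sigma_sets (space M) G" "Int_stable G" "G \<subseteq> Pow (space M)"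
    and S: "\<And>j. S j \<in> measurable M M" "\<And>j. distr M M (S j) = M"
    and lim: "\<And>A B. A \<in> G \<Longrightarrow> B \<in> G \<Longrightarrow> asymptotically_independent M S A B"
    and A: "A \<in> sets M" and B: "B \<in> sets M"
  shows "asymptotically_independent M S A B"
proof -
  let ?pre = "\<lambda>j D. S j -` D \<inter> space M"
  have G: "V \<in> sets M" if "V \<in> G" for V
    using that gen(1) by auto
  have right: "asymptotically_independent M S V B" if "V \<in> G" for V
    unfolding asymptotically_independent_def
  proof (rule tendsto_on_generated[OF gen])
    show "(\<lambda>i. measure M (V \<inter> ?pre j (D i))) sums measure M (V \<inter> ?pre j (\<Union>i. D i))"
      if "range D \<subseteq> sets M" "disjoint_family D" for j D
    proof -
      have "range (\<lambda>i. V \<inter> ?pre j (D i)) \<subseteq> sets M"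
        using G[OF \<open>V \<in> G\<close>] that(1) measurable_sets[OF S(1)] by auto
      moreover have "disjoint_family (\<lambda>i. V \<inter> ?pre j (D i))"
        using that(2) by (auto simp: disjoint_family_on_def)
      ultimately have "(\<lambda>i. measure M (V \<inter> ?pre j (D i)))
          sums measure M (\<Union>i. V \<inter> ?pre j (D i))"
        by (rule finite_measure_UNION)
      moreover have "(\<Union>i. V \<inter> ?pre j (D i)) = V \<inter> ?pre j (\<Union>i. D i)"
        by auto
      ultimately show ?thesis by simp
    qed
    have VS: "V \<subseteq> space M" using gen(3) that by auto
    show "measure M (V \<inter> (S j -` space M \<inter> space M)) = measure M V" for j
      using measurable_space[OF S(1)] VS by (intro arg_cong[where f="measure M"]) auto
    show "measure M (V \<inter> ?pre j (space M - D)) =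
        measure M (V \<inter> (S j -` space M \<inter> space M)) - measure M (V \<inter> ?pre j D)"
      if D: "D \<in> sets M" for j D
    proof -
      have "V \<inter> ?pre j (space M - D) =
          (V \<inter> (S j -` space M \<inter> space M)) - (V \<inter> ?pre j D)"
        by auto
      moreover have "V \<inter> ?pre j D \<subseteq> V \<inter> (S j -` space M \<inter> space M)"
        using sets.sets_into_space[OF D] by auto
      ultimately show ?thesis
        using G[OF \<open>V \<in> G\<close>] D measurable_sets[OF S(1)]
        by (simp add: finite_measure_Diff)
    qed
    show "0 \<le> measure M (V \<inter> ?pre j D) \<and>
        measure M (V \<inter> ?pre j D) \<le> measure M D" if "D \<in> sets M" for j D
    proof -
      have "measure M (V \<inter> ?pre j D) \<le> measure M (?pre j D)"
        using that measurable_sets[OF S(1)] by (intro finite_measure_mono) auto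
      then show ?thesis
        using measure_preserving_vimage[OF S that, of j] by simp
    qed
    show "(\<lambda>j. measure M (V \<inter> ?pre j D)) \<longlonglongrightarrow> measure M V * measure M D" if "D \<in> G" for D
      using lim[OF \<open>V \<in> G\<close> that] by (simp add: asymptotically_independent_def)
  qed (rule B)
  have SB: "S j -` B \<inter> space M \<in> sets M" for j
    by (rule measurable_sets[OF S(1) B])
  have "(\<lambda>j. measure M (A \<inter> ?pre j B)) \<longlonglongrightarrow> measure M B * measure M A"
  proof (rule tendsto_on_generated[OF gen])
    show "(\<lambda>i. measure M (D i \<inter> ?pre j B)) sums measure M ((\<Union>i. D i) \<inter> ?pre j B)"
      if "range D \<subseteq> sets M" "disjoint_family D" for j D
    proof -
      have "range (\<lambda>i. D i \<inter> ?pre j B) \<subseteq> sets M"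
        using that(1) SB by auto
      moreover have "disjoint_family (\<lambda>i. D i \<inter> ?pre j B)"
        using that(2) by (auto simp: disjoint_family_on_def)
      ultimately have "(\<lambda>i. measure M (D i \<inter> ?pre j B))
          sums measure M (\<Union>i. D i \<inter> ?pre j B)"
        by (rule finite_measure_UNION)
      moreover have "(\<Union>i. D i \<inter> ?pre j B) = (\<Union>i. D i) \<inter> ?pre j B"
        by auto
      ultimately show ?thesis by simp
    qed
    show "measure M (space M \<inter> ?pre j B) = measure M B" for j
      using measure_preserving_vimage[OF S B, of j] by (simp add: Int_commute)
    show "measure M ((space M - D) \<inter> ?pre j B) =
        measure M (space M \<inter> ?pre j B) - measure M (D \<inter> ?pre j B)"
      if D: "D \<in> sets M" for j D
    proof -
      have "(space M - D) \<inter> ?pre j B =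
          (space M \<inter> ?pre j B) - (D \<inter> ?pre j B)"
        by auto
      moreover have "D \<inter> ?pre j B \<subseteq> space M \<inter> ?pre j B"
        by auto
      ultimately show ?thesis
        using SB D by (simp add: finite_measure_Diff)
    qed
    show "0 \<le> measure M (D \<inter> ?pre j B) \<and>
        measure M (D \<inter> ?pre j B) \<le> measure M D" if "D \<in> sets M" for j D
      using that by (auto intro!: finite_measure_mono)
    show "(\<lambda>j. measure M (D \<inter> ?pre j B)) \<longlonglongrightarrow> measure M B * measure M D" if "D \<in> G" for D
      using right[OF that] by (simp add: asymptotically_independent_def mult.commute)
  qed (rule A)
  then show ?thesis
    by (simp add: asymptotically_independent_def mult.commute)
qed

section \<open>An ergodicity criterion\<close>

definition mixing_sequence :: "'a measure \<Rightarrow> ('a \<Rightarrow> 'a) \<Rightarrow> (nat \<Rightarrow> 'a \<Rightarrow> 'a) \<Rightarrow> bool" where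
  "mixing_sequence M T S \<longleftrightarrow> range S \<subseteq> weak_homoclinic M T \<and>
     (\<forall>A\<in>sets M. \<forall>B\<in>sets M. asymptotically_independent M S A B)"

text \<open>
  A set \<open>A\<close> that is invariant under the weak homoclinic group satisfies \<open>A \<inter> S\<^sub>j\<^sup>-\<^sup>1 A = A\<close> mod 0 for all \<open>j\<close>,
  and mixing gives \<open>\<mu>(A) = \<mu>(A)\<^sup>2\<close> in the limit.
\<close>

lemma (in prob_space) ergodic_weak_homoclinicI:
  assumes T: "automorphism M T" and S: "mixing_sequence M T S"
  shows "ergodic_subgroup M (weak_homoclinic M T)"
  unfolding ergodic_subgroup_def
proof (intro conjI ballI impI aut_subgroup_weak_homoclinic T)
  fix A assume A[measurable]: "A \<in> sets M"
    and inv: "\<forall>R\<in>weak_homoclinic M T. emeasure M (sym_diff (aut_image M R A) A) = 0"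
  have "measure M (A \<inter> (S j -` A \<inter> space M)) = measure M A" for j
  proof -
    have SW: "S j \<in> weak_homoclinic M T"
      using S by (auto simp: mixing_sequence_def)
    then have Sj: "automorphism M (S j)"
      by (simp add: weak_homoclinic_def)
    note [measurable] = automorphismD(1)[OF Sj] automorphismD(1)[OF automorphism_aut_inv[OF Sj]]
    have "sym_diff (aut_image M (S j) A) A \<in> null_sets M"
      using inv SW by (auto simp: aut_image_def null_sets_def)
    then have "AE x in M. aut_inv M (S j) x \<in> A \<longleftrightarrow> x \<in> A"
    proof (rule AE_I')
      show "{x \<in> space M. \<not> (aut_inv M (S j) x \<in> A \<longleftrightarrow> x \<in> A)} \<subseteq> sym_diff (aut_image M (S j) A) A"
        unfolding aut_image_def by blast
    qed
    then have "AE x in M. aut_inv M (S j) (S j x) \<in> A \<longleftrightarrow> S j x \<in> A"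
      by (rule AE_measure_preserving[OF automorphismD(1,2)[OF Sj]])
    moreover have "AE x in M. aut_inv M (S j) (S j x) = x"
      using automorphismD(3)[OF Sj] by (simp add: ae_inverse_def)
    ultimately have "AE x in M. x \<in> A \<longleftrightarrow> S j x \<in> A"
      by eventually_elim simp
    then show ?thesis
      by (intro finite_measure_eq_AE) auto
  qed
  moreover have "(\<lambda>j. measure M (A \<inter> (S j -` A \<inter> space M))) \<longlonglongrightarrow> measure M A * measure M A"
    using S A by (simp add: mixing_sequence_def asymptotically_independent_def)
  ultimately have "measure M A = measure M A * measure M A"
    by (simp add: LIMSEQ_const_iff)
  then show "measure M A = 0 \<or> measure M A = 1"
    by simp
qed

section \<open>Transfer along isomorphisms\<close>

lemma isomorphism_intertwines_funpow:
  assumes T: "T \<in> measurable M M" "distr M M T = M"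
    and f: "AE x in M. f (T x) = R (f x)"
  shows "AE x in M. f ((T ^^ n) x) = (R ^^ n) (f x)"
proof (induction n)
  case (Suc n)
  have "AE x in M. f ((T ^^ n) (T x)) = (R ^^ n) (f (T x))"
    by (rule AE_measure_preserving[OF T Suc])
  with f show ?case
    by eventually_elim (simp add: funpow_Suc_right del: funpow.simps(2))
qed simp

lemma isomorphism_intertwines_inverse:
  assumes T: "automorphism M T" and R: "automorphism N R"
    and f: "f \<in> measurable M N" "distr M N f = N" and g: "g \<in> measurable N M" "distr N M g = M"
    and gf: "AE x in M. g (f x) = x" and fg: "AE y in N. f (g y) = y"
    and inter: "AE x in M. f (T x) = R (f x)"
  shows "AE y in N. aut_inv M T (g y) = g (aut_inv N R y)"
proof -
  note T' = automorphismD[OF T] and R' = automorphismD[OF R]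
    and Ri = automorphismD(1,2)[OF automorphism_aut_inv[OF R]]
  have "AE y in N. f (T (g y)) = R (f (g y))"
    by (rule AE_measure_preserving[OF g inter])
  moreover have "AE y in N. g (f (T (g y))) = T (g y)"
    by (rule AE_measure_preserving[OF g AE_measure_preserving[OF T'(1,2) gf]])
  moreover have "AE y in N. aut_inv M T (T (g y)) = g y"
    by (rule AE_measure_preserving[OF g]) (use T'(3) in \<open>simp add: ae_inverse_def\<close>)
  ultimately have "AE y in N. aut_inv M T (g (R y)) = g y"
    using fg by eventually_elim simp
  then have "AE y in N. aut_inv M T (g (R (aut_inv N R y))) = g (aut_inv N R y)"
    by (rule AE_measure_preserving[OF Ri])
  moreover have "AE y in N. R (aut_inv N R y) = y"
    using R'(3) by (simp add: ae_inverse_def)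
  ultimately show ?thesis
    by eventually_elim simp
qed

text \<open>
  The transported sequence is \<open>g \<circ> S\<^sub>j \<circ> f\<close>, where \<open>f\<close> and \<open>g\<close> are the mutually inverse isomorphisms.
\<close>

lemma mixing_sequence_transfer:
  assumes M: "prob_space M" and T: "automorphism M T" and R: "automorphism N R"
    and iso: "isomorphic_mod0 M T N R" and S: "mixing_sequence N R S"
  shows "\<exists>S'. mixing_sequence M T S'"
proof -
  obtain f g where f: "f \<in> measurable M N" "distr M N f = N"
    and g: "g \<in> measurable N M" "distr N M g = M"
    and gf: "AE x in M. g (f x) = x" and fg: "AE y in N. f (g y) = y"
    and inter: "AE x in M. f (T x) = R (f x)"
    using iso unfolding isomorphic_mod0_def by blast
  interpret M: prob_space M by (rule M)
  interpret N: prob_space N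
    using M.prob_space_distr[OF f(1)] f(2) by simp
  have SW: "S j \<in> weak_homoclinic N R" and Sj: "automorphism N (S j)" for j
    using S by (auto simp: mixing_sequence_def weak_homoclinic_def)
  define V where "V = aut_inv M T"
  define V' where "V' = aut_inv N R"
  have V: "V ^^ n \<in> measurable M M" and V': "V' ^^ n \<in> measurable N N" for n
    unfolding V_def V'_def
    by (intro automorphismD automorphism_funpow automorphism_aut_inv T R)+
  have VV': "AE y in N. (V ^^ n) (g y) = g ((V' ^^ n) y)" for n
  proof -
    have "AE y in N. V (g y) = g (V' y)"
      unfolding V_def V'_def by (rule isomorphism_intertwines_inverse[OF T R f g gf fg inter])
    then have "AE y in N. g (V' y) = V (g y)"
      by eventually_elim simp
    then have "AE y in N. g ((V' ^^ n) y) = (V ^^ n) (g y)"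
      unfolding V'_def
      by (intro isomorphism_intertwines_funpow automorphismD[OF automorphism_aut_inv[OF R]])
    then show ?thesis
      by eventually_elim simp
  qed
  define S' where "S' j = g \<circ> S j \<circ> f" for j
  note [measurable] = f(1) g(1) V V' automorphismD(1)[OF Sj]
  have S'_aut: "automorphism M (S' j)" for j
  proof -
    let ?i = "aut_inv N (S j)"
    note Si = automorphismD[OF Sj[of j]] and Sii = automorphismD[OF automorphism_aut_inv[OF Sj[of j]]]
    have "ae_inverse M (S' j) (g \<circ> ?i \<circ> f)"
      unfolding ae_inverse_def
    proof (intro conjI)
      show "g \<circ> ?i \<circ> f \<in> measurable M M"
        using Sii(1) by measurable
      have "AE x in M. f (g (S j (f x))) = S j (f x)"
        by (rule AE_measure_preserving[OF f AE_measure_preserving[OF Si(1,2) fg]])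
      moreover have "AE x in M. ?i (S j (f x)) = f x"
        by (rule AE_measure_preserving[OF f]) (use Si(3) in \<open>simp add: ae_inverse_def\<close>)
      ultimately show "AE x in M. (g \<circ> ?i \<circ> f) (S' j x) = x"
        using gf by eventually_elim (simp add: S'_def)
      have "AE x in M. f (g (?i (f x))) = ?i (f x)"
        by (rule AE_measure_preserving[OF f AE_measure_preserving[OF Sii(1,2) fg]])
      moreover have "AE x in M. S j (?i (f x)) = f x"
        by (rule AE_measure_preserving[OF f]) (use Si(3) in \<open>simp add: ae_inverse_def\<close>)
      ultimately show "AE x in M. S' j ((g \<circ> ?i \<circ> f) x) = x"
        using gf by eventually_elim (simp add: S'_def)
    qed
    moreover have "S' j \<in> measurable M M"
      unfolding S'_def by measurable
    moreover have "distr M M (S' j) = M"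
      unfolding S'_def
      by (rule distr_comp_eq[OF f measurable_comp[OF Si(1) g(1)] distr_comp_eq[OF Si(1,2) g]])
    ultimately show ?thesis
      unfolding automorphism_def by blast
  qed
  have "S' j \<in> weak_homoclinic M T" for j
    unfolding M.weak_homoclinic_iff[OF T] V_def[symmetric]
  proof (intro conjI ballI S'_aut)
    fix A assume A[measurable]: "A \<in> sets M"
    define B where "B = g -` A \<inter> space N"
    have B[measurable]: "B \<in> sets N"
      unfolding B_def by measurable
    have "moved M (S' j) (V ^^ n) A = moved N (S j) (V' ^^ n) B" for n
    proof -
      have "AE x in M. (V ^^ n) (g (S j (f x))) = g ((V' ^^ n) (S j (f x)))"
        by (rule AE_measure_preserving[OF f AE_measure_preserving[OF automorphismD(1,2)[OF Sj] VV']])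
      moreover have "AE x in M. (V ^^ n) (g (f x)) = g ((V' ^^ n) (f x))"
        by (rule AE_measure_preserving[OF f VV'])
      moreover have "AE x in M. x \<in> space M"
        by simp
      ultimately have "AE x in M. ((V ^^ n) (S' j x) \<in> A) \<noteq> ((V ^^ n) x \<in> A) \<longleftrightarrow>
          ((V' ^^ n) (S j (f x)) \<in> B) \<noteq> ((V' ^^ n) (f x) \<in> B)"
        using gf
      proof eventually_elim
        case (elim x)
        have "f x \<in> space N" "S j (f x) \<in> space N"
          using elim(3) measurable_space[OF f(1)] measurable_space[OF automorphismD(1)[OF Sj]] by auto
        then have "(V' ^^ n) (f x) \<in> space N" "(V' ^^ n) (S j (f x)) \<in> space N"
          using measurable_space[OF V'] by auto
        then show ?case
          using elim by (simp add: S'_def B_def)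
      qed
      then have "moved M (S' j) (V ^^ n) A
          = measure M {x \<in> space M. ((V' ^^ n) (S j (f x)) \<in> B) \<noteq> ((V' ^^ n) (f x) \<in> B)}"
        unfolding moved_def using automorphismD(1)[OF S'_aut[of j]]
        by (intro M.finite_measure_eq_AE) auto
      also have "\<dots> = moved N (S j) (V' ^^ n) B"
        unfolding moved_def
        by (rule measure_preserving_Collect[OF f,
              where Q="\<lambda>y. ((V' ^^ n) (S j y) \<in> B) \<noteq> ((V' ^^ n) y \<in> B)"]) measurable
      finally show ?thesis .
    qed
    then show "cesaro_null (\<lambda>n. moved M (S' j) (V ^^ n) A)"
      using SW[of j] B unfolding N.weak_homoclinic_iff[OF R] V'_def[symmetric] by simp
  qed
  moreover have "asymptotically_independent M S' A B" if [measurable]: "A \<in> sets M" "B \<in> sets M" for A B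
  proof -
    define C where "C = g -` A \<inter> space N"
    define D where "D = g -` B \<inter> space N"
    have CD[measurable]: "C \<in> sets N" "D \<in> sets N"
      unfolding C_def D_def by measurable
    have "measure M (A \<inter> (S' j -` B \<inter> space M)) = measure N (C \<inter> (S j -` D \<inter> space N))" for j
    proof -
      have "AE x in M. x \<in> A \<inter> (S' j -` B \<inter> space M) \<longleftrightarrow> x \<in> f -` (C \<inter> (S j -` D \<inter> space N)) \<inter> space M"
        using gf AE_space
      proof eventually_elim
        case (elim x)
        have "f x \<in> space N" "S j (f x) \<in> space N"
          using elim(2) measurable_space[OF f(1)] measurable_space[OF automorphismD(1)[OF Sj]] by auto
        then show ?case
          using elim by (auto simp: S'_def C_def D_def)
      qed
      then have "measure M (A \<inter> (S' j -` B \<inter> space M))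
          = measure M (f -` (C \<inter> (S j -` D \<inter> space N)) \<inter> space M)"
        using automorphismD(1)[OF S'_aut[of j]] by (intro M.finite_measure_eq_AE) auto
      also have "\<dots> = measure N (C \<inter> (S j -` D \<inter> space N))"
        by (rule measure_preserving_vimage[OF f]) measurable
      finally show ?thesis .
    qed
    moreover have "measure M A = measure N C" "measure M B = measure N D"
      unfolding C_def D_def by (rule measure_preserving_vimage[OF g, symmetric]; measurable)+
    ultimately show ?thesis
      using S CD by (simp add: mixing_sequence_def asymptotically_independent_def)
  qed
  ultimately have "mixing_sequence M T S'"
    by (auto simp: mixing_sequence_def)
  then show ?thesis by blast
qed

lemma weakly_mixing_cesaro:
  assumes "weakly_mixing M T" "A \<in> sets M" "B \<in> sets M"
  shows "cesaro_null (\<lambda>n. \<bar>measure M (((T ^^ n) -` A \<inter> space M) \<inter> B) - measure M A * measure M B\<bar>)"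
  using assms unfolding weakly_mixing_def by (intro cesaro_nullI_lessThan) auto

lemma weakly_mixing_transfer:
  assumes wm: "weakly_mixing M T" and iso: "isomorphic_mod0 M T N R"
    and M: "prob_space M" and T: "automorphism M T" and R: "automorphism N R"
  shows "weakly_mixing N R"
  unfolding weakly_mixing_def
proof (intro ballI)
  fix A B assume A: "A \<in> sets N" and B: "B \<in> sets N"
  let ?c = "\<lambda>n. measure N (((R ^^ n) -` A \<inter> space N) \<inter> B)"
  obtain f g where f: "f \<in> measurable M N" "distr M N f = N"
    and inter: "AE x in M. f (T x) = R (f x)"
    using iso unfolding isomorphic_mod0_def by blast
  interpret M: prob_space M by (rule M)
  have Rn: "R ^^ n \<in> measurable N N" and Tn: "T ^^ n \<in> measurable M M" for n
    by (intro automorphismD automorphism_funpow T R)+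
  note [measurable] = f(1) Rn Tn A B
  define C where "C = f -` A \<inter> space M"
  define D where "D = f -` B \<inter> space M"
  have CD[measurable]: "C \<in> sets M" "D \<in> sets M"
    unfolding C_def D_def by measurable
  have "measure M (((T ^^ n) -` C \<inter> space M) \<inter> D) = ?c n" for n
  proof -
    have "AE x in M. x \<in> ((T ^^ n) -` C \<inter> space M) \<inter> D \<longleftrightarrow>
        x \<in> f -` (((R ^^ n) -` A \<inter> space N) \<inter> B) \<inter> space M"
      using isomorphism_intertwines_funpow[OF automorphismD(1,2)[OF T] inter, of n] AE_space
    proof eventually_elim
      case (elim x)
      then show ?case
        using measurable_space[OF f(1)] measurable_space[OF Tn[of n]] by (auto simp: C_def D_def)
    qed
    then have "measure M (((T ^^ n) -` C \<inter> space M) \<inter> D)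
        = measure M (f -` (((R ^^ n) -` A \<inter> space N) \<inter> B) \<inter> space M)"
      by (intro M.finite_measure_eq_AE) auto
    also have "\<dots> = ?c n"
      by (rule measure_preserving_vimage[OF f]) measurable
    finally show ?thesis .
  qed
  moreover have "measure M C = measure N A" "measure M D = measure N B"
    unfolding C_def D_def by (rule measure_preserving_vimage[OF f]; measurable)+
  ultimately show "(\<lambda>N'. (\<Sum>n<N'. \<bar>?c n - measure N A * measure N B\<bar>)
      / real N') \<longlonglongrightarrow> 0"
    using wm[unfolded weakly_mixing_def, rule_format, OF CD] by (simp only:)
qed

section \<open>Void events\<close>

text \<open>
  A simple point configuration is determined by the sets that it avoids.  Void events are closed
  under intersection and have an explicit probability, so they replace the joint distribution of
  counts throughout.
\<close>

definition void :: "'y measure \<Rightarrow> (nat \<Rightarrow> 'y set) \<Rightarrow> 'y set \<Rightarrow> 'y set set" where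
  "void Y E C = {\<omega> \<in> configurations Y E. \<omega> \<inter> C = {}}"

definition void_events :: "'y measure \<Rightarrow> (nat \<Rightarrow> 'y set) \<Rightarrow> 'y set set set" where
  "void_events Y E = {void Y E C | C. C \<in> sets Y \<and> emeasure Y C < \<infinity>}"

lemma void_eq_count_event: "void Y E C = count_event Y E C 0"
  by (auto simp: void_def count_event_def)

lemma Int_stable_void_events: "Int_stable (void_events Y E)"
proof (rule Int_stableI)
  fix a b assume "a \<in> void_events Y E" "b \<in> void_events Y E"
  then obtain C D where C: "a = void Y E C" "C \<in> sets Y" "emeasure Y C < \<infinity>"
    and D: "b = void Y E D" "D \<in> sets Y" "emeasure Y D < \<infinity>"
    unfolding void_events_def by blast
  have "emeasure Y (C \<union> D) \<le> emeasure Y C + emeasure Y D"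
    using C D by (intro emeasure_subadditive)
  also have "\<dots> < \<infinity>"
    using C D by (simp add: ennreal_add_less_top)
  finally have "emeasure Y (C \<union> D) < \<infinity>" .
  moreover have "a \<inter> b = void Y E (C \<union> D)"
    using C D by (auto simp: void_def)
  ultimately show "a \<inter> b \<in> void_events Y E"
    using C D unfolding void_events_def by blast
qed

lemma void_events_subset: "void_events Y E \<subseteq> Pow (configurations Y E)"
  by (auto simp: void_events_def void_def)

text \<open>
  Two reals at distance \<open>d > 0\<close> have different floors after scaling by \<open>n\<close>, as soon as \<open>n * d \<ge> 1\<close>.
\<close>

lemma finite_separated_by_floor:
  fixes F :: "real set"
  assumes "finite F"
  shows "\<exists>n::nat. inj_on (\<lambda>x. \<lfloor>real n * x\<rfloor>) F"
proof -
  have "\<forall>\<^sub>F n in sequentially. \<forall>x\<in>F. \<forall>y\<in>F. x \<noteq> y \<longrightarrow> \<lfloor>real n * x\<rfloor> \<noteq> \<lfloor>real n * y\<rfloor>"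
  proof (intro eventually_ball_finite assms ballI)
    fix x y assume "x \<in> F" "y \<in> F"
    show "\<forall>\<^sub>F n in sequentially. x \<noteq> y \<longrightarrow> \<lfloor>real n * x\<rfloor> \<noteq> \<lfloor>real n * y\<rfloor>"
    proof (cases "x = y")
      case False
      obtain n0 :: nat where n0: "1 / \<bar>x - y\<bar> < real n0"
        using reals_Archimedean2 by blast
      have "\<lfloor>real n * x\<rfloor> \<noteq> \<lfloor>real n * y\<rfloor>" if "n \<ge> n0" for n
      proof
        assume eq: "\<lfloor>real n * x\<rfloor> = \<lfloor>real n * y\<rfloor>"
        have "\<bar>real n * x - real n * y\<bar> < 1"
          using eq by linarith
        then have "real n * \<bar>x - y\<bar> < 1"
          by (simp add: abs_mult flip: right_diff_distrib)
        moreover have "1 < real n0 * \<bar>x - y\<bar>"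
          using n0 False by (simp add: field_simps)
        moreover have "real n0 * \<bar>x - y\<bar> \<le> real n * \<bar>x - y\<bar>"
          using that by (intro mult_right_mono) auto
        ultimately show False by linarith
      qed
      then show ?thesis
        unfolding eventually_sequentially by blast
    qed simp
  qed
  then obtain n where "\<forall>x\<in>F. \<forall>y\<in>F. x \<noteq> y \<longrightarrow> \<lfloor>real n * x\<rfloor> \<noteq> \<lfloor>real n * y\<rfloor>"
    using eventually_happens'[OF sequentially_bot] by blast
  then show ?thesis
    unfolding inj_on_def by blast
qed

lemma standard_borel_injection:
  assumes "standard_borel M"
  obtains \<phi> :: "'a \<Rightarrow> real" where "\<phi> \<in> borel_measurable M" "inj_on \<phi> (space M)"
proof -
  obtain B f g where f: "f \<in> measurable M (restrict_space borel (B :: real set))"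
    and inv: "\<forall>x\<in>space M. g (f x) = x"
    using assms unfolding standard_borel_def by blast
  have "f \<in> borel_measurable M"
    using f by (simp add: measurable_restrict_space2_iff)
  moreover have "inj_on f (space M)"
    using inv by (metis inj_onI)
  ultimately show ?thesis by (rule that)
qed

text \<open>
  A configuration has at least \<open>k\<close> points in \<open>A\<close> if and only if it meets \<open>k\<close> different cells of \<open>A\<close> for
  some grid, where the cells come from a measurable injection of the standard space into the reals.
  This is a countable condition on void events, and \<open>count_event\<close> is a difference of two conditions of
  this kind.
\<close>

lemma sets_config_space_void_events:
  assumes Y: "standard_borel Y"
  shows "sets (config_space Y E) = sigma_sets (configurations Y E) (void_events Y E)"
proof
  let ?\<Omega> = "configurations Y E"
  let ?\<Sigma> = "sigma_sets ?\<Omega> (void_events Y E)"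
  have sets_config: "sets (config_space Y E) =
      sigma_sets ?\<Omega> {count_event Y E A k | A k. A \<in> sets Y \<and> emeasure Y A < \<infinity>}"
    unfolding config_space_def by (intro sets_measure_of) (auto simp: count_event_def)
  show "?\<Sigma> \<subseteq> sets (config_space Y E)"
    unfolding sets_config by (intro sigma_sets_mono') (auto simp: void_events_def void_eq_count_event)
  interpret sigma_algebra ?\<Omega> ?\<Sigma>
    by (rule sigma_algebra_sigma_sets[OF void_events_subset])
  obtain \<phi> :: "'a \<Rightarrow> real" where \<phi>[measurable]: "\<phi> \<in> borel_measurable Y" and inj: "inj_on \<phi> (space Y)"
    using standard_borel_injection[OF Y] by blast
  have "count_event Y E A k \<in> ?\<Sigma>" if A: "A \<in> sets Y" "emeasure Y A < \<infinity>" for A k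
  proof -
    note [measurable] = A(1)
    define cell where "cell n j = A \<inter> {y \<in> space Y. \<lfloor>real n * \<phi> y\<rfloor> = j}" for n :: nat and j :: int
    have cell: "cell n j \<in> sets Y" for n j
      unfolding cell_def by measurable
    have hit: "?\<Omega> - void Y E (cell n j) \<in> ?\<Sigma>" for n j
    proof -
      have "emeasure Y (cell n j) \<le> emeasure Y A"
        using A by (intro emeasure_mono) (auto simp: cell_def)
      then have "emeasure Y (cell n j) < \<infinity>"
        using A(2) by (rule le_less_trans)
      then have "void Y E (cell n j) \<in> void_events Y E"
        using cell unfolding void_events_def by blast
      then show ?thesis
        by (intro compl_sets sigma_sets.Basic)
    qed
    define at_least where "at_least k = (\<Union>n. \<Union>J\<in>{J. finite J \<and> card J = k}.
        {\<omega> \<in> ?\<Omega>. \<forall>j\<in>J. \<omega> \<in> ?\<Omega> - void Y E (cell n j)})" for k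
    have at_least_sets: "at_least k \<in> ?\<Sigma>" for k
    proof -
      have count: "countable {J :: int set. finite J \<and> card J = k}"
        by (rule countable_subset[OF _ countable_Collect_finite]) auto
      have "{\<omega> \<in> ?\<Omega>. \<forall>j\<in>J. \<omega> \<in> ?\<Omega> - void Y E (cell n j)} \<in> ?\<Sigma>" if "finite J" for n J
      proof (rule sets_Collect_finite_All[OF _ that])
        fix j
        have "{\<omega> \<in> ?\<Omega>. \<omega> \<in> ?\<Omega> - void Y E (cell n j)} = ?\<Omega> - void Y E (cell n j)"
          by blast
        then show "{\<omega> \<in> ?\<Omega>. \<omega> \<in> ?\<Omega> - void Y E (cell n j)} \<in> ?\<Sigma>"
          using hit by simp
      qed
      then have "(\<Union>J\<in>{J. finite J \<and> card J = k}.
          {\<omega> \<in> ?\<Omega>. \<forall>j\<in>J. \<omega> \<in> ?\<Omega> - void Y E (cell n j)}) \<in> ?\<Sigma>" for n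
        by (intro countable_UN''[OF count]) (simp only: mem_Collect_eq)
      then show ?thesis
        unfolding at_least_def by (intro countable_UN image_subsetI)
    qed
    have at_least: "\<omega> \<in> at_least k \<longleftrightarrow> \<omega> \<in> ?\<Omega> \<and> (\<exists>F. F \<subseteq> \<omega> \<inter> A \<and> finite F \<and> card F = k)" for \<omega> k
    proof safe
      assume "\<omega> \<in> at_least k"
      then obtain n J where J: "finite J" "card J = k" "\<omega> \<in> ?\<Omega>" "\<forall>j\<in>J. \<omega> \<notin> void Y E (cell n j)"
        unfolding at_least_def by blast
      then have "\<forall>j\<in>J. \<exists>y. y \<in> \<omega> \<inter> cell n j"
        unfolding void_def by blast
      then obtain y where y: "\<And>j. j \<in> J \<Longrightarrow> y j \<in> \<omega> \<inter> cell n j"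
        by metis
      have "inj_on y J"
      proof (rule inj_onI)
        fix i j assume "i \<in> J" "j \<in> J" "y i = y j"
        then show "i = j" using y[of i] y[of j] by (auto simp: cell_def)
      qed
      then have "card (y ` J) = k"
        using J card_image by blast
      moreover have "y ` J \<subseteq> \<omega> \<inter> A"
        using y by (auto simp: cell_def)
      ultimately show "\<exists>F. F \<subseteq> \<omega> \<inter> A \<and> finite F \<and> card F = k"
        using J(1) by blast
      show "\<omega> \<in> ?\<Omega>" by (rule J(3))
    next
      fix F assume \<omega>: "\<omega> \<in> ?\<Omega>" and F: "F \<subseteq> \<omega> \<inter> A" "finite F"
      have FY: "F \<subseteq> space Y"
        using F \<omega> by (auto simp: configurations_def)
      obtain n where n: "inj_on (\<lambda>x. \<lfloor>real n * x\<rfloor>) (\<phi> ` F)"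
        using finite_separated_by_floor[of "\<phi> ` F"] F by blast
      define J where "J = (\<lambda>y. \<lfloor>real n * \<phi> y\<rfloor>) ` F"
      have "inj_on (\<lambda>y. \<lfloor>real n * \<phi> y\<rfloor>) F"
        using comp_inj_on[OF inj_on_subset[OF inj FY] n] by (simp add: comp_def)
      then have "finite J" "card J = card F"
        using F by (auto simp: J_def card_image)
      moreover have "\<omega> \<notin> void Y E (cell n j)" if "j \<in> J" for j
        using that F FY by (auto simp: J_def void_def cell_def)
      ultimately have "J \<in> {J. finite J \<and> card J = card F}"
          "\<omega> \<in> {\<omega> \<in> ?\<Omega>. \<forall>j\<in>J. \<omega> \<in> ?\<Omega> - void Y E (cell n j)}"
        using \<omega> by auto
      then show "\<omega> \<in> at_least (card F)"
        unfolding at_least_def UN_iff by (intro bexI[of _ n] bexI[of _ J] UNIV_I)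
    qed
    have "count_event Y E A k = at_least k - at_least (Suc k)"
    proof (intro set_eqI iffI)
      fix \<omega> assume "\<omega> \<in> count_event Y E A k"
      then have \<omega>: "\<omega> \<in> ?\<Omega>" "finite (\<omega> \<inter> A)" "card (\<omega> \<inter> A) = k"
        by (auto simp: count_event_def)
      have "card F \<le> k" if "F \<subseteq> \<omega> \<inter> A" for F
        using card_mono[OF \<omega>(2) that] \<omega>(3) by simp
      then have "\<not> (\<exists>F. F \<subseteq> \<omega> \<inter> A \<and> finite F \<and> card F = Suc k)"
        using \<omega>(2) by (metis Suc_n_not_le_n)
      moreover have "\<exists>F. F \<subseteq> \<omega> \<inter> A \<and> finite F \<and> card F = k"
        using \<omega> by blast
      ultimately show "\<omega> \<in> at_least k - at_least (Suc k)"
        using \<omega>(1) unfolding Diff_iff at_least by iprover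
    next
      fix \<omega> assume "\<omega> \<in> at_least k - at_least (Suc k)"
      then obtain F where \<omega>: "\<omega> \<in> ?\<Omega>" and F: "F \<subseteq> \<omega> \<inter> A" "finite F" "card F = k"
        and no: "\<And>F. F \<subseteq> \<omega> \<inter> A \<Longrightarrow> finite F \<Longrightarrow> card F \<noteq> Suc k"
        by (auto simp: at_least)
      have "\<omega> \<inter> A \<subseteq> F"
      proof
        fix y assume "y \<in> \<omega> \<inter> A"
        then show "y \<in> F"
          using no[of "insert y F"] F by (cases "y \<in> F") auto
      qed
      then have "\<omega> \<inter> A = F" using F by blast
      then show "\<omega> \<in> count_event Y E A k"
        using \<omega> F by (simp add: count_event_def)
    qed
    then show ?thesis
      using at_least_sets by auto
  qed
  then show "sets (config_space Y E) \<subseteq> ?\<Sigma>"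
    unfolding sets_config by (intro sigma_sets_subset) blast
qed

section \<open>Exchanging sets by a power of an automorphism\<close>

text \<open>
  The involution \<open>s\<close> exchanges \<open>A\<close>, the part of \<open>K\<close> that \<open>p\<close> moves off \<open>K\<close> but keeps in \<open>L\<close>, with
  \<open>B = p A\<close>, and is the identity elsewhere.  So sets can be exchanged by means of \<open>p\<close> itself, without
  a classification of measure spaces.  The relations hold at every point of the space, since the null
  sets where \<open>p\<close> and its inverse \<open>q\<close> do not cancel have been removed; this makes the induced map of
  configurations an exact involution.
\<close>

lemma swap_automorphism:
  assumes p: "automorphism Y p" and K[measurable]: "K \<in> sets Y" and L[measurable]: "L \<in> sets Y"
    and KL: "K \<subseteq> L"
  obtains s A where
    "s \<in> measurable Y Y" "distr Y Y s = Y" "\<And>y. y \<in> space Y \<Longrightarrow> s (s y) = y"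
    "\<And>y. y \<in> L \<Longrightarrow> s y \<in> L" "\<And>y. y \<notin> L \<Longrightarrow> s y = y"
    "A \<in> sets Y" "A \<subseteq> K" "\<And>y. y \<in> A \<Longrightarrow> s y \<notin> K"
    "AE y in Y. y \<in> K - A \<longrightarrow> p y \<in> K \<or> p y \<notin> L"
proof -
  define q where "q = aut_inv Y p"
  note p' = automorphismD(1,2)[OF p]
  note q' = automorphismD(1,2)[OF automorphism_aut_inv[OF p], folded q_def]
  note [measurable] = p'(1) q'(1)
  have "AE y in Y. q (p y) = y" "AE y in Y. p (q y) = y"
    using automorphismD(3)[OF p] by (auto simp: ae_inverse_def q_def)
  then obtain N N' where N: "N \<in> null_sets Y" "\<And>y. y \<in> space Y - N \<Longrightarrow> q (p y) = y"
    and N': "N' \<in> null_sets Y" "\<And>y. y \<in> space Y - N' \<Longrightarrow> p (q y) = y"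
    unfolding eventually_ae_filter by blast
  have [measurable]: "N \<in> sets Y" "N' \<in> sets Y"
    using N(1) N'(1) by auto
  define A where "A = {y \<in> space Y. y \<in> K \<and> y \<notin> N \<and> p y \<in> L \<and> p y \<notin> K \<and> p y \<notin> N'}"
  define B where "B = {z \<in> space Y. z \<in> L \<and> z \<notin> K \<and> z \<notin> N' \<and> q z \<in> A}"
  have A[measurable]: "A \<in> sets Y"
    unfolding A_def by measurable
  have B[measurable]: "B \<in> sets Y"
    unfolding B_def by measurable
  \<comment> \<open>The conditions in \<open>A\<close> and \<open>B\<close> are chosen so that \<open>p\<close> and \<open>q\<close> are mutually inverse bijections
     between the two sets at every point.\<close>
  have qp: "q (p y) = y" "p y \<in> B" if "y \<in> A" for y
    using that N(2)[of y] measurable_space[OF p'(1), of y] by (auto simp: A_def B_def)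
  have pq: "p (q z) = z" "q z \<in> A" if "z \<in> B" for z
    using that N'(2) by (auto simp: B_def)
  have AB: "A \<inter> B = {}" "A \<subseteq> K" "A \<subseteq> space Y" "B \<inter> K = {}" "B \<subseteq> L"
    by (auto simp: A_def B_def)
  define s where "s y = (if y \<in> A then p y else if y \<in> B then q y else y)" for y
  have s_meas[measurable]: "s \<in> measurable Y Y"
    unfolding s_def by measurable
  have "distr Y Y s = Y"
  proof (rule measure_eqI)
    fix C assume "C \<in> sets (distr Y Y s)"
    then have C[measurable]: "C \<in> sets Y" by simp
    let ?A' = "A \<inter> (p -` C \<inter> space Y)" and ?B' = "B \<inter> (q -` C \<inter> space Y)"
    have "AE y in Y. y \<in> ?A' \<longleftrightarrow> y \<in> p -` (C \<inter> B) \<inter> space Y"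
    proof (rule AE_I'[OF N(1)], safe)
      fix y assume "y \<in> space Y" "y \<notin> N" "p y \<in> C" "p y \<in> B"
      then show "y \<in> A" using N(2)[of y] pq(2)[of "p y"] by simp
    qed (use qp AB in auto)
    then have "emeasure Y ?A' = emeasure Y (p -` (C \<inter> B) \<inter> space Y)"
      by (rule emeasure_eq_AE) measurable
    also have "\<dots> = emeasure Y (C \<inter> B)"
      using emeasure_distr[OF p'(1), of "C \<inter> B"] p'(2) by simp
    finally have eA: "emeasure Y ?A' = emeasure Y (C \<inter> B)" .
    have "AE y in Y. y \<in> ?B' \<longleftrightarrow> y \<in> q -` (C \<inter> A) \<inter> space Y"
    proof (rule AE_I'[OF N'(1)], safe)
      fix y assume y: "y \<in> space Y" "y \<notin> N'" "q y \<in> C" "q y \<in> A"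
      then show "y \<in> B" using N'(2)[of y] qp(2)[of "q y"] by simp
    qed (use pq B sets.sets_into_space in auto)
    then have "emeasure Y ?B' = emeasure Y (q -` (C \<inter> A) \<inter> space Y)"
      by (rule emeasure_eq_AE) measurable
    also have "\<dots> = emeasure Y (C \<inter> A)"
      using emeasure_distr[OF q'(1), of "C \<inter> A"] q'(2) by simp
    finally have eB: "emeasure Y ?B' = emeasure Y (C \<inter> A)" .
    have "s -` C \<inter> space Y = ?A' \<union> (?B' \<union> (C - (A \<union> B)))"
      using AB sets.sets_into_space[OF C] by (auto simp: s_def split: if_splits)
    then have "emeasure Y (s -` C \<inter> space Y) = emeasure Y (?A' \<union> (?B' \<union> (C - (A \<union> B))))"
      by simp
    also have "\<dots> = emeasure Y ?A' + emeasure Y (?B' \<union> (C - (A \<union> B)))"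
      using AB by (intro plus_emeasure[symmetric]) auto
    also have "emeasure Y (?B' \<union> (C - (A \<union> B))) = emeasure Y ?B' + emeasure Y (C - (A \<union> B))"
      by (rule plus_emeasure[symmetric]) auto
    also note eA
    also note eB
    also have "emeasure Y (C \<inter> A) + emeasure Y (C - (A \<union> B)) = emeasure Y ((C \<inter> A) \<union> (C - (A \<union> B)))"
      by (rule plus_emeasure) auto
    also have "emeasure Y (C \<inter> B) + \<dots> = emeasure Y ((C \<inter> B) \<union> ((C \<inter> A) \<union> (C - (A \<union> B))))"
      using AB by (intro plus_emeasure) auto
    also have "(C \<inter> B) \<union> ((C \<inter> A) \<union> (C - (A \<union> B))) = C"
      by auto
    finally show "emeasure (distr Y Y s) C = emeasure Y C"
      by (simp add: emeasure_distr)
  qed simp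
  moreover have "s (s y) = y" for y
    using qp[of y] pq[of y] AB by (auto simp: s_def)
  moreover have "s y \<in> L" if "y \<in> L" for y
    using that qp[of y] pq[of y] AB KL by (auto simp: s_def)
  moreover have "s y = y" if "y \<notin> L" for y
    using that AB KL by (auto simp: s_def)
  moreover have "s y \<notin> K" if "y \<in> A" for y
    using that qp[of y] AB by (auto simp: s_def)
  moreover have "AE y in Y. y \<in> K - A \<longrightarrow> p y \<in> K \<or> p y \<notin> L"
  proof -
    have "AE y in Y. p y \<notin> N'"
      by (rule AE_measure_preserving[OF p']) (rule AE_not_in[OF N'(1)])
    with AE_not_in[OF N(1)] AE_space show ?thesis
      by eventually_elim (auto simp: A_def)
  qed
  ultimately show ?thesis
    using that[OF s_meas] A AB(2) by blast
qed

section \<open>Poisson suspensions\<close>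

locale poisson_space =
  fixes Y :: "'y measure" and E :: "nat \<Rightarrow> 'y set" and P :: "'y set measure"
  assumes standard: "standard_borel Y" and exhausting: "exhausting Y E"
    and poisson: "poisson_measure Y E P"
begin

sublocale prob_space P
  using poisson by (simp add: poisson_measure_def)

lemma space_P: "space P = configurations Y E"
  using poisson by (simp add: poisson_measure_def)

lemma sets_P: "sets P = sigma_sets (space P) (void_events Y E)"
  using poisson sets_config_space_void_events[OF standard]
  by (simp add: poisson_measure_def)

lemma void_sets:
  assumes "C \<in> sets Y" "emeasure Y C < \<infinity>"
  shows "void Y E C \<in> sets P"
  using assms unfolding sets_P void_events_def by blast

lemma measure_void:
  assumes "C \<in> sets Y" "emeasure Y C < \<infinity>"
  shows "measure P (void Y E C) = exp (- measure Y C)"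
  using assms poisson by (simp add: void_eq_count_event poisson_measure_def)

lemma E_sets [measurable]: "E n \<in> sets Y" and E_finite: "emeasure Y (E n) < \<infinity>"
  and E_mono: "m \<le> n \<Longrightarrow> E m \<subseteq> E n" and E_Un: "(\<Union>n. E n) = space Y"
  using exhausting by (auto simp: exhausting_def incseq_def)

text \<open>
  The points of almost every configuration avoid a given null set, because the event that this set is
  void has probability \<open>exp 0\<close>.
\<close>

lemma AE_all_points:
  assumes "AE y in Y. Q y"
  shows "AE \<omega> in P. \<forall>y\<in>\<omega>. Q y"
proof -
  obtain N where N: "N \<in> null_sets Y" "{y \<in> space Y. \<not> Q y} \<subseteq> N"
    using assms unfolding eventually_ae_filter by blast
  have "measure P (void Y E N) = exp (- measure Y N)"
    using N(1) by (intro measure_void) (auto simp: null_sets_def)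
  also have "measure Y N = 0"
    using N(1) by (simp add: measure_def null_sets_def)
  finally have "AE \<omega> in P. \<omega> \<in> void Y E N"
    by (intro AE_prob_1) simp
  then show ?thesis
    by eventually_elim (use N(2) in \<open>auto simp: void_def configurations_def\<close>)
qed

lemma AE_funpow_image:
  assumes R: "automorphism P R" and img: "AE \<omega> in P. R \<omega> = t ` \<omega>"
  shows "AE \<omega> in P. (R ^^ n) \<omega> = (t ^^ n) ` \<omega>"
proof (induction n)
  case (Suc n)
  have "AE \<omega> in P. R ((R ^^ n) \<omega>) = t ` (R ^^ n) \<omega>"
    by (rule AE_measure_preserving[OF automorphismD(1,2)[OF automorphism_funpow[OF R]] img])
  with Suc show ?case
    by eventually_elim (simp add: image_comp)
qed simp

lemma AE_inverse_image:
  assumes R: "automorphism P R" and T0: "automorphism Y T0" and img: "AE \<omega> in P. R \<omega> = T0 ` \<omega>"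
  shows "AE \<omega> in P. aut_inv P R \<omega> = aut_inv Y T0 ` \<omega>"
proof -
  note V = automorphismD(1,2)[OF automorphism_aut_inv[OF R]]
  have "AE \<omega> in P. R (aut_inv P R \<omega>) = T0 ` aut_inv P R \<omega>"
    by (rule AE_measure_preserving[OF V img])
  moreover have "AE \<omega> in P. R (aut_inv P R \<omega>) = \<omega>"
    using automorphismD(3)[OF R] by (simp add: ae_inverse_def)
  moreover have "AE \<omega> in P. \<forall>y\<in>aut_inv P R \<omega>. aut_inv Y T0 (T0 y) = y"
    by (rule AE_measure_preserving[OF V AE_all_points])
      (use automorphismD(3)[OF T0] in \<open>simp add: ae_inverse_def\<close>)
  ultimately show ?thesis
  proof eventually_elim
    case (elim \<omega>)
    have "aut_inv Y T0 ` \<omega> = aut_inv Y T0 ` T0 ` aut_inv P R \<omega>"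
      using elim by simp
    also have "\<dots> = aut_inv P R \<omega>"
      using elim(3) by (force simp: image_comp)
    finally show ?case by simp
  qed
qed

lemma AE_in_void_image:
  assumes F: "F \<in> measurable P P" and img: "AE \<omega> in P. F \<omega> = t ` \<omega>"
  shows "AE \<omega> in P. F \<omega> \<in> void Y E C \<longleftrightarrow> \<omega> \<in> void Y E (t -` C \<inter> space Y)"
  using img AE_space
proof eventually_elim
  case (elim \<omega>)
  have "t ` \<omega> \<in> configurations Y E" "\<omega> \<in> configurations Y E"
    using measurable_space[OF F elim(2)] elim by (auto simp: space_P)
  then show ?case
    unfolding elim(1) by (auto simp: void_def configurations_def)
qed

lemma measure_vimage_automorphism:
  assumes "automorphism Y t" "C \<in> sets Y"
  shows "t -` C \<inter> space Y \<in> sets Y" "emeasure Y (t -` C \<inter> space Y) = emeasure Y C"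
    "measure Y (t -` C \<inter> space Y) = measure Y C"
  using automorphismD[OF assms(1)] assms(2) emeasure_distr[of t Y Y C]
    measure_preserving_vimage[of t Y Y C] by auto

text \<open>
  Weak mixing of the suspension, applied to the events that \<open>D\<close> and \<open>C\<close> are void, compares
  \<open>exp (- m (T\<^sub>0\<^sup>-\<^sup>n D \<union> C))\<close> with \<open>exp (- m D - m C)\<close>.  Their quotient is \<open>exp (m (T\<^sub>0\<^sup>-\<^sup>n D \<inter> C))\<close>, which
  controls the overlap because \<open>exp t - 1 \<ge> t\<close>.
\<close>

lemma overlaps_vanish:
  assumes R: "automorphism P R" and T0: "automorphism Y T0" and img: "AE \<omega> in P. R \<omega> = T0 ` \<omega>"
    and mix: "weakly_mixing P R"
    and C: "C \<in> sets Y" "emeasure Y C < \<infinity>" and D: "D \<in> sets Y" "emeasure Y D < \<infinity>"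
  shows "cesaro_null (\<lambda>n. measure Y (((T0 ^^ n) -` D \<inter> space Y) \<inter> C))"
proof (rule cesaro_null_mono[OF cesaro_null_cmult[OF weakly_mixing_cesaro[OF mix void_sets[OF D] void_sets[OF C]]]])
  fix n
  let ?PDC = "measure P (((R ^^ n) -` void Y E D \<inter> space P) \<inter> void Y E C)"
  let ?PP = "measure P (void Y E D) * measure P (void Y E C)"
  define Dn where "Dn = (T0 ^^ n) -` D \<inter> space Y"
  note Dn = measure_vimage_automorphism[OF automorphism_funpow[OF T0, of n] D(1), folded Dn_def]
  have Rn: "R ^^ n \<in> measurable P P"
    by (intro automorphismD automorphism_funpow R)
  have fm: "Dn \<in> fmeasurable Y" "C \<in> fmeasurable Y"
    using Dn C D by (auto simp: fmeasurable_def)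
  then have "Dn \<union> C \<in> fmeasurable Y" by auto
  then have U: "Dn \<union> C \<in> sets Y" "emeasure Y (Dn \<union> C) < \<infinity>"
    by (auto simp: fmeasurable_def)
  have "?PDC = measure P (void Y E (Dn \<union> C))"
  proof (rule finite_measure_eq_AE)
    show "AE \<omega> in P. \<omega> \<in> ((R ^^ n) -` void Y E D \<inter> space P) \<inter> void Y E C \<longleftrightarrow> \<omega> \<in> void Y E (Dn \<union> C)"
      using AE_in_void_image[OF Rn AE_funpow_image[OF R img], of D] AE_space
      by eventually_elim (auto simp: void_def Dn_def)
    show "((R ^^ n) -` void Y E D \<inter> space P) \<inter> void Y E C \<in> sets P"
      using measurable_sets[OF Rn void_sets[OF D]] void_sets[OF C] by auto
  qed (rule void_sets[OF U])
  also have "\<dots> = exp (- measure Y (Dn \<union> C))"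
    by (rule measure_void[OF U])
  also have "measure Y (Dn \<union> C) = measure Y D + measure Y C - measure Y (Dn \<inter> C)"
    using measure_Un3[OF fm] Dn(3) by simp
  finally have "?PDC - ?PP
      = exp (- (measure Y D + measure Y C)) * (exp (measure Y (Dn \<inter> C)) - 1)"
    using C D by (simp add: measure_void algebra_simps flip: exp_add)
  moreover have "measure Y (Dn \<inter> C) \<le> exp (measure Y (Dn \<inter> C)) - 1"
    using exp_ge_add_one_self[of "measure Y (Dn \<inter> C)"] by linarith
  then have "exp (- (measure Y D + measure Y C)) * measure Y (Dn \<inter> C)
      \<le> exp (- (measure Y D + measure Y C)) * (exp (measure Y (Dn \<inter> C)) - 1)"
    by (rule mult_left_mono) simp
  ultimately have "exp (- (measure Y D + measure Y C)) * measure Y (Dn \<inter> C)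
      \<le> \<bar>?PDC - ?PP\<bar>"
    by linarith
  then have "exp (measure Y D + measure Y C) * (exp (- (measure Y D + measure Y C)) * measure Y (Dn \<inter> C))
      \<le> exp (measure Y D + measure Y C) * \<bar>?PDC - ?PP\<bar>"
    by (rule mult_left_mono) simp
  moreover have "exp (measure Y D + measure Y C) * (exp (- (measure Y D + measure Y C)) * measure Y (Dn \<inter> C))
      = measure Y (Dn \<inter> C)"
    by (simp only: mult.assoc[symmetric] exp_add[symmetric]) simp
  ultimately show "measure Y (((T0 ^^ n) -` D \<inter> space Y) \<inter> C) \<le> exp (measure Y D + measure Y C) *
      \<bar>?PDC - ?PP\<bar>"
    by (simp only: Dn_def)
qed simp

text \<open>
  As \<open>s\<close> lives on \<open>E l\<close>, where every configuration is finite, the image of every configuration is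
  again one, with no exceptional set.  Invariance of the Poisson measure need only be checked on void
  events, where it is the invariance of the intensity.
\<close>

lemma image_suspension:
  assumes s: "s \<in> measurable Y Y" "distr Y Y s = Y" and invol: "\<And>y. y \<in> space Y \<Longrightarrow> s (s y) = y"
    and supp: "\<And>y. y \<in> E l \<Longrightarrow> s y \<in> E l" "\<And>y. y \<notin> E l \<Longrightarrow> s y = y"
  shows "image s -` void Y E C \<inter> space P = void Y E (s -` C \<inter> space Y)"
    and "automorphism P (image s)"
proof -
  note sY = measurable_space[OF s(1)]
  have conf: "s ` \<omega> \<in> configurations Y E" if "\<omega> \<in> configurations Y E" for \<omega>
  proof -
    have "s ` \<omega> \<inter> E n \<subseteq> s ` (\<omega> \<inter> E n) \<union> s ` (\<omega> \<inter> E l)" for n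
      using supp by force
    then have "finite (s ` \<omega> \<inter> E n)" for n
      by (rule finite_subset) (use that in \<open>auto simp: configurations_def\<close>)
    then show ?thesis
      using that sY by (auto simp: configurations_def)
  qed
  show vimage: "image s -` void Y E C \<inter> space P = void Y E (s -` C \<inter> space Y)" for C
    using conf by (auto simp: void_def space_P) (auto simp: configurations_def)
  have pull: "s -` C \<inter> space Y \<in> sets Y" "emeasure Y (s -` C \<inter> space Y) = emeasure Y C" if "C \<in> sets Y" for C
    using that s(2) measurable_sets[OF s(1) that] emeasure_distr[OF s(1) that] by auto
  have measure_eq: "measure Y (s -` C \<inter> space Y) = measure Y C" if "C \<in> sets Y" for C
    using pull(2)[OF that] by (simp add: measure_def)
  have meas: "image s \<in> measurable P P"
  proof (rule measurable_sigma_sets[OF sets_P])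
    show "void_events Y E \<subseteq> Pow (space P)"
      unfolding space_P by (rule void_events_subset)
    show "image s \<in> space P \<rightarrow> space P"
      using conf by (auto simp: space_P)
    fix V assume "V \<in> void_events Y E"
    then show "image s -` V \<inter> space P \<in> sets P"
      using pull by (auto simp: void_events_def vimage intro!: void_sets)
  qed
  moreover have "distr P P (image s) = P"
  proof (rule measure_eqI_generator_eq[OF Int_stable_void_events])
    show "void_events Y E \<subseteq> Pow (space P)"
      unfolding space_P by (rule void_events_subset)
    show "sets (distr P P (image s)) = sigma_sets (space P) (void_events Y E)"
      using sets_P by simp
    show "sets P = sigma_sets (space P) (void_events Y E)"
      by (rule sets_P)
    have "void Y E {} = space P"
      by (auto simp: void_def space_P)
    then show "range (\<lambda>_::nat. space P) \<subseteq> void_events Y E"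
      by (auto simp: void_events_def intro!: exI[of _ "{}"])
    fix V assume "V \<in> void_events Y E"
    then obtain C where C: "V = void Y E C" "C \<in> sets Y" "emeasure Y C < \<infinity>"
      unfolding void_events_def by blast
    have "emeasure (distr P P (image s)) V = emeasure P (void Y E (s -` C \<inter> space Y))"
      using C void_sets by (simp add: emeasure_distr[OF meas] vimage)
    also have "\<dots> = emeasure P V"
      using pull[OF C(2)] C by (simp add: emeasure_eq_measure measure_void measure_eq)
    finally show "emeasure (distr P P (image s)) V = emeasure P V" .
  qed (auto simp: emeasure_distr[OF meas] emeasure_eq_measure)
  moreover have "ae_inverse P (image s) (image s)"
  proof -
    have "s ` s ` \<omega> = \<omega>" if "\<omega> \<in> space P" for \<omega>
    proof -
      have "\<omega> \<subseteq> space Y"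
        using that by (simp add: space_P configurations_def)
      then show ?thesis
        using invol by (force simp: image_comp)
    qed
    then show ?thesis
      using meas by (auto simp: ae_inverse_def)
  qed
  ultimately show "automorphism P (image s)"
    unfolding automorphism_def by blast
qed

text \<open>
  If passing from \<open>\<omega>\<close> to \<open>s ` \<omega>\<close> changes whether \<open>C'\<close> is void, then \<open>\<omega>\<close> or \<open>s ` \<omega>\<close> has a point in \<open>C'\<close> that \<open>s\<close>
  moves, and hence a point in \<open>E l \<inter> C'\<close>.  Either event has probability at most the measure of
  \<open>E l \<inter> C'\<close>.
\<close>

lemma moved_image_le:
  assumes S: "automorphism P (image s)"
    and s: "s \<in> measurable Y Y" and invol: "\<And>y. y \<in> space Y \<Longrightarrow> s (s y) = y"
    and supp: "\<And>y. y \<in> E l \<Longrightarrow> s y \<in> E l" "\<And>y. y \<notin> E l \<Longrightarrow> s y = y"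
    and U: "U \<in> measurable P P" "AE \<omega> in P. U \<omega> \<in> void Y E C \<longleftrightarrow> \<omega> \<in> void Y E C'"
    and C: "C \<in> sets Y" "emeasure Y C < \<infinity>" and C': "C' \<in> sets Y" "emeasure Y C' < \<infinity>"
  shows "moved P (image s) U (void Y E C) \<le> 2 * measure Y (E l \<inter> C')"
proof -
  note S' = automorphismD(1,2)[OF S]
  have [measurable]: "void Y E C \<in> sets P" "void Y E C' \<in> sets P"
    using void_sets C C' by auto
  note [measurable] = S'(1) U(1)
  have D: "E l \<inter> C' \<in> sets Y" "emeasure Y (E l \<inter> C') < \<infinity>"
    using C' E_sets E_finite[of l] by (auto intro: le_less_trans[OF emeasure_mono])
  define V where "V = space P - void Y E (E l \<inter> C')"
  have V[measurable]: "V \<in> sets P"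
    unfolding V_def using void_sets[OF D] by auto
  have "measure P V = 1 - exp (- measure Y (E l \<inter> C'))"
    unfolding V_def using void_sets[OF D] measure_void[OF D] by (simp add: prob_compl)
  also have "\<dots> \<le> measure Y (E l \<inter> C')"
    using exp_ge_add_one_self[of "- measure Y (E l \<inter> C')"] by linarith
  finally have V_le: "measure P V \<le> measure Y (E l \<inter> C')" .
  have "AE \<omega> in P. U (s ` \<omega>) \<in> void Y E C \<longleftrightarrow> s ` \<omega> \<in> void Y E C'"
    by (rule AE_measure_preserving[OF S' U(2)])
  with U(2) have "moved P (image s) U (void Y E C)
      = measure P {\<omega> \<in> space P. (s ` \<omega> \<in> void Y E C') \<noteq> (\<omega> \<in> void Y E C')}"
    unfolding moved_def by (intro finite_measure_eq_AE) auto
  also have "\<dots> \<le> measure P (V \<union> (image s -` V \<inter> space P))"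
  proof (rule finite_measure_mono)
    show "{\<omega> \<in> space P. (s ` \<omega> \<in> void Y E C') \<noteq> (\<omega> \<in> void Y E C')} \<subseteq> V \<union> (image s -` V \<inter> space P)"
    proof
      fix \<omega> assume *: "\<omega> \<in> {\<omega> \<in> space P. (s ` \<omega> \<in> void Y E C') \<noteq> (\<omega> \<in> void Y E C')}"
      then have \<omega>: "\<omega> \<in> space P" "s ` \<omega> \<in> space P"
        using measurable_space[OF S'(1)] by auto
      then have \<omega>Y: "\<omega> \<subseteq> space Y"
        by (simp add: space_P configurations_def)
      consider "\<omega> \<inter> C' \<noteq> {}" "s ` \<omega> \<inter> C' = {}" | "\<omega> \<inter> C' = {}" "s ` \<omega> \<inter> C' \<noteq> {}"
        using * \<omega> by (auto simp: void_def space_P)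
      then show "\<omega> \<in> V \<union> (image s -` V \<inter> space P)"
      proof cases
        case 1
        then obtain y where y: "y \<in> \<omega>" "y \<in> C'" by blast
        then have "y \<in> E l"
          using 1(2) supp(2)[of y] by (metis IntI empty_iff imageI)
        then have "\<omega> \<in> V"
          using y \<omega> by (auto simp: V_def void_def)
        then show ?thesis ..
      next
        case 2
        then obtain y where y: "y \<in> \<omega>" "s y \<in> C'" by blast
        then have "s y \<in> E l"
          using 2(1) supp[of y] by (metis IntI empty_iff)
        then have "s ` \<omega> \<in> V"
          using y \<omega> by (auto simp: V_def void_def)
        then show ?thesis
          using \<omega> by simp
      qed
    qed
  qed measurable
  also have "\<dots> \<le> measure P V + measure P (image s -` V \<inter> space P)"
    by (intro measure_Un_le) measurable
  also have "measure P (image s -` V \<inter> space P) = measure P V"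
    by (rule measure_preserving_vimage[OF S' V])
  finally show ?thesis
    using V_le by simp
qed

lemma difference_vanishes:
  assumes C: "C \<in> sets Y" "emeasure Y C < \<infinity>" and F: "range F \<subseteq> sets Y" "incseq F" "C \<subseteq> (\<Union>n. F n)"
  shows "(\<lambda>n. measure Y (C - F n)) \<longlonglongrightarrow> 0"
proof -
  have "(\<lambda>n. measure Y (C - F n)) \<longlonglongrightarrow> measure Y (\<Inter>n. C - F n)"
  proof (rule Lim_measure_decseq)
    show "range (\<lambda>n. C - F n) \<subseteq> sets Y" using C F by auto
    show "decseq (\<lambda>n. C - F n)" using F(2) by (auto simp: incseq_def decseq_def)
    have "emeasure Y (C - F n) \<le> emeasure Y C" for n
      using C by (intro emeasure_mono) auto
    then show "emeasure Y (C - F n) \<noteq> \<infinity>" for n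
      using C(2) by (metis infinity_ennreal_def leD)
  qed
  moreover have "(\<Inter>n. C - F n) = {}" using F(3) by auto
  ultimately show ?thesis by (simp only: measure_empty)
qed

text \<open>
  As overlaps vanish on average, some power of \<open>T\<^sub>0\<close> moves \<open>E j\<close> almost off itself, and almost all of
  the image lies in a large \<open>E l\<close>.
\<close>

lemma swap_exists:
  assumes R: "automorphism P R" and T0: "automorphism Y T0" and img: "AE \<omega> in P. R \<omega> = T0 ` \<omega>"
    and mix: "weakly_mixing P R"
    and "e > 0"
  shows "\<exists>s l A. s \<in> measurable Y Y \<and> distr Y Y s = Y \<and> (\<forall>y\<in>space Y. s (s y) = y) \<and>
    (\<forall>y. y \<in> E l \<longrightarrow> s y \<in> E l) \<and> (\<forall>y. y \<notin> E l \<longrightarrow> s y = y) \<and>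
    A \<in> sets Y \<and> A \<subseteq> E j \<and> (\<forall>y\<in>A. s y \<notin> E j) \<and> measure Y (E j - A) < e"
proof -
  have "cesaro_null (\<lambda>n. measure Y (((T0 ^^ n) -` E j \<inter> space Y) \<inter> E j))"
    by (rule overlaps_vanish[OF R T0 img mix E_sets E_finite E_sets E_finite])
  then obtain n where n: "measure Y (((T0 ^^ n) -` E j \<inter> space Y) \<inter> E j) < e / 2"
    using cesaro_null_small half_gt_zero[OF \<open>e > 0\<close>] by blast
  have p: "automorphism Y (T0 ^^ n)"
    by (rule automorphism_funpow[OF T0])
  note vimage = measure_vimage_automorphism[OF p E_sets]
  note [measurable] = automorphismD(1)[OF p]
  have "(\<lambda>l. measure Y (E j - ((T0 ^^ n) -` E l \<inter> space Y))) \<longlonglongrightarrow> 0"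
  proof (rule difference_vanishes[OF E_sets E_finite])
    show "range (\<lambda>l. (T0 ^^ n) -` E l \<inter> space Y) \<subseteq> sets Y"
      using vimage by auto
    show "incseq (\<lambda>l. (T0 ^^ n) -` E l \<inter> space Y)"
      using E_mono by (fastforce simp: incseq_def)
    have "E j \<subseteq> space Y"
      by (rule sets.sets_into_space[OF E_sets])
    then show "E j \<subseteq> (\<Union>l. (T0 ^^ n) -` E l \<inter> space Y)"
      using E_Un measurable_space[OF automorphismD(1)[OF p]] by fastforce
  qed
  then obtain l0 where l0: "\<And>l. l \<ge> l0 \<Longrightarrow> measure Y (E j - ((T0 ^^ n) -` E l \<inter> space Y)) < e / 2"
    using LIMSEQ_D[of _ 0 "e / 2"] \<open>e > 0\<close> by fastforce
  define l where "l = max l0 j"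
  obtain s A where s: "s \<in> measurable Y Y" "distr Y Y s = Y" "\<And>y. y \<in> space Y \<Longrightarrow> s (s y) = y"
    "\<And>y. y \<in> E l \<Longrightarrow> s y \<in> E l" "\<And>y. y \<notin> E l \<Longrightarrow> s y = y"
    and A: "A \<in> sets Y" "A \<subseteq> E j" "\<And>y. y \<in> A \<Longrightarrow> s y \<notin> E j"
    "AE y in Y. y \<in> E j - A \<longrightarrow> (T0 ^^ n) y \<in> E j \<or> (T0 ^^ n) y \<notin> E l"
    using swap_automorphism[OF p E_sets E_sets, of j l] E_mono[of j l] by (auto simp: l_def)
  let ?F = "((T0 ^^ n) -` E j \<inter> space Y) \<inter> E j" and ?G = "E j - ((T0 ^^ n) -` E l \<inter> space Y)"
  have fin: "?F \<in> fmeasurable Y" "?G \<in> fmeasurable Y"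
    using E_finite[of j] by (auto intro!: fmeasurableI2[of "E j" Y] simp: fmeasurable_def[of Y]
        intro: le_less_trans[OF emeasure_mono[of _ "E j"]])
  have "AE y in Y. y \<in> E j - A \<longrightarrow> y \<in> ?F \<union> ?G"
    using A(4) AE_space by eventually_elim auto
  then have "emeasure Y (E j - A) \<le> emeasure Y (?F \<union> ?G)"
    by (rule emeasure_mono_AE) measurable
  moreover have "?F \<union> ?G \<in> fmeasurable Y"
    using fin by (rule fmeasurable.Un)
  ultimately have "measure Y (E j - A) \<le> measure Y (?F \<union> ?G)"
    unfolding measure_def by (intro enn2real_mono) (simp_all add: fmeasurable_def)
  also have "\<dots> \<le> measure Y ?F + measure Y ?G"
    using fin by (intro measure_Un_le) auto
  also have "\<dots> < e"
    using n l0[of l] by (simp add: l_def)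
  finally have "measure Y (E j - A) < e" .
  then show ?thesis
    by (intro exI[of _ s] exI[of _ l] exI[of _ A] conjI ballI allI impI s A)
qed

text \<open>
  The transformations are the suspensions of involutions \<open>s\<^sub>j\<close> that send almost all of \<open>E j\<close> outside
  \<open>E j\<close>.  They are weakly homoclinic since \<open>T\<^sub>0\<^sup>n C\<close> is on average almost disjoint from the support of
  \<open>s\<^sub>j\<close>.  They are mixing since \<open>C\<close> and \<open>s\<^sub>j\<^sup>-\<^sup>1 C'\<close> become disjoint, up to small measure, once \<open>E j\<close> contains
  most of \<open>C\<close> and \<open>C'\<close>, and void events of disjoint sets are independent.
\<close>

lemma mixing_sequence_exists:
  assumes R: "automorphism P R" and T0: "automorphism Y T0" and img: "AE \<omega> in P. R \<omega> = T0 ` \<omega>"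
    and mix: "weakly_mixing P R"
  shows "\<exists>S. mixing_sequence P R S"
proof -
  have "\<forall>j. \<exists>s l A. s \<in> measurable Y Y \<and> distr Y Y s = Y \<and> (\<forall>y\<in>space Y. s (s y) = y) \<and>
    (\<forall>y. y \<in> E l \<longrightarrow> s y \<in> E l) \<and> (\<forall>y. y \<notin> E l \<longrightarrow> s y = y) \<and>
    A \<in> sets Y \<and> A \<subseteq> E j \<and> (\<forall>y\<in>A. s y \<notin> E j) \<and> measure Y (E j - A) < 1 / real (Suc j)"
    by (intro allI swap_exists[OF R T0 img mix]) simp
  then obtain s l A where s: "\<And>j. s j \<in> measurable Y Y" "\<And>j. distr Y Y (s j) = Y"
      "\<And>j y. y \<in> space Y \<Longrightarrow> s j (s j y) = y"
    and supp: "\<And>j y. y \<in> E (l j) \<Longrightarrow> s j y \<in> E (l j)" "\<And>j y. y \<notin> E (l j) \<Longrightarrow> s j y = y"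
    and A: "\<And>j. A j \<in> sets Y" "\<And>j. A j \<subseteq> E j" "\<And>j y. y \<in> A j \<Longrightarrow> s j y \<notin> E j"
      "\<And>j. measure Y (E j - A j) < 1 / real (Suc j)"
    by metis
  have S_vimage: "image (s j) -` void Y E C \<inter> space P = void Y E (s j -` C \<inter> space Y)" for j C
    by (rule image_suspension(1)[where l="l j"]) (simp_all add: s supp)
  have S: "automorphism P (image (s j))" for j
    by (rule image_suspension(2)[where l="l j"]) (simp_all add: s supp)
  define t where "t = aut_inv Y T0"
  have t: "automorphism Y (t ^^ n)" for n
    unfolding t_def by (intro automorphism_funpow automorphism_aut_inv T0)
  have homoclinic: "image (s j) \<in> weak_homoclinic P R" for j
  proof (rule weak_homoclinicI_generated[OF R S sets_P])
    fix V assume "V \<in> void_events Y E"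
    then obtain C where C: "V = void Y E C" "C \<in> sets Y" "emeasure Y C < \<infinity>"
      unfolding void_events_def by blast
    have le: "moved P (image (s j)) (aut_inv P R ^^ n) V
        \<le> 2 * measure Y (((T0 ^^ n) -` E (l j) \<inter> space Y) \<inter> C)" for n
    proof -
      define Cn where "Cn = (t ^^ n) -` C \<inter> space Y"
      note Cn = measure_vimage_automorphism[OF t[of n] C(2), folded Cn_def]
      have U: "aut_inv P R ^^ n \<in> measurable P P"
        by (intro automorphismD automorphism_funpow automorphism_aut_inv R)
      have "AE \<omega> in P. (aut_inv P R ^^ n) \<omega> \<in> void Y E C \<longleftrightarrow> \<omega> \<in> void Y E Cn"
        unfolding Cn_def t_def
        by (intro AE_in_void_image[OF U] AE_funpow_image automorphism_aut_inv R AE_inverse_image T0 img)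
      then have "moved P (image (s j)) (aut_inv P R ^^ n) V \<le> 2 * measure Y (E (l j) \<inter> Cn)"
        unfolding C(1) using Cn C by (intro moved_image_le[OF S s(1,3) supp U]) auto
      also have "measure Y (E (l j) \<inter> Cn) = measure Y ((T0 ^^ n) -` (E (l j) \<inter> Cn) \<inter> space Y)"
        using Cn by (intro measure_vimage_automorphism(3)[symmetric] automorphism_funpow T0) auto
      also have "\<dots> = measure Y (((T0 ^^ n) -` E (l j) \<inter> space Y) \<inter> C)"
      proof (rule measure_eq_AE)
        have "AE y in Y. (t ^^ n) ((T0 ^^ n) y) = y"
          using ae_inverse_funpow[OF T0 automorphismD(3)[OF T0], of n] by (simp add: ae_inverse_def t_def)
        then show "AE y in Y. y \<in> (T0 ^^ n) -` (E (l j) \<inter> Cn) \<inter> space Y \<longleftrightarrow>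
            y \<in> ((T0 ^^ n) -` E (l j) \<inter> space Y) \<inter> C"
          using AE_space
        proof eventually_elim
          case (elim y)
          then show ?case
            using measurable_space[OF automorphismD(1)[OF automorphism_funpow[OF T0, of n]]]
            by (auto simp: Cn_def)
        qed
        have "(T0 ^^ n) \<in> measurable Y Y"
          by (intro automorphismD automorphism_funpow T0)
        then show "(T0 ^^ n) -` (E (l j) \<inter> Cn) \<inter> space Y \<in> sets Y"
            "((T0 ^^ n) -` E (l j) \<inter> space Y) \<inter> C \<in> sets Y"
          using Cn(1) C(2) by auto
      qed
      finally show ?thesis .
    qed
    show "cesaro_null (\<lambda>n. moved P (image (s j)) (aut_inv P R ^^ n) V)"
      by (rule cesaro_null_mono[OF cesaro_null_cmult[OF overlaps_vanish[OF R T0 img mix C(2,3) E_sets E_finite]]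
            moved_nonneg le])
  qed
  have "asymptotically_independent P (\<lambda>j. image (s j)) V V'"
    if "V \<in> void_events Y E" "V' \<in> void_events Y E" for V V'
  proof -
    obtain C C' where C: "V = void Y E C" "C \<in> sets Y" "emeasure Y C < \<infinity>"
      and C': "V' = void Y E C'" "C' \<in> sets Y" "emeasure Y C' < \<infinity>"
      using \<open>V \<in> void_events Y E\<close> \<open>V' \<in> void_events Y E\<close> unfolding void_events_def by blast
    define D where "D j = s j -` C' \<inter> space Y" for j
    have D: "D j \<in> sets Y" "emeasure Y (D j) = emeasure Y C'" "measure Y (D j) = measure Y C'" for j
      using s(2)[of j] measurable_sets[OF s(1) C'(2), of j] emeasure_distr[OF s(1) C'(2), of j]
      by (auto simp: D_def measure_def)
    have fm: "C \<in> fmeasurable Y" "D j \<in> fmeasurable Y" "C' \<in> fmeasurable Y" "E j \<in> fmeasurable Y" for j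
      using C C' D E_finite by (auto simp: fmeasurable_def)
    \<comment> \<open>A point of \<open>C \<inter> D j\<close> lies outside \<open>E j\<close>, or in the small part of \<open>E j\<close> that is not sent away, or in
       \<open>A j\<close>; in the last case \<open>s\<^sub>j\<close> sends it to a point of \<open>C'\<close> outside \<open>E j\<close>.\<close>
    have overlap_le: "measure Y (C \<inter> D j) \<le> measure Y (C - E j) + (1 / real (Suc j) + measure Y (C' - E j))" for j
    proof -
      let ?F = "s j -` (C' - E j) \<inter> space Y"
      have F: "?F \<in> sets Y" "measure Y ?F = measure Y (C' - E j)"
        using C' s(1) measure_preserving_vimage[OF s(1,2)] by auto
      have subset: "C \<inter> D j \<subseteq> (C - E j) \<union> ((E j - A j) \<union> ?F)"
        using A(3) by (auto simp: D_def)
      have fm': "?F \<in> fmeasurable Y"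
        using D(1) F(1) fm(2)[of j] by (rule_tac fmeasurableI2[of "D j"]) (auto simp: D_def)
      have fm'': "C - E j \<in> fmeasurable Y" "E j - A j \<in> fmeasurable Y"
        using fm A(1) by (auto intro: fmeasurable.Diff fmeasurable_Diff)
      have "measure Y (C \<inter> D j) \<le> measure Y ((C - E j) \<union> ((E j - A j) \<union> ?F))"
        using fm' fm'' C(2) D(1) by (intro measure_mono_fmeasurable[OF subset]) auto
      also have "\<dots> \<le> measure Y (C - E j) + measure Y ((E j - A j) \<union> ?F)"
        using fm' fm'' by (intro measure_Un_le) auto
      also have "measure Y ((E j - A j) \<union> ?F) \<le> measure Y (E j - A j) + measure Y ?F"
        using fm' fm'' by (intro measure_Un_le) auto
      finally show ?thesis
        using A(4)[of j] F(2) by linarith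
    qed
    have in_E: "B \<subseteq> (\<Union>n. E n)" if "B \<in> sets Y" for B
      using sets.sets_into_space[OF that] E_Un by simp
    have incE: "range E \<subseteq> sets Y" "incseq E"
      using E_sets E_mono by (auto simp: incseq_def)
    have lim: "(\<lambda>j. measure Y (C - E j) + (1 / real (Suc j) + measure Y (C' - E j))) \<longlonglongrightarrow> 0 + (0 + 0)"
      by (intro tendsto_add difference_vanishes incE C(2,3) C'(2,3) in_E lim_inverse_n'[THEN LIMSEQ_Suc])
    have "(\<lambda>j. measure Y (C \<inter> D j)) \<longlonglongrightarrow> 0"
    proof (rule tendsto_sandwich[OF _ _ tendsto_const])
      show "(\<lambda>j. measure Y (C - E j) + (1 / real (Suc j) + measure Y (C' - E j))) \<longlonglongrightarrow> 0"
        using lim by simp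
    qed (simp, intro always_eventually allI overlap_le)
    then have "(\<lambda>j. exp (- (measure Y C + measure Y C' - measure Y (C \<inter> D j))))
        \<longlonglongrightarrow> exp (- (measure Y C + measure Y C' - 0))"
      by (intro tendsto_exp tendsto_minus tendsto_diff tendsto_const)
    moreover have "measure P (V \<inter> (image (s j) -` V' \<inter> space P))
        = exp (- (measure Y C + measure Y C' - measure Y (C \<inter> D j)))" for j
    proof -
      have U: "C \<union> D j \<in> sets Y" "emeasure Y (C \<union> D j) < \<infinity>"
        using fmeasurable.Un[OF fm(1) fm(2)[of j]] by (simp_all add: fmeasurable_def)
      have "V \<inter> (image (s j) -` V' \<inter> space P) = void Y E (C \<union> D j)"
        unfolding C(1) C'(1) S_vimage D_def by (auto simp: void_def)
      then show ?thesis
        using measure_void[OF U] measure_Un3[OF fm(1) fm(2)[of j]] D(3) by simp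
    qed
    moreover have "measure P V * measure P V' = exp (- (measure Y C + measure Y C' - 0))"
      using C C' by (simp add: measure_void flip: exp_add)
    ultimately show ?thesis
      unfolding asymptotically_independent_def by (simp only:)
  qed
  note indep = this
  have sub: "void_events Y E \<subseteq> Pow (space P)"
    unfolding space_P by (rule void_events_subset)
  have "asymptotically_independent P (\<lambda>j. image (s j)) V V'" if "V \<in> sets P" "V' \<in> sets P" for V V'
    by (rule asymptotically_independent_generated[OF sets_P Int_stable_void_events sub
          automorphismD(1)[OF S] automorphismD(2)[OF S] indep that])
  then have "mixing_sequence P R (\<lambda>j. image (s j))"
    using homoclinic by (auto simp: mixing_sequence_def)
  then show ?thesis by blast
qed

end

lemma ergodic_weak_homoclinic_poisson:
  assumes M: "prob_space M" and T: "automorphism M T" and wm: "weakly_mixing M T"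
    and Y: "standard_borel Y" and T0: "automorphism Y T0" and sus: "poisson_suspension_of Y T0 M T"
  shows "ergodic_subgroup M (weak_homoclinic M T)"
proof -
  obtain E P R where E: "exhausting Y E" "poisson_measure Y E P" and R: "automorphism P R"
    and img: "AE \<omega> in P. R \<omega> = T0 ` \<omega>" and iso: "isomorphic_mod0 M T P R"
    using sus unfolding poisson_suspension_of_def by blast
  interpret poisson_space Y E P
    using Y E by unfold_locales
  have "\<exists>S. mixing_sequence P R S"
    by (rule mixing_sequence_exists[OF R T0 img weakly_mixing_transfer[OF wm iso M T R]])
  then have "\<exists>S. mixing_sequence M T S"
    using mixing_sequence_transfer[OF M T R iso] by blast
  then show ?thesis
    using prob_space.ergodic_weak_homoclinicI[OF M T] by blast
qed

section \<open>Square-integrable real functions\<close>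

context prob_space
begin

definition square_integrable :: "('a \<Rightarrow> real) \<Rightarrow> bool" where
  "square_integrable u \<longleftrightarrow> u \<in> borel_measurable M \<and> integrable M (\<lambda>x. (u x)\<^sup>2)"

lemma square_integrable_minus:
  "square_integrable u \<Longrightarrow> square_integrable v \<Longrightarrow> square_integrable (\<lambda>x. u x - v x)"
  using square_integrable_diff[of u v] by (auto simp: square_integrable_def)

lemma square_integrable_scale: "square_integrable u \<Longrightarrow> square_integrable (\<lambda>x. c * u x)"
  by (auto simp: square_integrable_def power_mult_distrib)

lemma square_integrable_add:
  assumes "square_integrable u" "square_integrable v"
  shows "square_integrable (\<lambda>x. u x + v x)"
  using square_integrable_minus[OF assms(1) square_integrable_scale[OF assms(2), of "-1"]] by simp

lemma square_integrable_zero: "square_integrable (\<lambda>x. 0)"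
  by (simp add: square_integrable_def)

lemma square_integrable_sum:
  "(\<And>i. i \<in> I \<Longrightarrow> square_integrable (u i)) \<Longrightarrow> square_integrable (\<lambda>x. \<Sum>i\<in>I. u i x)"
  by (induction I rule: infinite_finite_induct)
    (auto intro: square_integrable_add square_integrable_zero)

lemma square_integrable_integrable: "square_integrable u \<Longrightarrow> integrable M u"
  unfolding square_integrable_def using square_integrable_imp_integrable by blast

lemma integrable_product:
  assumes u: "square_integrable u" and v: "square_integrable v"
  shows "integrable M (\<lambda>x. u x * v x)"
proof (rule Bochner_Integration.integrable_bound)
  show "integrable M (\<lambda>x. (u x)\<^sup>2 + (v x)\<^sup>2)" "(\<lambda>x. u x * v x) \<in> borel_measurable M"
    using u v by (auto simp: square_integrable_def)
  have "\<bar>u x * v x\<bar> \<le> (u x)\<^sup>2 + (v x)\<^sup>2" for x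
    using sum_squares_bound[of "\<bar>u x\<bar>" "\<bar>v x\<bar>"] mult_nonneg_nonneg[of "\<bar>u x\<bar>" "\<bar>v x\<bar>"]
    unfolding abs_mult power2_abs by linarith
  then show "AE x in M. norm (u x * v x) \<le> norm ((u x)\<^sup>2 + (v x)\<^sup>2)"
    by simp
qed

lemma Cauchy_Schwarz_integral:
  assumes u: "square_integrable u" and v: "square_integrable v"
  shows "\<bar>\<integral>x. u x * v x \<partial>M\<bar> \<le> sqrt (\<integral>x. (u x)\<^sup>2 \<partial>M) * sqrt (\<integral>x. (v x)\<^sup>2 \<partial>M)"
proof -
  define a where "a = (\<integral>x. (v x)\<^sup>2 \<partial>M)"
  define b where "b = (\<integral>x. u x * v x \<partial>M)"
  define c where "c = (\<integral>x. (u x)\<^sup>2 \<partial>M)"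
  note int = u[unfolded square_integrable_def] v[unfolded square_integrable_def] integrable_product[OF u v]
  have a0: "0 \<le> a" unfolding a_def by simp
  have "b\<^sup>2 \<le> c * a"
  proof (cases "a = 0")
    case True
    have "AE x in M. (v x)\<^sup>2 = 0"
      using True int by (subst (asm) a_def, subst (asm) integral_nonneg_eq_0_iff_AE) auto
    then have "b = (\<integral>x. 0 \<partial>M)"
      unfolding b_def using int by (intro integral_cong_AE) auto
    then show ?thesis using True by simp
  next
    case False
    have "0 \<le> (\<integral>x. (a * u x - b * v x)\<^sup>2 \<partial>M)" by simp
    also have "\<dots> = (\<integral>x. a\<^sup>2 * (u x)\<^sup>2 - 2 * a * b * (u x * v x) + b\<^sup>2 * (v x)\<^sup>2 \<partial>M)"
      by (intro Bochner_Integration.integral_cong) (auto simp: power2_diff power_mult_distrib algebra_simps)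
    also have "\<dots> = a\<^sup>2 * c - 2 * a * b * b + b\<^sup>2 * a"
      using int by (simp add: a_def b_def c_def)
    also have "\<dots> = a * (a * c - b\<^sup>2)"
      by (simp add: power2_eq_square algebra_simps)
    finally show ?thesis
      using a0 False by (simp add: zero_le_mult_iff mult.commute)
  qed
  then have "sqrt (b\<^sup>2) \<le> sqrt (c * a)"
    by (rule real_sqrt_le_mono)
  then show ?thesis
    by (simp add: a_def b_def c_def real_sqrt_mult)
qed

lemma integral_square_add_le:
  assumes u: "square_integrable u" and v: "square_integrable v"
  shows "(\<integral>x. (u x + v x)\<^sup>2 \<partial>M) \<le> 2 * (\<integral>x. (u x)\<^sup>2 \<partial>M) + 2 * (\<integral>x. (v x)\<^sup>2 \<partial>M)"
proof -
  note int = u[unfolded square_integrable_def] v[unfolded square_integrable_def]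
  have "(\<integral>x. (u x + v x)\<^sup>2 \<partial>M) \<le> (\<integral>x. 2 * (u x)\<^sup>2 + 2 * (v x)\<^sup>2 \<partial>M)"
  proof (rule integral_mono)
    show "(u x + v x)\<^sup>2 \<le> 2 * (u x)\<^sup>2 + 2 * (v x)\<^sup>2" for x
      using norm_add_squared_le[of "u x" "v x"] by simp
    show "integrable M (\<lambda>x. (u x + v x)\<^sup>2)"
      using square_integrable_add[OF u v] by (simp add: square_integrable_def)
  qed (use int in auto)
  then show ?thesis using int by simp
qed

lemma L2_limit_unique:
  assumes F: "square_integrable F" and G: "square_integrable G" and f: "\<And>n. square_integrable (f n)"
    and limF: "(\<lambda>n. \<integral>x. (f n x - F x)\<^sup>2 \<partial>M) \<longlonglongrightarrow> 0"
    and limG: "(\<lambda>n. \<integral>x. (f n x - G x)\<^sup>2 \<partial>M) \<longlonglongrightarrow> 0"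
  shows "AE x in M. F x = G x"
proof -
  have le: "(\<integral>x. (F x - G x)\<^sup>2 \<partial>M) \<le> 2 * (\<integral>x. (f n x - F x)\<^sup>2 \<partial>M) + 2 * (\<integral>x. (f n x - G x)\<^sup>2 \<partial>M)" for n
    using integral_square_add_le[OF square_integrable_minus[OF F f[of n]] square_integrable_minus[OF f[of n] G]]
    by (simp add: power2_commute[of "F _"])
  have "(\<lambda>n. 2 * (\<integral>x. (f n x - F x)\<^sup>2 \<partial>M) + 2 * (\<integral>x. (f n x - G x)\<^sup>2 \<partial>M)) \<longlonglongrightarrow> 2 * 0 + 2 * 0"
    by (intro tendsto_intros limF limG)
  then have "(\<integral>x. (F x - G x)\<^sup>2 \<partial>M) \<le> 2 * 0 + 2 * 0"
    by (rule LIMSEQ_le_const) (use le in blast)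
  then have "(\<integral>x. (F x - G x)\<^sup>2 \<partial>M) = 0"
    by (simp add: antisym)
  then have "AE x in M. (F x - G x)\<^sup>2 = 0"
    using square_integrable_minus[OF F G] unfolding square_integrable_def
    by (subst (asm) integral_nonneg_eq_0_iff_AE) auto
  then show ?thesis by simp
qed

text \<open>
  Completeness of \<open>L\<^sub>2\<close>.  An \<open>L\<^sub>2\<close>-Cauchy sequence is \<open>L\<^sub>1\<close>-Cauchy and therefore has an a.e. convergent
  subsequence; by Fatou's lemma its limit is also the \<open>L\<^sub>2\<close> limit.
\<close>

lemma L2_complete:
  assumes f: "\<And>n. square_integrable (f n)"
    and Cauchy: "\<And>e. e > 0 \<Longrightarrow> \<exists>N. \<forall>i\<ge>N. \<forall>j\<ge>N. (\<integral>x. (f i x - f j x)\<^sup>2 \<partial>M) < e"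
  shows "\<exists>F. square_integrable F \<and> (\<lambda>n. \<integral>x. (f n x - F x)\<^sup>2 \<partial>M) \<longlonglongrightarrow> 0"
proof -
  have [measurable]: "f n \<in> borel_measurable M" for n
    using f by (simp add: square_integrable_def)
  have "\<exists>N. \<forall>i\<ge>N. \<forall>j\<ge>N. (\<integral>x. norm (f i x - f j x) \<partial>M) < e" if "e > 0" for e
  proof -
    obtain N where N: "\<And>i j. i \<ge> N \<Longrightarrow> j \<ge> N \<Longrightarrow> (\<integral>x. (f i x - f j x)\<^sup>2 \<partial>M) < e\<^sup>2"
      using Cauchy[of "e\<^sup>2"] \<open>e > 0\<close> by auto
    have "(\<integral>x. norm (f i x - f j x) \<partial>M) < e" if "i \<ge> N" "j \<ge> N" for i j
    proof -
      have "(\<integral>x. \<bar>f i x - f j x\<bar> \<partial>M)\<^sup>2 \<le> (\<integral>x. \<bar>f i x - f j x\<bar>\<^sup>2 \<partial>M)"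
        using square_integrable_minus[OF f f, of i j]
        by (intro integral_squared_le) (auto simp: square_integrable_def)
      also have "\<dots> < e\<^sup>2" using N[OF that] by simp
      finally show ?thesis
        using \<open>e > 0\<close> power_less_imp_less_base[of _ 2 e] by auto
    qed
    then show ?thesis by blast
  qed
  then obtain r where r: "strict_mono r" and ae: "AE x in M. Cauchy (\<lambda>i. f (r i) x)"
    using cauchy_L1_AE_cauchy_subseq[of M f] square_integrable_integrable[OF f] by blast
  define F where "F x = lim (\<lambda>i. f (r i) x)" for x
  have [measurable]: "F \<in> borel_measurable M"
    unfolding F_def by measurable
  have limF: "AE x in M. (\<lambda>i. f (r i) x) \<longlonglongrightarrow> F x"
    using ae by eventually_elim (simp add: F_def Cauchy_convergent_iff convergent_LIMSEQ_iff)
  have fatou: "integrable M (\<lambda>x. (f n x - F x)\<^sup>2) \<and> (\<integral>x. (f n x - F x)\<^sup>2 \<partial>M) \<le> e"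
    if N: "\<And>i j. i \<ge> N \<Longrightarrow> j \<ge> N \<Longrightarrow> (\<integral>x. (f i x - f j x)\<^sup>2 \<partial>M) < e" and "n \<ge> N" "e > 0" for N n e
  proof -
    have "(\<integral>\<^sup>+x. ennreal ((f n x - F x)\<^sup>2) \<partial>M) = (\<integral>\<^sup>+x. liminf (\<lambda>i. ennreal ((f n x - f (r i) x)\<^sup>2)) \<partial>M)"
    proof (rule nn_integral_cong_AE)
      show "AE x in M. ennreal ((f n x - F x)\<^sup>2) = liminf (\<lambda>i. ennreal ((f n x - f (r i) x)\<^sup>2))"
        using limF
      proof eventually_elim
        case (elim x)
        then have "(\<lambda>i. ennreal ((f n x - f (r i) x)\<^sup>2)) \<longlonglongrightarrow> ennreal ((f n x - F x)\<^sup>2)"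
          by (intro tendsto_ennrealI tendsto_intros)
        then show ?case
          by (intro lim_imp_Liminf[symmetric]) auto
      qed
    qed
    also have "\<dots> \<le> liminf (\<lambda>i. \<integral>\<^sup>+x. ennreal ((f n x - f (r i) x)\<^sup>2) \<partial>M)"
      by (intro nn_integral_liminf) measurable
    also have "\<dots> \<le> liminf (\<lambda>i. ennreal e)"
    proof (rule Liminf_mono, rule eventually_sequentiallyI[of N])
      fix i assume "N \<le> i"
      then have "r i \<ge> N" using seq_suble[OF r, of i] by simp
      have "(\<integral>\<^sup>+x. ennreal ((f n x - f (r i) x)\<^sup>2) \<partial>M) = ennreal (\<integral>x. (f n x - f (r i) x)\<^sup>2 \<partial>M)"
        using square_integrable_minus[OF f f, of n "r i"] unfolding square_integrable_def
        by (intro nn_integral_eq_integral) auto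
      also have "\<dots> \<le> ennreal e"
        using N[OF \<open>n \<ge> N\<close> \<open>r i \<ge> N\<close>] by (intro ennreal_leI) simp
      finally show "(\<integral>\<^sup>+x. ennreal ((f n x - f (r i) x)\<^sup>2) \<partial>M) \<le> ennreal e" .
    qed
    also have "\<dots> = ennreal e"
      by (simp add: Liminf_const)
    finally have le: "(\<integral>\<^sup>+x. ennreal ((f n x - F x)\<^sup>2) \<partial>M) \<le> ennreal e" .
    then have int: "integrable M (\<lambda>x. (f n x - F x)\<^sup>2)"
      by (intro integrableI_nonneg) (auto intro: le_less_trans)
    then have "ennreal (\<integral>x. (f n x - F x)\<^sup>2 \<partial>M) \<le> ennreal e"
      using le by (subst (asm) nn_integral_eq_integral) auto
    then show ?thesis
      using int \<open>e > 0\<close> by (simp add: ennreal_le_iff)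
  qed
  obtain N where N: "\<And>i j. i \<ge> N \<Longrightarrow> j \<ge> N \<Longrightarrow> (\<integral>x. (f i x - f j x)\<^sup>2 \<partial>M) < 1"
    using Cauchy[of 1] by auto
  have "square_integrable (\<lambda>x. f N x - F x)"
    using fatou[OF N order_refl] by (simp add: square_integrable_def)
  then have "square_integrable F"
    using square_integrable_minus[OF f[of N], of "\<lambda>x. f N x - F x"] by simp
  moreover have "(\<lambda>n. \<integral>x. (f n x - F x)\<^sup>2 \<partial>M) \<longlonglongrightarrow> 0"
  proof (rule LIMSEQ_I)
    fix e :: real assume "e > 0"
    then obtain N where N: "\<And>i j. i \<ge> N \<Longrightarrow> j \<ge> N \<Longrightarrow> (\<integral>x. (f i x - f j x)\<^sup>2 \<partial>M) < e / 2"
      using Cauchy[of "e / 2"] by auto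
    have "norm ((\<integral>x. (f n x - F x)\<^sup>2 \<partial>M) - 0) < e" if "n \<ge> N" for n
      using fatou[OF N that] \<open>e > 0\<close> by auto
    then show "\<exists>N. \<forall>n\<ge>N. norm ((\<integral>x. (f n x - F x)\<^sup>2 \<partial>M) - 0) < e" by blast
  qed
  ultimately show ?thesis by blast
qed

definition correlation :: "('a \<Rightarrow> 'a) \<Rightarrow> ('a \<Rightarrow> real) \<Rightarrow> ('a \<Rightarrow> real) \<Rightarrow> real" where
  "correlation S u v = (\<integral>x. u (S x) * v x \<partial>M) - (\<integral>x. u x \<partial>M) * (\<integral>x. v x \<partial>M)"

lemma square_integrable_comp:
  assumes "S \<in> measurable M M" "distr M M S = M" "square_integrable u"
  shows "square_integrable (\<lambda>x. u (S x))" "(\<integral>x. (u (S x))\<^sup>2 \<partial>M) = (\<integral>x. (u x)\<^sup>2 \<partial>M)"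
    "(\<integral>x. u (S x) \<partial>M) = (\<integral>x. u x \<partial>M)"
  using assms measure_preserving_integrable[OF assms(1,2), of "\<lambda>x. (u x)\<^sup>2"]
    measure_preserving_integral[OF assms(1,2), of "\<lambda>x. (u x)\<^sup>2"]
    measure_preserving_integral[OF assms(1,2), of u]
  by (auto simp: square_integrable_def)

lemma correlation_le:
  assumes S: "S \<in> measurable M M" "distr M M S = M" and u: "square_integrable u" and v: "square_integrable v"
  shows "\<bar>correlation S u v\<bar> \<le> 2 * (sqrt (\<integral>x. (u x)\<^sup>2 \<partial>M) * sqrt (\<integral>x. (v x)\<^sup>2 \<partial>M))"
proof -
  have one: "square_integrable (\<lambda>x. 1)" by (simp add: square_integrable_def)
  have 1: "\<bar>\<integral>x. u (S x) * v x \<partial>M\<bar> \<le> sqrt (\<integral>x. (u x)\<^sup>2 \<partial>M) * sqrt (\<integral>x. (v x)\<^sup>2 \<partial>M)"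
    using Cauchy_Schwarz_integral[OF square_integrable_comp(1)[OF S u] v] square_integrable_comp(2)[OF S u]
    by simp
  have "\<bar>\<integral>x. u x \<partial>M\<bar> * \<bar>\<integral>x. v x \<partial>M\<bar> \<le> sqrt (\<integral>x. (u x)\<^sup>2 \<partial>M) * sqrt (\<integral>x. (v x)\<^sup>2 \<partial>M)"
    using Cauchy_Schwarz_integral[OF u one] Cauchy_Schwarz_integral[OF v one]
    by (intro mult_mono) (auto simp: prob_space)
  then have 2: "\<bar>(\<integral>x. u x \<partial>M) * (\<integral>x. v x \<partial>M)\<bar> \<le> sqrt (\<integral>x. (u x)\<^sup>2 \<partial>M) * sqrt (\<integral>x. (v x)\<^sup>2 \<partial>M)"
    by (simp add: abs_mult)
  show ?thesis
    unfolding correlation_def using 1 2 by linarith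
qed

lemma correlation_add:
  assumes S: "S \<in> measurable M M" "distr M M S = M"
    and u: "square_integrable u" "square_integrable u'" and v: "square_integrable v" "square_integrable v'"
  shows "correlation S (\<lambda>x. u x + u' x) v = correlation S u v + correlation S u' v"
    and "correlation S u (\<lambda>x. v x + v' x) = correlation S u v + correlation S u v'"
proof -
  note uS = square_integrable_comp(1)[OF S u(1)] square_integrable_comp(1)[OF S u(2)]
  note int = u[THEN square_integrable_integrable] v[THEN square_integrable_integrable]
    integrable_product[OF uS(1) v(1)] integrable_product[OF uS(2) v(1)] integrable_product[OF uS(1) v(2)]
  show "correlation S (\<lambda>x. u x + u' x) v = correlation S u v + correlation S u' v"
    "correlation S u (\<lambda>x. v x + v' x) = correlation S u v + correlation S u v'"
    using int by (simp_all add: correlation_def algebra_simps)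
qed

lemma square_integrable_indicator:
  assumes [measurable]: "A \<in> sets M"
  shows "square_integrable (\<lambda>x. indicator A x *\<^sub>R c)"
  unfolding square_integrable_def
proof
  show "integrable M (\<lambda>x. (indicator A x *\<^sub>R c)\<^sup>2)"
    by (intro integrable_const_bound[where B="c\<^sup>2"]) (auto simp: indicator_def)
qed measurable

text \<open>
  The bound \<open>K\<close> is uniform in \<open>n\<close>; so an approximation of \<open>w\<close> in \<open>L\<^sub>2\<close> changes all members of the
  sequence by little.
\<close>

lemma cesaro_null_functionals:
  fixes B :: "nat \<Rightarrow> ('a \<Rightarrow> real) \<Rightarrow> real"
  assumes additive: "\<And>n u v. square_integrable u \<Longrightarrow> square_integrable v \<Longrightarrow>
      B n (\<lambda>x. u x + v x) = B n u + B n v"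
    and bounded: "\<And>n u. square_integrable u \<Longrightarrow> \<bar>B n u\<bar> \<le> K * sqrt (\<integral>x. (u x)\<^sup>2 \<partial>M)"
    and indicators: "\<And>A c. A \<in> sets M \<Longrightarrow> cesaro_null (\<lambda>n. \<bar>B n (\<lambda>x. indicator A x *\<^sub>R c)\<bar>)"
    and w: "square_integrable w"
  shows "cesaro_null (\<lambda>n. \<bar>B n w\<bar>)"
proof -
  have w': "w \<in> borel_measurable M" "integrable M (\<lambda>x. (norm (w x))\<^sup>2)"
    using w by (simp_all add: square_integrable_def)
  have cast: "square_integrable u" if "u \<in> borel_measurable M" "integrable M (\<lambda>x. (norm (u x))\<^sup>2)" for u
    using that by (simp add: square_integrable_def)
  show ?thesis
    using w'
  proof (induct rule: square_integrable_induct)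
    case (indicator A c)
    then show ?case by (rule indicators)
  next
    case (add g h)
    have gh: "square_integrable g" "square_integrable h"
      using add by (auto intro: cast)
    show ?case
      by (rule cesaro_null_mono[OF cesaro_null_add[OF add(3,6)]])
        (simp_all only: additive[OF gh] abs_triangle_ineq abs_ge_zero)
  next
    case (limit g s)
    have gs: "square_integrable g" "\<And>i. square_integrable (s i)"
      using limit by (auto intro: cast)
    show ?case
    proof (rule cesaro_null_approx)
      fix e :: real assume "e > 0"
      have lim: "(\<lambda>i. K * sqrt (\<integral>x. (norm (g x - s i x))\<^sup>2 \<partial>M)) \<longlonglongrightarrow> K * sqrt 0"
        by (intro tendsto_intros limit(6))
      obtain i where "\<bar>K * sqrt (\<integral>x. (norm (g x - s i x))\<^sup>2 \<partial>M) - K * sqrt 0\<bar> < e"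
        using LIMSEQ_D[OF lim \<open>e > 0\<close>] unfolding real_norm_def by blast
      then have i: "K * sqrt (\<integral>x. (g x - s i x)\<^sup>2 \<partial>M) \<le> e"
        by simp
      have "\<bar>B n g\<bar> \<le> \<bar>B n (s i)\<bar> + e" for n
        using additive[OF square_integrable_minus[OF gs(1) gs(2)[of i]] gs(2)[of i], of n]
          bounded[OF square_integrable_minus[OF gs(1) gs(2)[of i]], of n] i by simp
      then show "\<exists>b. cesaro_null b \<and> (\<forall>n. \<bar>B n g\<bar> \<le> b n + e)"
        using limit(5)[of i] by blast
    qed simp
  qed
qed

text \<open>
  Weak mixing is defined by sets, but it is needed for the unbounded coordinates of the Gaussian
  space.  The extension is carried out in one argument at a time.
\<close>

lemma weakly_mixing_correlation:
  assumes T: "automorphism M T" and mix: "weakly_mixing M T"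
    and u: "square_integrable u" and v: "square_integrable v"
  shows "cesaro_null (\<lambda>n. \<bar>correlation (T ^^ n) u v\<bar>)"
proof -
  note Tn = automorphismD(1,2)[OF automorphism_funpow[OF T]]
  note ind = square_integrable_indicator
  have sets: "cesaro_null (\<lambda>n. \<bar>correlation (T ^^ n) (\<lambda>x. indicator A x *\<^sub>R c) (\<lambda>x. indicator D x *\<^sub>R d)\<bar>)"
    if A[measurable]: "A \<in> sets M" and D[measurable]: "D \<in> sets M" for A D c d
  proof -
    note [measurable] = Tn(1)
    have "correlation (T ^^ n) (\<lambda>x. indicator A x *\<^sub>R c) (\<lambda>x. indicator D x *\<^sub>R d)
        = c * d * (measure M (((T ^^ n) -` A \<inter> space M) \<inter> D) - measure M A * measure M D)" for n
    proof -
      have "(\<integral>x. (indicator A ((T ^^ n) x) *\<^sub>R c) * (indicator D x *\<^sub>R d) \<partial>M)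
          = (\<integral>x. c * d * indicator (((T ^^ n) -` A \<inter> space M) \<inter> D) x \<partial>M)"
        by (intro Bochner_Integration.integral_cong) (auto simp: indicator_def)
      then show ?thesis
        unfolding correlation_def by (simp add: algebra_simps)
    qed
    then show ?thesis
      using cesaro_null_cmult[OF weakly_mixing_cesaro[OF mix A D], of "\<bar>c * d\<bar>"]
      by (simp add: abs_mult)
  qed
  have right: "cesaro_null (\<lambda>n. \<bar>correlation (T ^^ n) (\<lambda>x. indicator A x *\<^sub>R c) v\<bar>)"
    if A: "A \<in> sets M" for A c
  proof (rule cesaro_null_functionals[where B="\<lambda>n. correlation (T ^^ n) (\<lambda>x. indicator A x *\<^sub>R c)",
        OF _ _ sets[OF A] v])
    show "\<bar>correlation (T ^^ n) (\<lambda>x. indicator A x *\<^sub>R c) w\<bar>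
        \<le> (2 * sqrt (\<integral>x. (indicator A x *\<^sub>R c)\<^sup>2 \<partial>M)) * sqrt (\<integral>x. (w x)\<^sup>2 \<partial>M)"
      if "square_integrable w" for n w
      using correlation_le[OF Tn ind[OF A] that, of n c] by (simp only: mult.assoc)
  qed (rule correlation_add(2)[OF Tn ind[OF A] ind[OF A]])
  show ?thesis
  proof (rule cesaro_null_functionals[where B="\<lambda>n w. correlation (T ^^ n) w v", OF _ _ right u])
    show "\<bar>correlation (T ^^ n) w v\<bar>
        \<le> (2 * sqrt (\<integral>x. (v x)\<^sup>2 \<partial>M)) * sqrt (\<integral>x. (w x)\<^sup>2 \<partial>M)"
      if "square_integrable w" for n w
      using correlation_le[OF Tn that v, of n] by (simp only: mult_ac)
  qed (rule correlation_add(1)[OF Tn _ _ v v])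
qed

end

section \<open>The Gaussian space\<close>

abbreviation std_gauss :: "real measure" where
  "std_gauss \<equiv> density lborel (\<lambda>x. ennreal (std_normal_density x))"

lemma prob_space_std_gauss: "prob_space std_gauss"
  by (rule prob_space_normal_density) simp

lemma prob_space_gauss: "prob_space gauss"
  unfolding gauss_def by (intro prob_space_PiM prob_space_std_gauss)

interpretation gauss: prob_space gauss
  by (rule prob_space_gauss)

lemma space_gauss [simp]: "space gauss = UNIV"
  by (simp add: gauss_def space_PiM)

lemma measurable_gauss_coord [measurable]: "(\<lambda>x. x i) \<in> borel_measurable gauss"
proof -
  have "(\<lambda>x. x i) \<in> measurable gauss std_gauss"
    unfolding gauss_def by (rule measurable_component_singleton) simp
  then show ?thesis by (simp cong: measurable_cong_sets)
qed

lemma measurable_into_gauss: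
  assumes "\<And>i. (\<lambda>x. f x i) \<in> borel_measurable N"
  shows "f \<in> measurable N gauss"
  unfolding gauss_def
proof (rule measurable_PiM_single')
  show "(\<lambda>x. f x i) \<in> measurable N std_gauss" for i
    using assms by (simp cong: measurable_cong_sets)
qed auto

lemma distr_gauss_coord: "distr gauss std_gauss (\<lambda>x. x i) = std_gauss"
  unfolding gauss_def by (rule distr_PiM_component) (auto intro: prob_space_std_gauss)

lemma gauss_coord:
  fixes f :: "real \<Rightarrow> real"
  assumes f: "f \<in> borel_measurable borel" and int: "integrable lborel (\<lambda>x. std_normal_density x * f x)"
  shows "integrable gauss (\<lambda>x. f (x i))"
    and "(\<integral>x. f (x i) \<partial>gauss) = (\<integral>x. std_normal_density x * f x \<partial>lborel)"
proof -
  have c: "(\<lambda>x. x i) \<in> measurable gauss std_gauss"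
    by (simp cong: measurable_cong_sets)
  have f': "f \<in> borel_measurable std_gauss"
    using f by simp
  have "integrable std_gauss f"
    using f int by (subst integrable_density) auto
  then show "integrable gauss (\<lambda>x. f (x i))"
    using measure_preserving_integrable[OF c distr_gauss_coord f'] by simp
  show "(\<integral>x. f (x i) \<partial>gauss) = (\<integral>x. std_normal_density x * f x \<partial>lborel)"
    unfolding measure_preserving_integral[OF c distr_gauss_coord f']
    using f by (subst integral_density) auto
qed

lemma square_integrable_gauss_coord: "gauss.square_integrable (\<lambda>x. x i)"
  using gauss_coord(1)[of "\<lambda>x. x\<^sup>2" i] integrable_std_normal_moment[of 2]
  by (simp add: gauss.square_integrable_def)

lemma integral_gauss_coord: "(\<integral>x. x i \<partial>gauss) = 0"
  using gauss_coord(2)[of "\<lambda>x. x" i] integrable_std_normal_moment[of 1] integral_std_normal_moment_odd[of 0]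
  by simp

lemma integral_gauss_coord_square: "(\<integral>x. (x i)\<^sup>2 \<partial>gauss) = 1"
  using gauss_coord(2)[of "\<lambda>x. x\<^sup>2" i] integrable_std_normal_moment[of 2] integral_std_normal_moment_even[of 1]
  by simp

lemma indep_vars_gauss_coord: "gauss.indep_vars (\<lambda>_. borel) (\<lambda>i x. x i) UNIV"
proof (subst gauss.indep_vars_iff_distr_eq_PiM')
  have "distr gauss borel (\<lambda>x. x i) = std_gauss" for i
  proof -
    have "distr gauss borel (\<lambda>x. x i) = distr gauss std_gauss (\<lambda>x. x i)"
      by (intro distr_cong) auto
    then show ?thesis by (simp add: distr_gauss_coord)
  qed
  moreover have "distr gauss (PiM UNIV (\<lambda>_. borel)) (\<lambda>x. x) = gauss"
  proof -
    have "distr gauss (PiM UNIV (\<lambda>_. borel)) (\<lambda>x. x) = distr gauss gauss (\<lambda>x. x)"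
      by (intro distr_cong) (auto simp: gauss_def intro!: sets_PiM_cong)
    then show ?thesis by (simp add: distr_id2)
  qed
  ultimately show "distr gauss (PiM UNIV (\<lambda>_. borel)) (\<lambda>x. \<lambda>i\<in>UNIV. x i)
      = (\<Pi>\<^sub>M i\<in>UNIV. distr gauss borel (\<lambda>x. x i))"
    by (simp add: gauss_def restrict_UNIV)
qed auto

lemma integral_gauss_coord_product: "(\<integral>x. x i * x j \<partial>gauss) = (if i = j then 1 else 0)"
proof (cases "i = j")
  case True
  then show ?thesis using integral_gauss_coord_square[of i] by (simp add: power2_eq_square)
next
  case False
  have "(\<integral>x. (\<Prod>k\<in>{i, j}. x k) \<partial>gauss) = (\<Prod>k\<in>{i, j}. \<integral>x. x k \<partial>gauss)"
    using gauss.indep_vars_subset[OF indep_vars_gauss_coord]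
    by (intro gauss.indep_vars_lebesgue_integral gauss.square_integrable_integrable
        square_integrable_gauss_coord) auto
  then show ?thesis using False by (simp add: integral_gauss_coord)
qed

definition gauss_sum :: "nat set \<Rightarrow> (nat \<Rightarrow> real) \<Rightarrow> (nat \<Rightarrow> real) \<Rightarrow> real" where
  "gauss_sum I h x = (\<Sum>i\<in>I. h i * x i)"

lemma square_integrable_gauss_sum: "gauss.square_integrable (gauss_sum I h)"
  unfolding gauss_sum_def
  by (intro gauss.square_integrable_sum gauss.square_integrable_scale square_integrable_gauss_coord)

lemma integral_gauss_sum_coord:
  assumes "finite I"
  shows "(\<integral>x. gauss_sum I h x * x l \<partial>gauss) = (if l \<in> I then h l else 0)"
proof -
  have "(\<integral>x. gauss_sum I h x * x l \<partial>gauss) = (\<integral>x. (\<Sum>i\<in>I. h i * (x i * x l)) \<partial>gauss)"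
    by (simp add: gauss_sum_def sum_distrib_right mult.assoc)
  also have "\<dots> = (\<Sum>i\<in>I. h i * (\<integral>x. x i * x l \<partial>gauss))"
    by (subst Bochner_Integration.integral_sum)
      (auto intro!: gauss.integrable_product square_integrable_gauss_coord)
  also have "\<dots> = (if l \<in> I then h l else 0)"
    using assms by (simp add: integral_gauss_coord_product if_distrib[of "(*) _"] cong: if_cong)
  finally show ?thesis .
qed

lemma integral_gauss_sum_square:
  assumes "finite I"
  shows "(\<integral>x. (gauss_sum I h x)\<^sup>2 \<partial>gauss) = (\<Sum>i\<in>I. (h i)\<^sup>2)"
proof -
  have "(\<integral>x. (gauss_sum I h x)\<^sup>2 \<partial>gauss) = (\<integral>x. (\<Sum>i\<in>I. h i * (gauss_sum I h x * x i)) \<partial>gauss)"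
    by (intro Bochner_Integration.integral_cong)
      (simp_all add: power2_eq_square gauss_sum_def[of _ _ "_"] sum_distrib_left mult_ac)
  also have "\<dots> = (\<Sum>i\<in>I. h i * (\<integral>x. gauss_sum I h x * x i \<partial>gauss))"
    by (subst Bochner_Integration.integral_sum)
      (auto intro!: gauss.integrable_product square_integrable_gauss_coord square_integrable_gauss_sum)
  also have "\<dots> = (\<Sum>i\<in>I. (h i)\<^sup>2)"
    using assms by (simp add: integral_gauss_sum_coord power2_eq_square)
  finally show ?thesis .
qed

text \<open>
  The series defining \<open>\<xi>\<^sub>h\<close> converges because the coordinates are orthonormal; so the choice in the
  definition of \<open>gauss_xi\<close> picks its sum.
\<close>

lemma gauss_xi:
  assumes h: "h \<in> ell2"
  shows "gauss.square_integrable (gauss_xi h)"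
    and "(\<lambda>n. \<integral>x. (gauss_sum {..<n} h x - gauss_xi h x)\<^sup>2 \<partial>gauss) \<longlonglongrightarrow> 0"
proof -
  let ?f = "\<lambda>n. gauss_sum {..<n} h"
  have "\<exists>F. gauss.square_integrable F \<and> (\<lambda>n. \<integral>x. (?f n x - F x)\<^sup>2 \<partial>gauss) \<longlonglongrightarrow> 0"
  proof (rule gauss.L2_complete[OF square_integrable_gauss_sum])
    fix e :: real assume "e > 0"
    have "Cauchy (\<lambda>n. \<Sum>i<n. (h i)\<^sup>2)"
      using h by (simp add: ell2_def summable_iff_convergent Cauchy_convergent_iff)
    then obtain N where N: "\<And>m n. m \<ge> N \<Longrightarrow> n \<ge> N \<Longrightarrow> \<bar>(\<Sum>i<m. (h i)\<^sup>2) - (\<Sum>i<n. (h i)\<^sup>2)\<bar> < e"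
      using \<open>e > 0\<close> unfolding Cauchy_def dist_real_def by blast
    have diff: "(\<integral>x. (?f m x - ?f n x)\<^sup>2 \<partial>gauss)
        = (\<Sum>i<m. (h i)\<^sup>2) - (\<Sum>i<n. (h i)\<^sup>2)" if "n \<le> m" for m n
    proof -
      have "?f m x - ?f n x = gauss_sum {n..<m} h x" for x
        unfolding gauss_sum_def lessThan_atLeast0 using that by (simp add: sum_diff_nat_ivl)
      moreover have "(\<Sum>i<m. (h i)\<^sup>2) - (\<Sum>i<n. (h i)\<^sup>2) = (\<Sum>i=n..<m. (h i)\<^sup>2)"
        unfolding lessThan_atLeast0 using that by (simp add: sum_diff_nat_ivl)
      ultimately show ?thesis by (simp add: integral_gauss_sum_square)
    qed
    have "(\<integral>x. (?f m x - ?f n x)\<^sup>2 \<partial>gauss) < e" if "m \<ge> N" "n \<ge> N" for m n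
    proof (cases "n \<le> m")
      case True
      then show ?thesis using diff[OF True] N[OF that] by linarith
    next
      case False
      then show ?thesis
        using diff[of m n] N[OF that] by (simp add: power2_commute[of "?f m _"])
    qed
    then show "\<exists>N. \<forall>i\<ge>N. \<forall>j\<ge>N. (\<integral>x. (?f i x - ?f j x)\<^sup>2 \<partial>gauss) < e"
      by blast
  qed
  then have "\<exists>F. F \<in> borel_measurable gauss \<and> integrable gauss (\<lambda>x. (F x)\<^sup>2) \<and>
     (\<lambda>n. \<integral>x. ((\<Sum>i<n. h i * x i) - F x)\<^sup>2 \<partial>gauss) \<longlonglongrightarrow> 0"
    unfolding gauss.square_integrable_def gauss_sum_def by blast
  from someI_ex[OF this] show "gauss.square_integrable (gauss_xi h)"
      "(\<lambda>n. \<integral>x. (?f n x - gauss_xi h x)\<^sup>2 \<partial>gauss) \<longlonglongrightarrow> 0"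
    unfolding gauss.square_integrable_def gauss_sum_def gauss_xi_def by blast+
qed

lemma integral_gauss_xi_coord:
  assumes h: "h \<in> ell2"
  shows "(\<integral>x. gauss_xi h x * x l \<partial>gauss) = h l"
proof -
  note xi = gauss_xi[OF h]
  have "(\<lambda>n. \<integral>x. gauss_xi h x * x l \<partial>gauss) \<longlonglongrightarrow> h l"
  proof (rule LIMSEQ_I)
    fix e :: real assume "e > 0"
    then obtain N where N: "\<And>n. n \<ge> N \<Longrightarrow> (\<integral>x. (gauss_sum {..<n} h x - gauss_xi h x)\<^sup>2 \<partial>gauss) < e\<^sup>2"
      using LIMSEQ_D[OF xi(2), of "e\<^sup>2"] by fastforce
    define n where "n = max N (Suc l)"
    have D: "gauss.square_integrable (\<lambda>x. gauss_sum {..<n} h x - gauss_xi h x)"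
      by (intro gauss.square_integrable_minus square_integrable_gauss_sum xi(1))
    have "h l - (\<integral>x. gauss_xi h x * x l \<partial>gauss)
        = (\<integral>x. gauss_sum {..<n} h x * x l \<partial>gauss) - (\<integral>x. gauss_xi h x * x l \<partial>gauss)"
      by (simp add: integral_gauss_sum_coord n_def)
    also have "\<dots> = (\<integral>x. (gauss_sum {..<n} h x - gauss_xi h x) * x l \<partial>gauss)"
      by (simp add: left_diff_distrib gauss.integrable_product square_integrable_gauss_sum xi(1)
          square_integrable_gauss_coord)
    also have "\<bar>\<dots>\<bar> \<le> sqrt (\<integral>x. (gauss_sum {..<n} h x - gauss_xi h x)\<^sup>2 \<partial>gauss)"
      using gauss.Cauchy_Schwarz_integral[OF D square_integrable_gauss_coord[of l]]
      by (simp add: integral_gauss_coord_square)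
    also have "\<dots> < e"
      using N[of n] \<open>e > 0\<close> by (simp add: n_def real_less_lsqrt)
    finally have "\<bar>h l - (\<integral>x. gauss_xi h x * x l \<partial>gauss)\<bar> < e" .
    then show "\<exists>N. \<forall>n\<ge>N. norm ((\<integral>x. gauss_xi h x * x l \<partial>gauss) - h l) < e"
      by (simp add: abs_minus_commute)
  qed
  then show ?thesis by (simp add: LIMSEQ_const_iff)
qed

definition unit_vector :: "nat \<Rightarrow> nat \<Rightarrow> real" where
  "unit_vector i = (\<lambda>j. if j = i then 1 else 0)"

lemma unit_vector_ell2: "unit_vector i \<in> ell2"
proof -
  have "summable (\<lambda>j. (unit_vector i j)\<^sup>2)"
    by (rule summable_finite[of "{i}"]) (auto simp: unit_vector_def)
  then show ?thesis by (simp add: ell2_def)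
qed

lemma gauss_xi_unit_vector: "AE x in gauss. gauss_xi (unit_vector i) x = x i"
proof (rule gauss.L2_limit_unique[OF gauss_xi(1)[OF unit_vector_ell2] square_integrable_gauss_coord
      square_integrable_gauss_sum gauss_xi(2)[OF unit_vector_ell2]])
  have "gauss_sum {..<n} (unit_vector i) x = x i" if "n > i" for n x
    using that by (simp add: gauss_sum_def unit_vector_def if_distrib[of "\<lambda>a. a * _"] cong: if_cong)
  then have "\<forall>\<^sub>F n in sequentially. (\<integral>x. (gauss_sum {..<n} (unit_vector i) x - x i)\<^sup>2 \<partial>gauss) = 0"
    by (intro eventually_sequentiallyI[of "Suc i"]) simp
  then show "(\<lambda>n. \<integral>x. (gauss_sum {..<n} (unit_vector i) x - x i)\<^sup>2 \<partial>gauss) \<longlonglongrightarrow> 0"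
    by (rule tendsto_eventually)
qed

section \<open>Exchanging coordinates\<close>

definition exchange :: "nat \<Rightarrow> nat \<Rightarrow> nat" where
  "exchange j i = (if i < j then i + j else if i < 2 * j then i - j else i)"

lemma exchange_exchange [simp]: "exchange j (exchange j i) = i"
  by (auto simp: exchange_def)

lemma inj_exchange: "inj (exchange j)"
  by (metis exchange_exchange injI)

lemma exchange_fixed: "i \<ge> 2 * j \<Longrightarrow> exchange j i = i"
  by (auto simp: exchange_def)

definition exchange_coords :: "nat \<Rightarrow> (nat \<Rightarrow> real) \<Rightarrow> nat \<Rightarrow> real" where
  "exchange_coords j x = (\<lambda>i. x (exchange j i))"

lemma automorphism_exchange_coords: "automorphism gauss (exchange_coords j)"
proof -
  have meas: "exchange_coords j \<in> measurable gauss gauss"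
    unfolding exchange_coords_def by (rule measurable_into_gauss) measurable
  have "distr gauss gauss (\<lambda>x. \<lambda>i\<in>UNIV. x (exchange j i)) = gauss"
    unfolding gauss_def using inj_exchange
    by (intro distr_PiM_reindex[where M="\<lambda>_. std_gauss"] prob_space_std_gauss) auto
  then have "distr gauss gauss (exchange_coords j) = gauss"
    by (simp add: restrict_UNIV exchange_coords_def[abs_def])
  moreover have "ae_inverse gauss (exchange_coords j) (exchange_coords j)"
    using meas by (auto simp: ae_inverse_def exchange_coords_def)
  ultimately show ?thesis
    using meas unfolding automorphism_def by blast
qed

definition rectangle :: "nat set \<Rightarrow> (nat \<Rightarrow> real set) \<Rightarrow> (nat \<Rightarrow> real) set" where
  "rectangle J X = {x. \<forall>i\<in>J. x i \<in> X i}"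

lemma measure_rectangle:
  assumes "finite J" "\<And>i. i \<in> J \<Longrightarrow> X i \<in> sets borel"
  shows "measure gauss (rectangle J X) = (\<Prod>i\<in>J. measure std_gauss (X i))"
proof -
  interpret product_prob_space "\<lambda>_. std_gauss" UNIV
    by (intro product_prob_spaceI prob_space_std_gauss)
  have "prod_emb UNIV (\<lambda>_. std_gauss) J (Pi\<^sub>E J X) = rectangle J X"
    by (auto simp: prod_emb_def rectangle_def space_PiM)
  then show ?thesis
    using measure_PiM_emb[of J X] assms by (simp add: gauss_def)
qed

lemma sets_gauss_rectangles:
  "sets gauss = sigma_sets (space gauss) (prod_algebra UNIV (\<lambda>_. std_gauss))"
  unfolding gauss_def sets_PiM space_PiM ..

lemma prod_algebra_rectangleE:
  assumes "V \<in> prod_algebra UNIV (\<lambda>_. std_gauss)"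
  obtains J X where "finite J" "\<And>i. i \<in> J \<Longrightarrow> X i \<in> sets borel" "V = rectangle J X"
proof -
  obtain J X where J: "V = prod_emb UNIV (\<lambda>_. std_gauss) J (Pi\<^sub>E J X)" "finite J"
    "\<And>i. i \<in> J \<Longrightarrow> X i \<in> sets std_gauss"
    using assms by (elim prod_algebraE) blast
  have "V = rectangle J X"
    unfolding J(1) by (auto simp: prod_emb_def rectangle_def space_PiM)
  then show ?thesis using that[of J X] J by simp
qed

text \<open>
  For events that depend on the first \<open>j\<close> coordinates only, independence is exact: the exchange maps
  these coordinates to the next \<open>j\<close> ones.
\<close>

lemma exchange_coords_asymptotically_independent:
  assumes "A \<in> sets gauss" "B \<in> sets gauss"
  shows "asymptotically_independent gauss exchange_coords A B"
proof (rule gauss.asymptotically_independent_generated[OF sets_gauss_rectangles Int_stable_prod_algebra])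
  show "prod_algebra UNIV (\<lambda>_. std_gauss) \<subseteq> Pow (space gauss)"
    by simp
  show "exchange_coords j \<in> measurable gauss gauss" "distr gauss gauss (exchange_coords j) = gauss" for j
    using automorphismD(1,2)[OF automorphism_exchange_coords] by auto
  fix V V' :: "(nat \<Rightarrow> real) set"
  assume "V \<in> prod_algebra UNIV (\<lambda>_. std_gauss)" "V' \<in> prod_algebra UNIV (\<lambda>_. std_gauss)"
  then obtain J X J' X' where J: "finite J" "\<And>i. i \<in> J \<Longrightarrow> X i \<in> sets borel" "V = rectangle J X"
    and J': "finite J'" "\<And>i. i \<in> J' \<Longrightarrow> X' i \<in> sets borel" "V' = rectangle J' X'"
    by (elim prod_algebra_rectangleE) blast
  obtain j0 where j0: "J \<union> J' \<subseteq> {..<j0}"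
    using finite_nat_bounded[of "J \<union> J'"] J(1) J'(1) by blast
  have eq: "measure gauss (V \<inter> (exchange_coords j -` V' \<inter> space gauss)) = measure gauss V * measure gauss V'"
    if "j \<ge> j0" for j
  proof -
    let ?K = "exchange j ` J'"
    define Z where "Z i = (if i \<in> J then X i else X' (exchange j i))" for i
    have disj: "J \<inter> ?K = {}"
      using j0 that by (fastforce simp: exchange_def)
    have Z: "Z i = X i" if "i \<in> J" for i
      using that by (simp add: Z_def)
    have Z': "Z (exchange j i) = X' i" if "i \<in> J'" for i
      using that disj by (auto simp: Z_def)
    have "V \<inter> (exchange_coords j -` V' \<inter> space gauss) = rectangle (J \<union> ?K) Z"
      unfolding J(3) J'(3) rectangle_def exchange_coords_def using Z Z'
      by (simp add: set_eq_iff ball_Un)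
    then have "measure gauss (V \<inter> (exchange_coords j -` V' \<inter> space gauss))
        = (\<Prod>i\<in>J \<union> ?K. measure std_gauss (Z i))"
      using J J' Z Z' by (auto intro!: measure_rectangle)
    also have "\<dots> = (\<Prod>i\<in>J. measure std_gauss (Z i)) * (\<Prod>i\<in>?K. measure std_gauss (Z i))"
      using J(1) J'(1) disj by (intro prod.union_disjoint) auto
    also have "(\<Prod>i\<in>?K. measure std_gauss (Z i)) = (\<Prod>i\<in>J'. measure std_gauss (Z (exchange j i)))"
      by (subst prod.reindex) (auto intro: inj_on_subset[OF inj_exchange])
    finally show ?thesis
      using J J' by (simp add: measure_rectangle Z Z')
  qed
  show "asymptotically_independent gauss exchange_coords V V'"
    unfolding asymptotically_independent_def
    by (rule tendsto_eventually, rule eventually_sequentiallyI[of j0]) (rule eq)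
qed (use assms in auto)

section \<open>Gaussian suspensions\<close>

lemma ell2_minus:
  assumes "h \<in> ell2" "k \<in> ell2"
  shows "(\<lambda>i. h i - k i) \<in> ell2"
proof -
  have "summable (\<lambda>i. 2 * (h i)\<^sup>2 + 2 * (k i)\<^sup>2)"
    using assms by (auto simp: ell2_def intro!: summable_add summable_mult)
  then have "summable (\<lambda>i. (h i - k i)\<^sup>2)"
    by (rule summable_comparison_test'[where N=0])
      (use norm_add_squared_le[of "h _" "- k _"] in simp)
  then show ?thesis by (simp add: ell2_def)
qed

lemma ell2_orthogonal_inv_into:
  assumes U: "ell2_orthogonal U" and h: "h \<in> ell2"
  shows "inv_into ell2 U (U h) = h"
proof (rule inv_into_f_f[OF _ h], rule inj_onI)
  fix h k assume hk: "h \<in> ell2" "k \<in> ell2" "U h = U k"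
  define d where "d i = h i - k i" for i
  have d: "d \<in> ell2"
    unfolding d_def using hk by (intro ell2_minus)
  have "U (\<lambda>i. 1 * h i + (- 1) * k i) = (\<lambda>i. 1 * U h i + (- 1) * U k i)"
    using U hk unfolding ell2_orthogonal_def by blast
  then have "U d = (\<lambda>i. 0)"
    using hk by (simp add: d_def[abs_def])
  moreover have "(\<Sum>i. U d i * U d i) = (\<Sum>i. d i * d i)"
    using U d unfolding ell2_orthogonal_def by blast
  ultimately have "(\<Sum>i. (d i)\<^sup>2) = 0"
    by (simp add: power2_eq_square)
  then have "(d i)\<^sup>2 = 0" for i
    using d suminf_eq_zero_iff[of "\<lambda>i. (d i)\<^sup>2"] by (auto simp: ell2_def)
  then show "h = k"
    by (auto simp: d_def)
qed

lemma ell2_orthogonal_funpow: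
  assumes "ell2_orthogonal U" "h \<in> ell2"
  shows "(U ^^ n) h \<in> ell2"
  using assms by (induction n) (auto simp: ell2_orthogonal_def)

locale gaussian_automorphism =
  fixes U R
  assumes U: "ell2_orthogonal U" and R: "automorphism gauss R"
    and xi: "\<And>h. h \<in> ell2 \<Longrightarrow> AE x in gauss. gauss_xi h (R x) = gauss_xi (inv_into ell2 U h) x"
    and mix: "weakly_mixing gauss R"
begin

definition "V = aut_inv gauss R"

lemma automorphism_V: "automorphism gauss (V ^^ n)"
  unfolding V_def by (intro automorphism_funpow automorphism_aut_inv R)

text \<open>
  The relation \<open>\<xi>\<^sub>h \<circ> R = \<xi>\<close> of \<open>U\<^sup>-\<^sup>1 h\<close> turns, for the inverse \<open>V\<close> of \<open>R\<close>, into a relation with \<open>U\<close> itself.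
\<close>

lemma xi_V_funpow:
  assumes h: "h \<in> ell2"
  shows "AE x in gauss. gauss_xi h ((V ^^ n) x) = gauss_xi ((U ^^ n) h) x"
  using h
proof (induction n arbitrary: h)
  case (Suc n)
  have Uh: "U h \<in> ell2"
    using ell2_orthogonal_funpow[OF U Suc.prems, of 1] by simp
  have "AE x in gauss. gauss_xi (U h) (R (V x)) = gauss_xi (inv_into ell2 U (U h)) (V x)"
    by (rule AE_measure_preserving[OF automorphismD(1,2)[OF automorphism_V[of 1, simplified]] xi[OF Uh]])
  moreover have "AE x in gauss. R (V x) = x"
    using automorphismD(3)[OF R] by (simp add: ae_inverse_def V_def)
  ultimately have "AE x in gauss. gauss_xi h (V x) = gauss_xi (U h) x"
    by eventually_elim (simp add: ell2_orthogonal_inv_into[OF U Suc.prems])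
  then have "AE x in gauss. gauss_xi h (V ((V ^^ n) x)) = gauss_xi (U h) ((V ^^ n) x)"
    by (rule AE_measure_preserving[OF automorphismD(1,2)[OF automorphism_V]])
  with Suc.IH[OF Uh] show ?case
    by eventually_elim (simp add: funpow_Suc_right[of n U] del: funpow.simps(2), simp)
qed simp

lemma coord_V_funpow: "AE x in gauss. (V ^^ n) x i = gauss_xi ((U ^^ n) (unit_vector i)) x"
proof -
  have "AE x in gauss. gauss_xi (unit_vector i) ((V ^^ n) x) = (V ^^ n) x i"
    by (rule AE_measure_preserving[OF automorphismD(1,2)[OF automorphism_V] gauss_xi_unit_vector])
  with xi_V_funpow[OF unit_vector_ell2[of i], of n] show ?thesis
    by eventually_elim simp
qed

text \<open>
  The matrix entry of \<open>U\<^sup>n\<close> at \<open>(l, i)\<close> is the correlation of the coordinate \<open>l\<close>, transported by \<open>R\<^sup>n\<close>,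
  with the coordinate \<open>i\<close>.
\<close>

lemma matrix_entries_vanish: "cesaro_null (\<lambda>n. \<bar>(U ^^ n) (unit_vector i) l\<bar>)"
proof -
  have "(U ^^ n) (unit_vector i) l = gauss.correlation (R ^^ n) (\<lambda>x. x l) (\<lambda>x. x i)" for n
  proof -
    let ?h = "(U ^^ n) (unit_vector i)"
    note Rn = automorphismD(1,2)[OF automorphism_funpow[OF R, of n]]
    note Vn = automorphismD(1)[OF automorphism_V[of n]]
    note [measurable] = Rn(1) Vn
    have h: "?h \<in> ell2"
      by (intro ell2_orthogonal_funpow U unit_vector_ell2)
    have [measurable]: "gauss_xi ?h \<in> borel_measurable gauss"
      using gauss_xi(1)[OF h] by (simp add: gauss.square_integrable_def)
    have coord[measurable]: "(\<lambda>x. (V ^^ n) x i) \<in> borel_measurable gauss" "(\<lambda>x. (R ^^ n) x l) \<in> borel_measurable gauss"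
      using measurable_compose[OF Vn measurable_gauss_coord] measurable_compose[OF Rn(1) measurable_gauss_coord]
      by auto
    have "?h l = (\<integral>x. gauss_xi ?h x * x l \<partial>gauss)"
      by (rule integral_gauss_xi_coord[OF h, symmetric])
    also have "\<dots> = (\<integral>x. (V ^^ n) x i * x l \<partial>gauss)"
      using coord_V_funpow[of n i] by (intro integral_cong_AE) auto
    also have "\<dots> = (\<integral>x. (V ^^ n) ((R ^^ n) x) i * (R ^^ n) x l \<partial>gauss)"
      by (rule measure_preserving_integral[OF Rn, of "\<lambda>x. (V ^^ n) x i * x l", symmetric]) measurable
    also have "\<dots> = (\<integral>x. (R ^^ n) x l * x i \<partial>gauss)"
    proof (rule integral_cong_AE)
      have "AE x in gauss. (V ^^ n) ((R ^^ n) x) = x"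
        using ae_inverse_funpow[OF R automorphismD(3)[OF R], of n] by (simp add: ae_inverse_def V_def)
      then show "AE x in gauss. (V ^^ n) ((R ^^ n) x) i * (R ^^ n) x l = (R ^^ n) x l * x i"
        by eventually_elim simp
      show "(\<lambda>x. (V ^^ n) ((R ^^ n) x) i * (R ^^ n) x l) \<in> borel_measurable gauss"
        using measurable_compose[OF Rn(1) coord(1)] by measurable
    qed measurable
    finally show ?thesis
      by (simp add: gauss.correlation_def integral_gauss_coord)
  qed
  then show ?thesis
    using gauss.weakly_mixing_correlation[OF R mix square_integrable_gauss_coord square_integrable_gauss_coord]
    by simp
qed

end

text \<open>
  The change of \<open>\<xi>\<^sub>h\<close> under the exchange of coordinates.  It is a finite sum because the exchange moves
  finitely many coordinates only, and it is small when the first \<open>2 * j\<close> entries of \<open>h\<close> are.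
\<close>

definition exchange_drift :: "nat \<Rightarrow> (nat \<Rightarrow> real) \<Rightarrow> (nat \<Rightarrow> real) \<Rightarrow> real" where
  "exchange_drift j h x = (\<Sum>l<2 * j. h l * (x (exchange j l) - x l))"

lemma square_integrable_exchange_drift: "gauss.square_integrable (exchange_drift j h)"
  unfolding exchange_drift_def
  by (intro gauss.square_integrable_sum gauss.square_integrable_scale gauss.square_integrable_minus
      square_integrable_gauss_coord)

lemma gauss_xi_exchange_coords:
  assumes h: "h \<in> ell2"
  shows "AE x in gauss. gauss_xi h (exchange_coords j x) - gauss_xi h x = exchange_drift j h x"
proof -
  note S = automorphismD(1,2)[OF automorphism_exchange_coords[of j]]
  note xi = gauss_xi[OF h]
  have xiS: "gauss.square_integrable (\<lambda>x. gauss_xi h (exchange_coords j x))"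
    by (rule gauss.square_integrable_comp(1)[OF S xi(1)])
  have fS: "gauss.square_integrable (\<lambda>x. gauss_sum {..<n} h (exchange_coords j x))" for n
    by (rule gauss.square_integrable_comp(1)[OF S square_integrable_gauss_sum])
  have drift: "gauss_sum {..<n} h (exchange_coords j x) - gauss_sum {..<n} h x = exchange_drift j h x"
    if "n \<ge> 2 * j" for n x
  proof -
    have "gauss_sum {..<n} h (exchange_coords j x) - gauss_sum {..<n} h x
        = (\<Sum>l<n. h l * (x (exchange j l) - x l))"
      by (simp add: gauss_sum_def exchange_coords_def sum_subtractf right_diff_distrib)
    also have "\<dots> = exchange_drift j h x"
      unfolding exchange_drift_def using that
      by (intro sum.mono_neutral_right) (auto simp: exchange_fixed)
    finally show ?thesis .
  qed
  have "AE x in gauss. gauss_xi h (exchange_coords j x) = gauss_xi h x + exchange_drift j h x"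
  proof (rule gauss.L2_limit_unique[OF xiS gauss.square_integrable_add[OF xi(1) square_integrable_exchange_drift] fS])
    have "(\<integral>x. (gauss_sum {..<n} h (exchange_coords j x) - gauss_xi h (exchange_coords j x))\<^sup>2 \<partial>gauss)
        = (\<integral>x. (gauss_sum {..<n} h x - gauss_xi h x)\<^sup>2 \<partial>gauss)" for n
      by (rule gauss.square_integrable_comp(2)[OF S gauss.square_integrable_minus[OF square_integrable_gauss_sum xi(1)]])
    then show "(\<lambda>n. \<integral>x. (gauss_sum {..<n} h (exchange_coords j x) - gauss_xi h (exchange_coords j x))\<^sup>2 \<partial>gauss) \<longlonglongrightarrow> 0"
      using xi(2) by simp
    have "(\<integral>x. (gauss_sum {..<n} h (exchange_coords j x) - (gauss_xi h x + exchange_drift j h x))\<^sup>2 \<partial>gauss)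
        = (\<integral>x. (gauss_sum {..<n} h x - gauss_xi h x)\<^sup>2 \<partial>gauss)" if "n \<ge> 2 * j" for n
      unfolding drift[OF that, symmetric] by (simp add: algebra_simps)
    then have "\<forall>\<^sub>F n in sequentially. (\<integral>x. (gauss_sum {..<n} h x - gauss_xi h x)\<^sup>2 \<partial>gauss)
        = (\<integral>x. (gauss_sum {..<n} h (exchange_coords j x) - (gauss_xi h x + exchange_drift j h x))\<^sup>2 \<partial>gauss)"
      by (intro eventually_sequentiallyI[of "2 * j"]) simp
    then show "(\<lambda>n. \<integral>x. (gauss_sum {..<n} h (exchange_coords j x) - (gauss_xi h x + exchange_drift j h x))\<^sup>2 \<partial>gauss) \<longlonglongrightarrow> 0"
      by (rule Lim_transform_eventually[OF xi(2)])
  qed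
  then show ?thesis by eventually_elim simp
qed

lemma integral_abs_exchange_drift_le:
  "(\<integral>x. \<bar>exchange_drift j h x\<bar> \<partial>gauss) \<le> (\<Sum>l<2 * j. 2 * \<bar>h l\<bar>)"
proof -
  have abs1: "(\<integral>x. \<bar>x i\<bar> \<partial>gauss) \<le> 1" for i
  proof -
    have "(\<integral>x. \<bar>x i\<bar> \<partial>gauss)\<^sup>2 \<le> (\<integral>x. \<bar>x i\<bar>\<^sup>2 \<partial>gauss)"
      using square_integrable_gauss_coord[of i]
      by (intro gauss.integral_squared_le) (auto simp: gauss.square_integrable_def)
    then have "(\<integral>x. \<bar>x i\<bar> \<partial>gauss)\<^sup>2 \<le> 1"
      by (simp add: integral_gauss_coord_square)
    then show ?thesis by (simp add: power_le_one_iff abs_square_le_1)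
  qed
  have int: "integrable gauss (\<lambda>x. \<bar>x i\<bar>)" for i
    using gauss.square_integrable_integrable[OF square_integrable_gauss_coord] by (rule integrable_abs)
  have "(\<integral>x. \<bar>exchange_drift j h x\<bar> \<partial>gauss)
      \<le> (\<integral>x. (\<Sum>l<2 * j. \<bar>h l\<bar> * (\<bar>x (exchange j l)\<bar> + \<bar>x l\<bar>)) \<partial>gauss)"
  proof (rule integral_mono)
    show "integrable gauss (\<lambda>x. \<bar>exchange_drift j h x\<bar>)"
      using gauss.square_integrable_integrable[OF square_integrable_exchange_drift] by (rule integrable_abs)
    show "\<bar>exchange_drift j h x\<bar> \<le> (\<Sum>l<2 * j. \<bar>h l\<bar> * (\<bar>x (exchange j l)\<bar> + \<bar>x l\<bar>))" for x
      unfolding exchange_drift_def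
      by (intro order_trans[OF sum_abs] sum_mono) (simp add: abs_mult mult_left_mono abs_triangle_ineq4)
  qed (use int in auto)
  also have "\<dots> = (\<Sum>l<2 * j. \<bar>h l\<bar> * ((\<integral>x. \<bar>x (exchange j l)\<bar> \<partial>gauss) + (\<integral>x. \<bar>x l\<bar> \<partial>gauss)))"
    using int by (simp add: Bochner_Integration.integral_sum)
  also have "\<dots> \<le> (\<Sum>l<2 * j. \<bar>h l\<bar> * (1 + 1))"
    by (intro sum_mono mult_left_mono add_mono abs1) auto
  finally show ?thesis by (simp add: mult.commute)
qed

lemma sets_gauss_halfspaces:
  "sets gauss = sigma_sets (space gauss) {{x. x i \<le> a} | i a. True}" (is "_ = sigma_sets _ ?G")
proof
  have sub: "?G \<subseteq> sets gauss"
  proof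
    fix A assume "A \<in> ?G"
    then obtain i a where A: "A = {x \<in> space gauss. x i \<le> a}" by auto
    show "A \<in> sets gauss" unfolding A by measurable
  qed
  then show "sigma_sets (space gauss) ?G \<subseteq> sets gauss"
    by (rule sets.sigma_sets_subset)
  let ?S = "sigma (space gauss) ?G"
  have S: "sets ?S = sigma_sets (space gauss) ?G"
    by (intro sets_measure_of) auto
  have "(\<lambda>x. x i) \<in> borel_measurable ?S" for i
    unfolding borel_measurable_iff_le
  proof
    fix a
    have "{w \<in> space ?S. w i \<le> a} \<in> ?G" by auto
    then show "{w \<in> space ?S. w i \<le> a} \<in> sets ?S"
      unfolding S by (rule sigma_sets.Basic)
  qed
  then have "(\<lambda>x. x) \<in> measurable ?S gauss"
    by (rule measurable_into_gauss)
  then have "A \<in> sets ?S" if "A \<in> sets gauss" for A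
    using measurable_sets[of "\<lambda>x. x" ?S gauss A] that by simp
  then show "sets gauss \<subseteq> sigma_sets (space gauss) ?G"
    unfolding S by blast
qed

context gaussian_automorphism
begin

text \<open>
  A half-space of \<open>x i\<close> is transported by \<open>T\<^sup>n\<close> to the half-space of \<open>\<xi>\<^sub>h\<close> with \<open>h = U\<^sup>n e\<^sub>i\<close>.  The exchange
  of coordinates can change the side of a point only if the drift of \<open>\<xi>\<^sub>h\<close> exceeds \<open>d\<close>, or if \<open>\<xi>\<^sub>h\<close> lies within
  \<open>d\<close> of the boundary.  The former is rare on average by Markov's inequality and because the entries of
  \<open>h\<close> vanish on average; the latter has the probability of a thin slab, the same for all \<open>n\<close>.
\<close>

lemma exchange_coords_homoclinic: "exchange_coords j \<in> weak_homoclinic gauss R"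
proof (rule gauss.weak_homoclinicI_generated[OF R automorphism_exchange_coords sets_gauss_halfspaces])
  fix A :: "(nat \<Rightarrow> real) set" assume "A \<in> {{x. x i \<le> a} | i a. True}"
  then obtain i a where A: "A = {x. x i \<le> a}" by auto
  note S = automorphismD(1,2)[OF automorphism_exchange_coords[of j]]
  let ?h = "\<lambda>n. (U ^^ n) (unit_vector i)"
  let ?slab = "\<lambda>k. {x \<in> space gauss. \<bar>x i - a\<bar> \<le> 1 / real (Suc k)}"
  show "cesaro_null (\<lambda>n. moved gauss (exchange_coords j) (aut_inv gauss R ^^ n) A)"
  proof (rule cesaro_null_approx[OF moved_nonneg])
    fix e :: real assume "e > 0"
    \<comment> \<open>The Gaussian distribution has no atoms, so a thin slab around the hyperplane \<open>x i = a\<close> is small.\<close>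
    have "(\<lambda>k. measure gauss (?slab k))
        \<longlonglongrightarrow> measure gauss (\<Inter>k. ?slab k)"
    proof (rule gauss.finite_Lim_measure_decseq)
      show "decseq ?slab"
      proof (rule decseq_SucI, safe)
        fix k x assume "\<bar>x i - a\<bar> \<le> 1 / real (Suc (Suc k))"
        also have "\<dots> \<le> 1 / real (Suc k)" by (simp add: frac_le)
        finally show "\<bar>x i - a\<bar> \<le> 1 / real (Suc k)" .
      qed
      show "range ?slab \<subseteq> sets gauss"
        by (rule image_subsetI) measurable
    qed
    moreover have "(\<Inter>k. ?slab k) = rectangle {i} (\<lambda>_. {a})"
    proof (intro set_eqI iffI)
      fix x assume "x \<in> (\<Inter>k. ?slab k)"
      then have le: "\<bar>x i - a\<bar> \<le> 1 / real (Suc k)" for k by simp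
      have "x i = a"
      proof (rule ccontr)
        assume "x i \<noteq> a"
        then obtain k where "1 / real (Suc k) < \<bar>x i - a\<bar>"
          using nat_approx_posE[of "\<bar>x i - a\<bar>"] by auto
        with le[of k] show False by simp
      qed
      then show "x \<in> rectangle {i} (\<lambda>_. {a})" by (simp add: rectangle_def)
    qed (simp add: rectangle_def)
    moreover have "measure gauss (rectangle {i} (\<lambda>_. {a})) = 0"
    proof -
      have "emeasure std_gauss {a} = 0"
        by (subst emeasure_density) (auto intro!: nn_integral_0_iff_AE[THEN iffD2] AE_I'[of "{a}"] simp: indicator_def)
      then have "measure std_gauss {a} = 0" by (simp add: measure_def)
      then show ?thesis by (simp add: measure_rectangle)
    qed
    ultimately obtain k where k: "measure gauss (?slab k) < e"
      using LIMSEQ_D[of "\<lambda>k. measure gauss (?slab k)" 0 e] \<open>e > 0\<close>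
      by fastforce
    define d where "d = 1 / real (Suc k)"
    have "d > 0" by (simp add: d_def)
    have "moved gauss (exchange_coords j) (V ^^ n) A \<le> (\<Sum>l<2 * j. 2 / d * \<bar>?h n l\<bar>) + e" for n
    proof -
      note Vn = automorphismD(1,2)[OF automorphism_V[of n]]
      have [measurable]: "(\<lambda>x. (V ^^ n) x i) \<in> borel_measurable gauss"
        using measurable_compose[OF Vn(1) measurable_gauss_coord] .
      have [measurable]: "(\<lambda>x. (V ^^ n) (exchange_coords j x) i) \<in> borel_measurable gauss"
        using measurable_compose[OF S(1), of "\<lambda>x. (V ^^ n) x i"] by measurable
      have [measurable]: "exchange_drift j (?h n) \<in> borel_measurable gauss"
        using square_integrable_exchange_drift by (simp add: gauss.square_integrable_def)
      have h: "?h n \<in> ell2"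
        by (intro ell2_orthogonal_funpow U unit_vector_ell2)
      let ?B = "{x \<in> space gauss. \<bar>exchange_drift j (?h n) x\<bar> \<ge> d}"
      let ?C = "{x \<in> space gauss. \<bar>(V ^^ n) x i - a\<bar> \<le> d}"
      let ?D = "{x \<in> space gauss. ((V ^^ n) (exchange_coords j x) i \<le> a) \<noteq> ((V ^^ n) x i \<le> a)}"
      have "AE x in gauss. (V ^^ n) (exchange_coords j x) i = gauss_xi (?h n) (exchange_coords j x)"
        by (rule AE_measure_preserving[OF S coord_V_funpow])
      with coord_V_funpow[of n i] gauss_xi_exchange_coords[OF h, of j]
      have "AE x in gauss. x \<in> ?D \<longrightarrow> x \<in> ?B \<union> ?C"
        by eventually_elim auto
      then have "measure gauss ?D \<le> measure gauss (?B \<union> ?C)"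
        by (rule gauss.finite_measure_mono_AE) measurable
      also have "\<dots> \<le> measure gauss ?B + measure gauss ?C"
        by (intro measure_Un_le) measurable
      also have "measure gauss ?B \<le> (\<integral>x. \<bar>exchange_drift j (?h n) x\<bar> \<partial>gauss) / d"
        using \<open>d > 0\<close> gauss.square_integrable_integrable[OF square_integrable_exchange_drift]
        by (intro integral_Markov_inequality_measure[where A="{}"]) auto
      also have "\<dots> \<le> (\<Sum>l<2 * j. 2 * \<bar>?h n l\<bar>) / d"
        using \<open>d > 0\<close> by (intro divide_right_mono integral_abs_exchange_drift_le) simp
      also have "(\<Sum>l<2 * j. 2 * \<bar>?h n l\<bar>) / d = (\<Sum>l<2 * j. 2 / d * \<bar>?h n l\<bar>)"
        by (simp add: sum_divide_distrib)
      also have "measure gauss ?C = measure gauss {x \<in> space gauss. \<bar>x i - a\<bar> \<le> d}"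
        by (rule measure_preserving_Collect[OF Vn, where Q="\<lambda>x. \<bar>x i - a\<bar> \<le> d"]) measurable
      finally show ?thesis
        using k by (simp add: moved_def A d_def)
    qed
    moreover have "cesaro_null (\<lambda>n. \<Sum>l<2 * j. 2 / d * \<bar>?h n l\<bar>)"
      by (intro cesaro_null_sum cesaro_null_cmult matrix_entries_vanish)
    ultimately show "\<exists>b. cesaro_null b \<and>
        (\<forall>n. moved gauss (exchange_coords j) (aut_inv gauss R ^^ n) A \<le> b n + e)"
      unfolding V_def by blast
  qed
qed

lemma mixing_sequence_exchange_coords: "mixing_sequence gauss R exchange_coords"
  unfolding mixing_sequence_def
  using exchange_coords_homoclinic exchange_coords_asymptotically_independent by blast

end

lemma ergodic_weak_homoclinic_gaussian:
  assumes M: "prob_space M" and T: "automorphism M T" and wm: "weakly_mixing M T"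
    and U: "ell2_orthogonal U" and sus: "gaussian_suspension_of U M T"
  shows "ergodic_subgroup M (weak_homoclinic M T)"
proof -
  obtain R where R: "automorphism gauss R" and iso: "isomorphic_mod0 M T gauss R"
    and xi: "\<forall>h\<in>ell2. AE x in gauss. gauss_xi h (R x) = gauss_xi (inv_into ell2 U h) x"
    using sus unfolding gaussian_suspension_of_def by blast
  interpret gaussian_automorphism U R
    using U R xi weakly_mixing_transfer[OF wm iso M T R] by unfold_locales auto
  obtain S where "mixing_sequence M T S"
    using mixing_sequence_transfer[OF M T R iso mixing_sequence_exchange_coords] by blast
  then show ?thesis
    by (rule prob_space.ergodic_weak_homoclinicI[OF M T])
qed

section \<open>Ergodicity of the weak homoclinic group\<close>

theorem theorem2:
  fixes M :: "'x measure" and T :: "'x \<Rightarrow> 'x"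
  assumes "standard_probability_space M"
    and "automorphism M T"
    and "weakly_mixing M T"
    and "(\<exists>(Y :: 'y measure) T0. standard_infinite_space Y \<and> automorphism Y T0 \<and>
            poisson_suspension_of Y T0 M T) \<or>
         (\<exists>U. ell2_orthogonal U \<and> gaussian_suspension_of U M T)"
  shows "ergodic_subgroup M (weak_homoclinic M T)"
proof -
  have M: "prob_space M"
    using assms(1) by (simp add: standard_probability_space_def)
  from assms(4) show ?thesis
  proof (elim disjE exE conjE)
    fix Y :: "'y measure" and T0
    assume "standard_infinite_space Y" "automorphism Y T0" "poisson_suspension_of Y T0 M T"
    then show ?thesis
      by (intro ergodic_weak_homoclinic_poisson[OF M assms(2,3)])
        (simp_all add: standard_infinite_space_def)
  next
    fix U
    assume "ell2_orthogonal U" "gaussian_suspension_of U M T"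
    then show ?thesis
      by (rule ergodic_weak_homoclinic_gaussian[OF M assms(2,3)])
  qed
qed

end
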